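(* Let $T$ be a supercritical Galton-Watson tree conditioned to survive. Then every component of the wired uniform spanning forest of $T$ is one-ended almost surely (that is, for almost every realization of $T$, if $F$ is sampled with law $\mathsf{WUSF}_T$ then almost surely every connected component of $F$ is one-ended).
   Context: A Galton-Watson tree with offspring distribution $\langle p_k\rangle_{k\ge0}$ is the random genealogical tree started from one root in which each vertex independently has $k$ children with probability $p_k$. It is supercritical if $\sum_k k p_k>1$; in this case it is infinite ("survives") with positive probability, and conditioned to survive means conditioned on the event that it is infinite. It is regarded as a network with unit conductances. Wired uniform spanning forest. Let $G$ be an infinite, locally finite, connected graph with edge set $\mathsf E$. An exhaustion of $G$ is an increasing sequence of finite connected subgraphs $G_n$ with $\bigcup_n G_n=G$. $G_n^*$ is the finite graph obtained from $G$ by identifying all vertices of $G\setminus G_n$ into a single vertex $\partial_n$ and deleting all self-loops that are created (multiple edges are kept). For a finite graph $H$, $\mathsf{UST}_H$ is the uniform measure on the spanning trees of $H$. The wired uniform spanning forest measure $\mathsf{WUSF}_G$ is the weak limit of $\mathsf{UST}_{G_n^*}$: for each finite $S\subset\mathsf E$, $\mathsf{WUSF}_G(S\subseteq F)=\lim_{n\to\infty}\mathsf{UST}_{G_n^*}(S\subseteq T_n)$, where $T_n$ denotes the random spanning tree of $G_n^*$. The limit exists and does not depend on the exhaustion. It is supported on spanning forests (cycle-free subgraphs containing every vertex) all of whose components are infinite. Ends. An infinite graph is $k$-ended if, over all finite sets of vertices $W$, the graph obtained by deleting $W$ has a maximum of $k$ distinct infinite connected components. An infinite tree is one-ended iff it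 contains no simple bi-infinite path. *)

theory Defs
  imports "HOL-Probability.Probability"
begin

section \<open>Undirected multigraphs\<close>

text \<open>Every edge \<open>e\<close> joins the vertices in \<open>ends e\<close>; a self-loop is an edge with a single end.
  Distinct edges may have the same ends.\<close>

record ('v, 'e) mgraph =
  verts :: "'v set"
  edges :: "'e set"
  ends :: "'e \<Rightarrow> 'v set"

definition wf_graph :: "('v, 'e) mgraph \<Rightarrow> bool" where
  "wf_graph G \<longleftrightarrow> (\<forall>e\<in>edges G. ends G e \<subseteq> verts G \<and> (card (ends G e) = 1 \<or> card (ends G e) = 2))"

definition subgraph :: "('v, 'e) mgraph \<Rightarrow> ('v, 'e) mgraph \<Rightarrow> bool" where
  "subgraph H G \<longleftrightarrow> wf_graph H \<and> verts H \<subseteq> verts G \<and> edges H \<subseteq> edges G \<and>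
     (\<forall>e\<in>edges H. ends H e = ends G e)"

definition induced :: "('v, 'e) mgraph \<Rightarrow> 'v set \<Rightarrow> ('v, 'e) mgraph" where
  "induced G U = \<lparr>verts = verts G \<inter> U, edges = {e \<in> edges G. ends G e \<subseteq> U}, ends = ends G\<rparr>"

definition walk :: "('v, 'e) mgraph \<Rightarrow> 'v list \<Rightarrow> 'e list \<Rightarrow> bool" where
  "walk G vs es \<longleftrightarrow> length vs = Suc (length es) \<and> set vs \<subseteq> verts G \<and> set es \<subseteq> edges G \<and>
     (\<forall>i<length es. ends G (es ! i) = {vs ! i, vs ! Suc i})"

definition cycle :: "('v, 'e) mgraph \<Rightarrow> 'v list \<Rightarrow> 'e list \<Rightarrow> bool" where
  "cycle G vs es \<longleftrightarrow> walk G vs es \<and> es \<noteq> [] \<and> hd vs = last vs \<and> distinct (tl vs) \<and> distinct es"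

definition reachable :: "('v, 'e) mgraph \<Rightarrow> 'v \<Rightarrow> 'v \<Rightarrow> bool" where
  "reachable G u v \<longleftrightarrow> (\<exists>vs es. walk G vs es \<and> hd vs = u \<and> last vs = v)"

definition connected_graph :: "('v, 'e) mgraph \<Rightarrow> bool" where
  "connected_graph G \<longleftrightarrow> verts G \<noteq> {} \<and> (\<forall>u\<in>verts G. \<forall>v\<in>verts G. reachable G u v)"

definition graph_components :: "('v, 'e) mgraph \<Rightarrow> ('v, 'e) mgraph set" where
  "graph_components G = (\<lambda>v. induced G {u. reachable G v u}) ` verts G"

section \<open>Ends\<close>

definition infinite_components_without :: "('v, 'e) mgraph \<Rightarrow> 'v set \<Rightarrow> ('v, 'e) mgraph set" where
  "infinite_components_without G W =
     {K \<in> graph_components (induced G (verts G - W)). infinite (verts K)}"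

definition k_ended :: "nat \<Rightarrow> ('v, 'e) mgraph \<Rightarrow> bool" where
  "k_ended k G \<longleftrightarrow> infinite (verts G) \<and>
     (\<forall>W. finite W \<and> W \<subseteq> verts G \<longrightarrow>
        finite (infinite_components_without G W) \<and> card (infinite_components_without G W) \<le> k) \<and>
     (\<exists>W. finite W \<and> W \<subseteq> verts G \<and> card (infinite_components_without G W) = k)"

abbreviation one_ended :: "('v, 'e) mgraph \<Rightarrow> bool" where
  "one_ended G \<equiv> k_ended 1 G"

section \<open>Uniform spanning trees and the wired uniform spanning forest\<close>

definition spanning_tree :: "('v, 'e) mgraph \<Rightarrow> 'e set \<Rightarrow> bool" where
  "spanning_tree H T \<longleftrightarrow> T \<subseteq> edges H \<and> connected_graph (H\<lparr>edges := T\<rparr>) \<and>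
     (\<nexists>vs es. cycle (H\<lparr>edges := T\<rparr>) vs es)"

definition UST :: "('v, 'e) mgraph \<Rightarrow> 'e set pmf" where
  "UST H = pmf_of_set {T. spanning_tree H T}"

definition exhaustion :: "('v, 'e) mgraph \<Rightarrow> (nat \<Rightarrow> ('v, 'e) mgraph) \<Rightarrow> bool" where
  "exhaustion G Gs \<longleftrightarrow>
     (\<forall>n. finite (verts (Gs n)) \<and> finite (edges (Gs n)) \<and> connected_graph (Gs n) \<and>
          subgraph (Gs n) G \<and> subgraph (Gs n) (Gs (Suc n))) \<and>
     (\<Union>n. verts (Gs n)) = verts G \<and> (\<Union>n. edges (Gs n)) = edges G"

text \<open>The quotient of \<open>G\<close> in which all vertices outside \<open>U\<close> are identified to the vertex \<open>None\<close>.
  The edges with no end in \<open>U\<close> are those that become self-loops at \<open>None\<close>.\<close>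

definition wired :: "('v, 'e) mgraph \<Rightarrow> 'v set \<Rightarrow> ('v option, 'e) mgraph" where
  "wired G U =
     \<lparr>verts = insert None (Some ` U),
      edges = {e \<in> edges G. ends G e \<inter> U \<noteq> {}},
      ends = (\<lambda>e. (\<lambda>v. if v \<in> U then Some v else None) ` ends G e)\<rparr>"

definition edge_config_algebra :: "('v, 'e) mgraph \<Rightarrow> 'e set measure" where
  "edge_config_algebra G = sigma (Pow (edges G)) ((\<lambda>e. {F \<in> Pow (edges G). e \<in> F}) ` edges G)"

definition is_WUSF :: "('v, 'e) mgraph \<Rightarrow> 'e set measure \<Rightarrow> bool" where
  "is_WUSF G \<mu> \<longleftrightarrow> prob_space \<mu> \<and> sets \<mu> = sets (edge_config_algebra G) \<and>
     (\<forall>Gs S. exhaustion G Gs \<and> finite S \<and> S \<subseteq> edges G \<longrightarrow>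
        (\<lambda>n. measure_pmf.prob (UST (wired G (verts (Gs n)))) {T. S \<subseteq> T})
          \<longlonglongrightarrow> measure \<mu> {F \<in> space \<mu>. S \<subseteq> F})"

text \<open>For an infinite, locally finite, connected graph exactly one measure satisfies
  \<^const>\<open>is_WUSF\<close>.\<close>

definition WUSF :: "('v, 'e) mgraph \<Rightarrow> 'e set measure" where
  "WUSF G = (THE \<mu>. is_WUSF G \<mu>)"

section \<open>Galton-Watson trees\<close>

text \<open>Ulam-Harris encoding: the root is \<open>[]\<close>, the \<open>i\<close>-th child of \<open>u\<close> is \<open>u @ [i]\<close>, and \<open>\<omega> u\<close> is
  the number of children of \<open>u\<close>. The values of \<open>\<omega>\<close> outside the tree are irrelevant.\<close>

definition gw_verts :: "(nat list \<Rightarrow> nat) \<Rightarrow> nat list set" where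
  "gw_verts \<omega> = {w. \<forall>i<length w. w ! i < \<omega> (take i w)}"

definition gw_tree :: "(nat list \<Rightarrow> nat) \<Rightarrow> (nat list, nat list set) mgraph" where
  "gw_tree \<omega> =
     \<lparr>verts = gw_verts \<omega>,
      edges = {{u, u @ [i]} | u i. u \<in> gw_verts \<omega> \<and> i < \<omega> u},
      ends = (\<lambda>e. e)\<rparr>"

definition supercritical :: "nat pmf \<Rightarrow> bool" where
  "supercritical p \<longleftrightarrow> (\<Sum>k. of_nat k * ennreal (pmf p k)) > 1"

definition gw_measure :: "nat pmf \<Rightarrow> (nat list \<Rightarrow> nat) measure" where
  "gw_measure p = PiM UNIV (\<lambda>_. measure_pmf p)"

definition survival :: "(nat list \<Rightarrow> nat) set" where
  "survival = {\<omega>. infinite (verts (gw_tree \<omega>))}"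

lemma survival_measurable: "survival \<in> sets (gw_measure p)"
proof -
  have sp: "space (gw_measure p) = UNIV"
    by (simp add: gw_measure_def space_PiM)
  have *: "{\<omega>. w \<in> gw_verts \<omega>} \<in> sets (gw_measure p)" for w
  proof -
    have "(\<lambda>\<omega>. \<omega> u) \<in> gw_measure p \<rightarrow>\<^sub>M count_space UNIV" for u
      unfolding gw_measure_def
      by (rule measurable_compose[OF measurable_component_singleton]) auto
    then have "{\<omega>\<in>space (gw_measure p). \<forall>i<length w. w ! i < \<omega> (take i w)} \<in> sets (gw_measure p)"
      by measurable
    then show ?thesis
      by (simp add: sp gw_verts_def)
  qed
  have "survival = (\<Inter>A\<in>{A. finite A}. \<Union>w\<in>- A. {\<omega>. w \<in> gw_verts \<omega>})"
  proof -
    have "infinite (X :: nat list set) \<longleftrightarrow> (\<forall>A. finite A \<longrightarrow> (\<exists>w\<in>-A. w \<in> X))" for X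
      by (metis ComplI ComplD finite_subset subsetI)
    then show ?thesis
      by (auto simp: survival_def gw_tree_def)
  qed
  also have "\<dots> \<in> sets (gw_measure p)"
    using * by (intro sets.countable_INT'' sets.countable_UN'' sets.countable_INT')
      (auto intro: countable_Collect_finite)
  finally show ?thesis .
qed

definition gw_survival_measure :: "nat pmf \<Rightarrow> (nat list \<Rightarrow> nat) measure" where
  "gw_survival_measure p = uniform_measure (gw_measure p) survival"

end

theory Submission imports Defs begin

text \<open>Write \<open>b v\<close> for the probability that the random walk on the tree started at \<open>v\<close> never visits the
  parent of \<open>v\<close>. By Wilson's algorithm, orienting every edge of the forest towards infinity, the
  forest can be sampled from independent choices at the vertices: the path from \<open>v\<close> goes down with
  probability \<open>b v\<close>, to a child \<open>w\<close> chosen with probability proportional to \<open>b w\<close>. The escape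
  probabilities of the wired finite graphs give the uniform spanning trees in the same way, and they
  converge to \<open>b\<close>. Every component of the forest is one-ended as soon as the set of vertices whose
  path passes through a given vertex is finite. These sets are controlled by percolation that retains
  the edge above \<open>v\<close> with probability \<open>1 - b v\<close>. On a Galton-Watson tree, stationarity under the
  harmonic flow forces at most one child of a vertex to have a positive probability of being connected
  to infinity, and branching then makes this probability zero.\<close>

section \<open>Escape probabilities and percolation on trees\<close>

text \<open>Wilson's algorithm itself is not run. For finite \<open>U\<close>, the product law of
  the choices is computed on cylinders: as \<open>escape U\<close> is 1 outside \<open>U\<close>,
  all admissible orientations of \<open>U\<close> get the same probability, which is uniformity. The
  same computation on a fixed finite \<open>A\<close> inside \<open>U\<close> gives a formula that
  is continuous in the escape probabilities and so passes to the limit.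

  The retention probability \<open>1 - b v\<close> arises because a path climbs from
  \<open>v\<close> to its parent only if the independent choice at \<open>v\<close> says so, which
  has probability \<open>1 - b v\<close>. The past of a vertex therefore lies in the retained
  clusters of its ancestors.

  A Galton-Watson tree seen from its root is not stationary: a typical vertex has a branch through
  its parent besides its \<open>k\<close> children. Hanging an independent tree there makes all
  \<open>k + 1\<close> branches exchangeable, and this augmented tree carries the stationarity
  argument.

  No moment of the offspring law is assumed and the mean may be infinite. Hence supercriticality
  enters through a truncated mean, and the harmonic weights are normalised to be at most 1, so that
  equality of two integrals can be turned into almost sure equality.\<close>

text \<open>The sum over the children of \<open>v\<close> is the effective conductance from \<open>v\<close> downwards, and the
  unit edge to the parent of \<open>v\<close> in series with it gives \<open>S / (1 + S)\<close>. Vertices outside \<open>U\<close>, and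
  those \<open>n\<close> levels below \<open>v\<close>, are wired to infinity.\<close>

primrec escape_upto :: "nat list set \<Rightarrow> (nat list \<Rightarrow> nat) \<Rightarrow> nat \<Rightarrow> nat list \<Rightarrow> real" where
  "escape_upto U \<omega> 0 v = 1"
| "escape_upto U \<omega> (Suc n) v = (if v \<in> U
     then (\<Sum>i<\<omega> v. escape_upto U \<omega> n (v @ [i])) / (1 + (\<Sum>i<\<omega> v. escape_upto U \<omega> n (v @ [i])))
     else 1)"

definition escape :: "nat list set \<Rightarrow> (nat list \<Rightarrow> nat) \<Rightarrow> nat list \<Rightarrow> real" where
  "escape U \<omega> v = lim (\<lambda>n. escape_upto U \<omega> n v)"

text \<open>This is the probability that percolation retaining the edge above each \<open>w\<close>
  independently with probability \<open>r w\<close> joins \<open>v\<close> to a vertex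
  \<open>n\<close> levels below it.\<close>

primrec perc_upto :: "(nat list \<Rightarrow> real) \<Rightarrow> (nat list \<Rightarrow> nat) \<Rightarrow> nat \<Rightarrow> nat list \<Rightarrow> real" where
  "perc_upto r \<omega> 0 v = 1"
| "perc_upto r \<omega> (Suc n) v = 1 - (\<Prod>i<\<omega> v. 1 - r (v @ [i]) * perc_upto r \<omega> n (v @ [i]))"

definition perc :: "(nat list \<Rightarrow> real) \<Rightarrow> (nat list \<Rightarrow> nat) \<Rightarrow> nat list \<Rightarrow> real" where
  "perc r \<omega> v = lim (\<lambda>n. perc_upto r \<omega> n v)"

definition subtree :: "(nat list \<Rightarrow> nat) \<Rightarrow> nat list \<Rightarrow> nat list \<Rightarrow> nat" where
  "subtree \<omega> v = (\<lambda>w. \<omega> (v @ w))"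

lemma series_mono: "0 \<le> x \<Longrightarrow> x \<le> y \<Longrightarrow> x / (1 + x) \<le> y / (1 + y :: real)"
  by (simp add: divide_simps) (simp add: algebra_simps)

lemma escape_upto_bounds: "0 \<le> escape_upto U \<omega> n v \<and> escape_upto U \<omega> n v \<le> 1"
proof (induction n arbitrary: v)
  case (Suc n)
  then have "0 \<le> (\<Sum>i<\<omega> v. escape_upto U \<omega> n (v @ [i]))" by (intro sum_nonneg) auto
  then show ?case by (auto simp: divide_simps)
qed simp

lemma escape_upto_nonneg [simp]: "0 \<le> escape_upto U \<omega> n v"
  and escape_upto_le_1 [simp]: "escape_upto U \<omega> n v \<le> 1"
  using escape_upto_bounds by auto

lemma escape_upto_sum_nonneg [simp]: "0 \<le> (\<Sum>i<k. escape_upto U \<omega> n (g i))"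
  by (intro sum_nonneg) auto

text \<open>Rayleigh monotonicity: wiring to infinity one level lower can only reduce the
  conductance. This makes the \<open>lim\<close> in \<open>escape\<close> a genuine limit.\<close>

lemma escape_upto_decreasing: "escape_upto U \<omega> (Suc n) v \<le> escape_upto U \<omega> n v"
proof (induction n arbitrary: v)
  case 0
  show ?case using escape_upto_le_1[of U \<omega> "Suc 0" v] by (simp only: escape_upto.simps(1))
next
  case (Suc n)
  have "(\<Sum>i<\<omega> v. escape_upto U \<omega> (Suc n) (v @ [i])) \<le> (\<Sum>i<\<omega> v. escape_upto U \<omega> n (v @ [i]))"
    by (intro sum_mono Suc)
  from series_mono[OF escape_upto_sum_nonneg this] show ?case
    by (simp only: escape_upto.simps(2) if_split) simp
qed

lemma decseq_escape_upto: "decseq (\<lambda>n. escape_upto U \<omega> n v)"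
  by (rule decseq_SucI) (rule escape_upto_decreasing)

lemma escape_upto_LIMSEQ: "(\<lambda>n. escape_upto U \<omega> n v) \<longlonglongrightarrow> escape U \<omega> v"
  unfolding escape_def
  by (rule convergent_LIMSEQ_iff[THEN iffD1], rule Bseq_monoseq_convergent)
     (auto intro!: BseqI'[of _ 1] decseq_imp_monoseq decseq_escape_upto)

lemma escape_le_upto: "escape U \<omega> v \<le> escape_upto U \<omega> n v"
  by (rule decseq_ge[OF decseq_escape_upto escape_upto_LIMSEQ])

lemma escape_nonneg [simp]: "0 \<le> escape U \<omega> v"
  by (rule LIMSEQ_le_const[OF escape_upto_LIMSEQ]) auto

lemma escape_le_1 [simp]: "escape U \<omega> v \<le> 1"
  using escape_le_upto[of U \<omega> v 0] by simp

lemma escape_sum_nonneg [simp]: "0 \<le> (\<Sum>i<k. escape U \<omega> (g i))"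
  by (intro sum_nonneg) auto

lemma escape_rec:
  assumes "v \<in> U"
  shows "escape U \<omega> v = (\<Sum>i<\<omega> v. escape U \<omega> (v @ [i])) / (1 + (\<Sum>i<\<omega> v. escape U \<omega> (v @ [i])))"
proof -
  have "1 + (\<Sum>i<\<omega> v. escape U \<omega> (v @ [i])) \<noteq> 0"
    using escape_sum_nonneg[where k = "\<omega> v" and U = U and \<omega> = \<omega> and g = "\<lambda>i. v @ [i]"] by linarith
  then have "(\<lambda>n. escape_upto U \<omega> (Suc n) v) \<longlonglongrightarrow>
      (\<Sum>i<\<omega> v. escape U \<omega> (v @ [i])) / (1 + (\<Sum>i<\<omega> v. escape U \<omega> (v @ [i])))"
    using assms by (auto intro!: tendsto_intros escape_upto_LIMSEQ)
  with escape_upto_LIMSEQ[THEN LIMSEQ_Suc] show ?thesis by (rule LIMSEQ_unique)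
qed

lemma escape_outside: "v \<notin> U \<Longrightarrow> escape U \<omega> v = 1"
proof (rule LIMSEQ_unique[OF escape_upto_LIMSEQ])
  assume "v \<notin> U"
  then have "escape_upto U \<omega> n v = 1" for n by (cases n) auto
  then show "(\<lambda>n. escape_upto U \<omega> n v) \<longlonglongrightarrow> 1" by simp
qed

text \<open>Rayleigh monotonicity again: enlarging \<open>U\<close> wires less of the tree to
  infinity.\<close>

lemma escape_upto_antimono: "U \<subseteq> V \<Longrightarrow> escape_upto V \<omega> n v \<le> escape_upto U \<omega> n v"
proof (induction n arbitrary: v)
  case (Suc n)
  then have "(\<Sum>i<\<omega> v. escape_upto V \<omega> n (v @ [i])) \<le> (\<Sum>i<\<omega> v. escape_upto U \<omega> n (v @ [i]))"
    by (intro sum_mono) auto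
  from series_mono[OF escape_upto_sum_nonneg this] show ?case
    using Suc.prems escape_upto_bounds[of V \<omega> "Suc n" v] by auto
qed simp

lemma escape_antimono: "U \<subseteq> V \<Longrightarrow> escape V \<omega> v \<le> escape U \<omega> v"
  by (rule LIMSEQ_le[OF escape_upto_LIMSEQ escape_upto_LIMSEQ])
     (auto intro: escape_upto_antimono)

lemma gw_verts_Nil [simp]: "[] \<in> gw_verts \<omega>"
  by (simp add: gw_verts_def)

lemma gw_verts_snoc: "v @ [i] \<in> gw_verts \<omega> \<longleftrightarrow> v \<in> gw_verts \<omega> \<and> i < \<omega> v"
  by (auto simp: gw_verts_def nth_append less_Suc_eq)

lemma gw_verts_Cons: "i # w \<in> gw_verts \<omega> \<longleftrightarrow> i < \<omega> [] \<and> w \<in> gw_verts (subtree \<omega> [i])"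
  by (auto simp: gw_verts_def less_Suc_eq_0_disj subtree_def)

lemma gw_verts_append: "v @ w \<in> gw_verts \<omega> \<longleftrightarrow> v \<in> gw_verts \<omega> \<and> w \<in> gw_verts (subtree \<omega> v)"
proof (induction w rule: rev_induct)
  case (snoc i w)
  then show ?case
    using gw_verts_snoc[of "v @ w" i \<omega>] gw_verts_snoc[of w i "subtree \<omega> v"]
    by (auto simp: subtree_def)
qed simp

text \<open>Once the sets \<open>U k\<close> contain the tree up to level \<open>n\<close> below \<open>v\<close>, their escape probabilities
  are squeezed between \<open>escape UNIV \<omega> v\<close> and \<open>escape_upto UNIV \<omega> n v\<close>.\<close>

lemma escape_exhaustion:
  assumes U: "\<And>v. v \<in> gw_verts \<omega> \<Longrightarrow> eventually (\<lambda>k. v \<in> U k) sequentially"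
  assumes v: "v \<in> gw_verts \<omega>"
  shows "(\<lambda>k. escape (U k) \<omega> v) \<longlonglongrightarrow> escape UNIV \<omega> v"
proof -
  have ev: "eventually (\<lambda>k. \<forall>m\<ge>n. escape_upto (U k) \<omega> m v \<le> escape_upto UNIV \<omega> n v) sequentially"
    if "v \<in> gw_verts \<omega>" for n v
    using that
  proof (induction n arbitrary: v)
    case (Suc n)
    have "eventually (\<lambda>k. \<forall>i\<in>{..<\<omega> v}. \<forall>m\<ge>n.
        escape_upto (U k) \<omega> m (v @ [i]) \<le> escape_upto UNIV \<omega> n (v @ [i])) sequentially"
      using Suc by (intro eventually_ball_finite) (auto simp: gw_verts_snoc)
    with U[OF Suc.prems] show ?case
    proof eventually_elim
      case (elim k)
      show ?case
      proof (intro allI impI)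
        fix m assume "Suc n \<le> m"
        then obtain m' where m': "m = Suc m'" "n \<le> m'" by (cases m) auto
        have "(\<Sum>i<\<omega> v. escape_upto (U k) \<omega> m' (v @ [i])) \<le> (\<Sum>i<\<omega> v. escape_upto UNIV \<omega> n (v @ [i]))"
          using elim m' by (intro sum_mono) auto
        from series_mono[OF escape_upto_sum_nonneg this]
        show "escape_upto (U k) \<omega> m v \<le> escape_upto UNIV \<omega> (Suc n) v"
          using elim m' by simp
      qed
    qed
  qed simp
  show ?thesis
  proof (rule order_tendstoI)
    fix a assume "a < escape UNIV \<omega> v"
    then have "a < escape (U k) \<omega> v" for k
      using escape_antimono[of "U k" UNIV \<omega> v] by simp
    then show "eventually (\<lambda>k. a < escape (U k) \<omega> v) sequentially" by simp
  next
    fix a assume "escape UNIV \<omega> v < a"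
    then obtain n where n: "escape_upto UNIV \<omega> n v < a"
      using order_tendstoD(2)[OF escape_upto_LIMSEQ] by (force simp: eventually_sequentially)
    from ev[OF v, of n] show "eventually (\<lambda>k. escape (U k) \<omega> v < a) sequentially"
    proof eventually_elim
      case (elim k)
      have "escape (U k) \<omega> v \<le> escape_upto (U k) \<omega> n v" by (rule escape_le_upto)
      with elim n show ?case by (meson le_less_trans order_refl)
    qed
  qed
qed

lemma escape_upto_subtree: "escape_upto UNIV \<omega> n (v @ w) = escape_upto UNIV (subtree \<omega> v) n w"
  by (induction n arbitrary: w) (auto simp: subtree_def)

lemma escape_subtree: "escape UNIV \<omega> (v @ w) = escape UNIV (subtree \<omega> v) w"
  by (simp add: escape_def escape_upto_subtree)

section \<open>Percolation on a tree\<close>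

lemma perc_upto_bounds:
  assumes "\<And>v. 0 \<le> r v \<and> r v \<le> 1"
  shows "0 \<le> perc_upto r \<omega> n v \<and> perc_upto r \<omega> n v \<le> 1"
proof (induction n arbitrary: v)
  case (Suc n)
  have "0 \<le> 1 - r (v @ [i]) * perc_upto r \<omega> n (v @ [i]) \<and> 1 - r (v @ [i]) * perc_upto r \<omega> n (v @ [i]) \<le> 1" for i
    using Suc[of "v @ [i]"] assms[of "v @ [i]"] by (auto intro: mult_le_one)
  then show ?case by (auto intro!: prod_nonneg prod_le_1)
qed simp

lemma perc_upto_decreasing:
  assumes r: "\<And>v. 0 \<le> r v \<and> r v \<le> 1"
  shows "perc_upto r \<omega> (Suc n) v \<le> perc_upto r \<omega> n v"
proof (induction n arbitrary: v)
  case 0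
  show ?case using perc_upto_bounds[of r \<omega> "Suc 0" v] r by (simp only: perc_upto.simps(1))
next
  case (Suc n)
  have "(\<Prod>i<\<omega> v. 1 - r (v @ [i]) * perc_upto r \<omega> n (v @ [i]))
     \<le> (\<Prod>i<\<omega> v. 1 - r (v @ [i]) * perc_upto r \<omega> (Suc n) (v @ [i]))"
  proof (intro prod_mono conjI)
    fix i
    show "0 \<le> 1 - r (v @ [i]) * perc_upto r \<omega> n (v @ [i])"
      using perc_upto_bounds[of r \<omega> n "v @ [i]"] r r[of "v @ [i]"] by (auto intro: mult_le_one)
    show "1 - r (v @ [i]) * perc_upto r \<omega> n (v @ [i]) \<le> 1 - r (v @ [i]) * perc_upto r \<omega> (Suc n) (v @ [i])"
      using Suc[of "v @ [i]"] r[of "v @ [i]"] by (intro diff_left_mono mult_left_mono) auto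
  qed
  then show ?case by (simp only: perc_upto.simps(2))
qed

lemma perc_upto_LIMSEQ:
  assumes r: "\<And>v. 0 \<le> r v \<and> r v \<le> 1"
  shows "(\<lambda>n. perc_upto r \<omega> n v) \<longlonglongrightarrow> perc r \<omega> v"
  unfolding perc_def
  using perc_upto_bounds[where r = r and \<omega> = \<omega> and v = v] r
  by (intro convergent_LIMSEQ_iff[THEN iffD1] Bseq_monoseq_convergent BseqI'[of _ 1]
      decseq_imp_monoseq decseq_SucI perc_upto_decreasing r) auto

lemma perc_bounds:
  assumes r: "\<And>v. 0 \<le> r v \<and> r v \<le> 1"
  shows "0 \<le> perc r \<omega> v" "perc r \<omega> v \<le> 1"
  by (rule LIMSEQ_le_const[OF perc_upto_LIMSEQ[OF r]] LIMSEQ_le_const2[OF perc_upto_LIMSEQ[OF r]],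
      use perc_upto_bounds[OF r] in auto)+

lemma perc_rec:
  assumes r: "\<And>v. 0 \<le> r v \<and> r v \<le> 1"
  shows "perc r \<omega> v = 1 - (\<Prod>i<\<omega> v. 1 - r (v @ [i]) * perc r \<omega> (v @ [i]))"
proof -
  have "(\<lambda>n. perc_upto r \<omega> (Suc n) v) \<longlonglongrightarrow> 1 - (\<Prod>i<\<omega> v. 1 - r (v @ [i]) * perc r \<omega> (v @ [i]))"
    by (auto intro!: tendsto_intros perc_upto_LIMSEQ r)
  with perc_upto_LIMSEQ[OF r, THEN LIMSEQ_Suc] show ?thesis by (rule LIMSEQ_unique)
qed

lemma perc_upto_subtree:
  "perc_upto r \<omega> n (v @ w) = perc_upto (\<lambda>u. r (v @ u)) (subtree \<omega> v) n w"
  by (induction n arbitrary: w) (auto simp: subtree_def)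

section \<open>Comparison of percolation with conductance\<close>

lemma one_minus_prod_le_sum:
  fixes f :: "'a \<Rightarrow> real"
  assumes "finite A" "\<And>i. i \<in> A \<Longrightarrow> 0 \<le> f i \<and> f i \<le> 1"
  shows "1 - (\<Prod>i\<in>A. 1 - f i) \<le> (\<Sum>i\<in>A. f i)"
  using assms
proof (induction A)
  case (insert a A)
  have P: "0 \<le> (\<Prod>i\<in>A. 1 - f i)" "(\<Prod>i\<in>A. 1 - f i) \<le> 1"
    using insert by (auto intro!: prod_nonneg prod_le_1)
  have "f a * (\<Prod>i\<in>A. 1 - f i) \<le> f a" using P insert by (intro mult_left_le) auto
  with insert show ?case by (auto simp: algebra_simps)
qed simp

text \<open>The union bound for independent events is strict once two of them have positive
  probability, because both then occur together with positive probability. This strictness later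
  rules out two children connected to infinity.\<close>

lemma one_minus_prod_less_sum:
  fixes f :: "'a \<Rightarrow> real"
  assumes "finite A" "\<And>i. i \<in> A \<Longrightarrow> 0 \<le> f i \<and> f i \<le> 1"
  assumes ab: "a \<in> A" "b \<in> A" "a \<noteq> b" "0 < f a" "0 < f b"
  shows "1 - (\<Prod>i\<in>A. 1 - f i) < (\<Sum>i\<in>A. f i)"
proof -
  define B where "B = A - {a}"
  have A: "A = insert a B" "a \<notin> B" "finite B" "b \<in> B" using ab assms by (auto simp: B_def)
  have b: "(\<Prod>i\<in>B. 1 - f i) \<le> 1 - f b"
  proof -
    have "(\<Prod>i\<in>B. 1 - f i) = (1 - f b) * (\<Prod>i\<in>B - {b}. 1 - f i)"
      using A by (simp add: prod.remove)
    also have "\<dots> \<le> (1 - f b) * 1"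
      using assms(2) A by (intro mult_left_mono prod_le_1) auto
    finally show ?thesis by simp
  qed
  have "1 - (\<Prod>i\<in>B. 1 - f i) \<le> (\<Sum>i\<in>B. f i)"
    using A assms by (intro one_minus_prod_le_sum) auto
  moreover have "f a * (\<Prod>i\<in>B. 1 - f i) < f a"
    using b ab by (simp add: mult_less_cancel_left1)
  ultimately show ?thesis using A by (simp add: algebra_simps)
qed

text \<open>The right side equals \<open>(1 - r) * y / (r + (1 - r) * y)\<close>, whose denominator
  is at most 1. At \<open>y = 1\<close> there is equality: conductance \<open>(1 - r) / r\<close> in
  series with a unit edge gives \<open>1 - r\<close>.\<close>

lemma thinning_inequality:
  fixes r y :: real
  assumes r: "0 < r" "r < 1" and y: "0 \<le> y" "y \<le> 1"
  shows "(1 - r) * y \<le> ((1 - r) / r * y) / (1 + (1 - r) / r * y)"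
proof -
  have le1: "r + (1 - r) * y \<le> 1"
    using mult_left_le[of y "1 - r"] r y by linarith
  have pos: "0 < r + (1 - r) * y" using r y by (intro add_pos_nonneg) auto
  have eq: "((1 - r) / r * y) / (1 + (1 - r) / r * y) = (1 - r) * y / (r + (1 - r) * y)"
    using r by (simp add: divide_simps)
  have "(1 - r) * y * (r + (1 - r) * y) \<le> (1 - r) * y"
    using le1 r y by (intro mult_left_le) auto
  with pos have "(1 - r) * y \<le> (1 - r) * y / (r + (1 - r) * y)"
    by (simp add: pos_le_divide_eq)
  then show ?thesis by (simp only: eq)
qed

text \<open>A positive percolation probability at some \<open>r < 1\<close> forces transience. The
  union bound turns the bounds for the children into a downward conductance of at least
  \<open>(1 - r) / r\<close> times the percolation probability at \<open>v\<close>, and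
  \<open>thinning_inequality\<close> restores the factor \<open>1 - r\<close> after the edge above
  \<open>v\<close> is added in series.\<close>

lemma perc_le_escape_upto:
  assumes r: "0 < r" "r < 1"
  shows "(1 - r) * perc_upto (\<lambda>_. r) \<omega> n v \<le> escape_upto UNIV \<omega> n v"
proof (induction n arbitrary: v)
  case (Suc n)
  let ?S = "\<Sum>i<\<omega> v. escape_upto UNIV \<omega> n (v @ [i])"
  let ?y = "perc_upto (\<lambda>_. r) \<omega> (Suc n) v"
  have y: "0 \<le> ?y" "?y \<le> 1" using perc_upto_bounds[of "\<lambda>_. r" \<omega> "Suc n" v] r by auto
  have pb: "0 \<le> perc_upto (\<lambda>_. r) \<omega> n w" "perc_upto (\<lambda>_. r) \<omega> n w \<le> 1" for w
    using perc_upto_bounds[of "\<lambda>_. r" \<omega> n w] r by auto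
  have "?y \<le> (\<Sum>i<\<omega> v. r * perc_upto (\<lambda>_. r) \<omega> n (v @ [i]))"
    unfolding perc_upto.simps using r pb
    by (intro one_minus_prod_le_sum) (auto intro: mult_le_one)
  then have "(1 - r) / r * ?y \<le> (1 - r) / r * (\<Sum>i<\<omega> v. r * perc_upto (\<lambda>_. r) \<omega> n (v @ [i]))"
    using r by (intro mult_left_mono) auto
  also have "\<dots> = (\<Sum>i<\<omega> v. (1 - r) * perc_upto (\<lambda>_. r) \<omega> n (v @ [i]))"
    using r by (simp add: sum_distrib_left)
  also have "\<dots> \<le> ?S" by (intro sum_mono Suc)
  finally have S: "(1 - r) / r * ?y \<le> ?S" .
  have y0: "0 \<le> (1 - r) / r * ?y" using r y by simp
  from series_mono[OF y0 S] have "((1 - r) / r * ?y) / (1 + (1 - r) / r * ?y) \<le> ?S / (1 + ?S)" .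
  moreover have "(1 - r) * ?y \<le> ((1 - r) / r * ?y) / (1 + (1 - r) / r * ?y)"
    using r y by (rule thinning_inequality)
  ultimately show ?case by simp
qed (use r in simp)

lemma escape_upto_finite_height:
  "\<forall>w\<in>gw_verts \<omega>. length w < n \<Longrightarrow> escape_upto UNIV \<omega> n [] = 0"
proof (induction n arbitrary: \<omega>)
  case 0
  then show ?case using gw_verts_Nil[of \<omega>] by blast
next
  case (Suc n)
  have "escape_upto UNIV \<omega> n ([] @ [i]) = 0" if "i < \<omega> []" for i
  proof -
    have "escape_upto UNIV (subtree \<omega> [i]) n [] = 0"
      using Suc.prems that by (intro Suc.IH) (auto simp: gw_verts_Cons dest: bspec[of _ _ "i # _"])
    then show ?thesis using escape_upto_subtree[of \<omega> n "[i]" "[]"] by simp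
  qed
  then show ?case by simp
qed

lemma escape_finite:
  assumes "finite (gw_verts \<omega>)"
  shows "escape UNIV \<omega> [] = 0"
proof -
  have "\<forall>w\<in>gw_verts \<omega>. length w < Suc (Max (length ` gw_verts \<omega>))"
    using assms by (simp add: less_Suc_eq_le)
  then have "escape_upto UNIV \<omega> (Suc (Max (length ` gw_verts \<omega>))) [] = 0"
    by (rule escape_upto_finite_height)
  then show ?thesis
    using escape_le_upto[of UNIV \<omega> "[]"] escape_nonneg[of UNIV \<omega> "[]"] by (metis order_antisym)
qed

section \<open>Galton-Watson trees\<close>

definition node :: "nat \<Rightarrow> (nat \<Rightarrow> nat list \<Rightarrow> nat) \<Rightarrow> nat list \<Rightarrow> nat" where
  "node k t = (\<lambda>u. case u of [] \<Rightarrow> k | i # w \<Rightarrow> t i w)"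

text \<open>A tree is sampled for every child index, whatever the number of children, so that this
  number is independent of the sequence of subtrees.\<close>

definition gw_forest :: "nat pmf \<Rightarrow> (nat \<Rightarrow> nat list \<Rightarrow> nat) measure" where
  "gw_forest p = PiM UNIV (\<lambda>_. gw_measure p)"

lemma node_Nil [simp]: "node k t [] = k"
  and node_Cons [simp]: "node k t (i # w) = t i w"
  and subtree_node [simp]: "subtree (node k t) [i] = t i"
  by (auto simp: node_def subtree_def)

lemma space_gw_measure [simp]: "space (gw_measure p) = UNIV"
  by (simp add: gw_measure_def space_PiM)

lemma space_gw_forest [simp]: "space (gw_forest p) = UNIV"
  by (simp add: gw_forest_def space_PiM)

lemma prob_space_gw_measure: "prob_space (gw_measure p)"
  unfolding gw_measure_def by (intro prob_space_PiM prob_space_measure_pmf)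

lemma prob_space_gw_forest: "prob_space (gw_forest p)"
  unfolding gw_forest_def by (intro prob_space_PiM prob_space_gw_measure)

lemma emeasure_gw_cylinder:
  assumes "finite J"
  shows "emeasure (gw_measure p) {\<omega>. \<forall>j\<in>J. \<omega> j \<in> F j} = (\<Prod>j\<in>J. emeasure (measure_pmf p) (F j))"
proof -
  interpret product_prob_space "\<lambda>_::nat list. measure_pmf p" UNIV
    by unfold_locales
  show ?thesis
    using emeasure_PiM_Collect[of J F] assms by (simp add: gw_measure_def space_PiM)
qed

lemma emeasure_gw_forest_cylinder:
  assumes "finite J" "\<And>j. j \<in> J \<Longrightarrow> F j \<in> sets (gw_measure p)"
  shows "emeasure (gw_forest p) {t. \<forall>j\<in>J. t j \<in> F j} = (\<Prod>j\<in>J. emeasure (gw_measure p) (F j))"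
proof -
  interpret G: prob_space "gw_measure p" by (rule prob_space_gw_measure)
  interpret product_prob_space "\<lambda>_::nat. gw_measure p" UNIV
    by unfold_locales
  show ?thesis
    using emeasure_PiM_Collect[of J F] assms by (simp add: gw_forest_def space_PiM)
qed

lemma measurable_gw_coord [measurable]: "(\<lambda>\<omega>. \<omega> u) \<in> gw_measure p \<rightarrow>\<^sub>M count_space UNIV"
  unfolding gw_measure_def
  by (rule measurable_compose[OF measurable_component_singleton]) auto

lemma measurable_gw_measureI:
  assumes "\<And>u. (\<lambda>x. f x u) \<in> M \<rightarrow>\<^sub>M count_space UNIV"
  shows "f \<in> M \<rightarrow>\<^sub>M gw_measure p"
proof -
  have "(\<lambda>x. \<lambda>u\<in>UNIV. f x u) \<in> M \<rightarrow>\<^sub>M gw_measure p"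
    unfolding gw_measure_def using assms
    by (intro measurable_restrict) (simp cong: measurable_cong_sets)
  then show ?thesis by (simp add: restrict_UNIV)
qed

lemma measurable_gw_forest_coord [measurable]: "(\<lambda>t. t i) \<in> gw_forest p \<rightarrow>\<^sub>M gw_measure p"
  unfolding gw_forest_def by (rule measurable_component_singleton) simp

lemma measurable_gw_forestI:
  assumes "\<And>i. (\<lambda>x. f x i) \<in> M \<rightarrow>\<^sub>M gw_measure p"
  shows "f \<in> M \<rightarrow>\<^sub>M gw_forest p"
proof -
  have "(\<lambda>x. \<lambda>i\<in>UNIV. f x i) \<in> M \<rightarrow>\<^sub>M gw_forest p"
    unfolding gw_forest_def using assms by (intro measurable_restrict)
  then show ?thesis by (simp add: restrict_UNIV)
qed

lemma measurable_subtree [measurable]: "(\<lambda>\<omega>. subtree \<omega> v) \<in> gw_measure p \<rightarrow>\<^sub>M gw_measure p"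
  unfolding subtree_def by (rule measurable_gw_measureI) measurable

lemma measurable_node [measurable]:
  "(\<lambda>(k, t). node k t) \<in> measure_pmf p \<Otimes>\<^sub>M gw_forest p \<rightarrow>\<^sub>M gw_measure p"
proof (rule measurable_gw_measureI)
  fix u
  have [measurable]: "(\<lambda>t. t i w) \<in> gw_forest p \<rightarrow>\<^sub>M count_space UNIV" for i w
    by (rule measurable_compose[OF measurable_gw_forest_coord measurable_gw_coord])
  show "(\<lambda>x. (case x of (k, t) \<Rightarrow> node k t) u)
      \<in> measure_pmf p \<Otimes>\<^sub>M gw_forest p \<rightarrow>\<^sub>M count_space UNIV"
  proof (cases u)
    case Nil
    then have "(\<lambda>x. (case x of (k, t) \<Rightarrow> node k t) u) = fst" by (auto simp: fun_eq_iff)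
    then show ?thesis
      using measurable_fst[of "measure_pmf p" "gw_forest p"] by (simp cong: measurable_cong_sets)
  next
    case (Cons i w)
    then have "(\<lambda>x. (case x of (k, t) \<Rightarrow> node k t) u) = (\<lambda>x. (snd x) i w)"
      by (auto simp: fun_eq_iff)
    then show ?thesis by simp
  qed
qed

text \<open>The branching property. A product measure is determined by its finite cylinders, and
  these factor because a nonempty word is a first letter together with a word in the corresponding
  subtree.\<close>

lemma distr_node:
  "distr (measure_pmf p \<Otimes>\<^sub>M gw_forest p) (gw_measure p) (\<lambda>(k, t). node k t) = gw_measure p"
    (is "?D = _")
proof -
  interpret P: product_prob_space "\<lambda>_::nat list. measure_pmf p" UNIV
    by unfold_locales
  interpret F: prob_space "gw_forest p" by (rule prob_space_gw_forest)
  have "?D = PiM UNIV (\<lambda>_. measure_pmf p)"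
  proof (rule P.PiM_eq)
    show "sets ?D = sets (PiM UNIV (\<lambda>_. measure_pmf p))" by (simp add: gw_measure_def)
    fix J :: "nat list set" and A :: "nat list \<Rightarrow> nat set"
    assume J: "finite J"
    let ?X = "prod_emb UNIV (\<lambda>_. measure_pmf p) J (\<Pi>\<^sub>E j\<in>J. A j)"
    \<comment> \<open>\<open>K\<close> collects the subtrees that the cylinder constrains and
      \<open>L i\<close> the vertices constrained inside subtree \<open>i\<close>.\<close>
    define K where "K = hd ` (J - {[]})"
    define L where "L i = {w. i # w \<in> J}" for i
    have fin: "finite K" "finite (L i)" for i
      using J finite_subset[of "L i" "tl ` J"] by (force simp: K_def L_def image_iff)+
    have X: "?X = {\<omega>. \<forall>j\<in>J. \<omega> j \<in> A j}"
      by (auto simp: prod_emb_def PiE_iff)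
    define A0 where "A0 = (if [] \<in> J then A [] else UNIV)"
    define C where "C i = {\<omega> :: nat list \<Rightarrow> nat. \<forall>w\<in>L i. \<omega> w \<in> A (i # w)}" for i
    have Cm: "C i \<in> sets (gw_measure p)" for i
    proof -
      have "C i = {\<omega>\<in>space (gw_measure p). \<forall>w\<in>L i. \<omega> w \<in> A (i # w)}" by (simp add: C_def)
      also have "\<dots> \<in> sets (gw_measure p)" using fin by measurable
      finally show ?thesis .
    qed
    have Fm: "{t. \<forall>i\<in>K. t i \<in> C i} \<in> sets (gw_forest p)"
    proof -
      have "{t. \<forall>i\<in>K. t i \<in> C i} = {t\<in>space (gw_forest p). \<forall>i\<in>K. t i \<in> C i}" by simp
      also have "\<dots> \<in> sets (gw_forest p)" using fin Cm by measurable
      finally show ?thesis .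
    qed
    have vim: "(\<lambda>(k, t). node k t) -` ?X \<inter> space (measure_pmf p \<Otimes>\<^sub>M gw_forest p)
        = A0 \<times> {t. \<forall>i\<in>K. t i \<in> C i}"
    proof (rule set_eqI)
      fix x :: "nat \<times> (nat \<Rightarrow> nat list \<Rightarrow> nat)"
      obtain k t where x: "x = (k, t)" by (cases x)
      have "(\<forall>j\<in>J. node k t j \<in> A j) \<longleftrightarrow> k \<in> A0 \<and> (\<forall>i\<in>K. \<forall>w\<in>L i. t i w \<in> A (i # w))"
      proof safe
        assume *: "\<forall>j\<in>J. node k t j \<in> A j"
        then show "k \<in> A0" by (force simp: A0_def)
        fix i w assume "i \<in> K" "w \<in> L i"
        with * show "t i w \<in> A (i # w)" by (force simp: L_def)
      next
        fix j assume "k \<in> A0" and *: "\<forall>i\<in>K. \<forall>w\<in>L i. t i w \<in> A (i # w)" and "j \<in> J"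
        then show "node k t j \<in> A j"
          by (cases j) (auto simp: A0_def K_def L_def split: if_splits dest: bspec[of _ _ j])
      qed
      then show "x \<in> (\<lambda>(k, t). node k t) -` ?X \<inter> space (measure_pmf p \<Otimes>\<^sub>M gw_forest p)
          \<longleftrightarrow> x \<in> A0 \<times> {t. \<forall>i\<in>K. t i \<in> C i}"
        by (simp add: X x C_def space_pair_measure)
    qed
    have "emeasure ?D ?X = emeasure (measure_pmf p \<Otimes>\<^sub>M gw_forest p) (A0 \<times> {t. \<forall>i\<in>K. t i \<in> C i})"
    proof (subst emeasure_distr)
      show "?X \<in> sets (gw_measure p)"
        unfolding gw_measure_def using J by (intro sets_PiM_I) auto
    qed (simp_all add: vim)
    also have "\<dots> = emeasure (measure_pmf p) A0 * emeasure (gw_forest p) {t. \<forall>i\<in>K. t i \<in> C i}"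
      using Fm by (intro F.emeasure_pair_measure_Times) auto
    also have "emeasure (gw_forest p) {t. \<forall>i\<in>K. t i \<in> C i} = (\<Prod>i\<in>K. emeasure (gw_measure p) (C i))"
      using fin Cm by (intro emeasure_gw_forest_cylinder) auto
    also have "\<dots> = (\<Prod>i\<in>K. \<Prod>w\<in>L i. emeasure (measure_pmf p) (A (i # w)))"
      using fin by (simp add: C_def emeasure_gw_cylinder)
    also have "\<dots> = (\<Prod>(i, w)\<in>Sigma K L. emeasure (measure_pmf p) (A (i # w)))"
      using fin by (subst prod.Sigma) auto
    also have "\<dots> = (\<Prod>j\<in>J - {[]}. emeasure (measure_pmf p) (A j))"
      by (rule prod.reindex_bij_witness[of _ "\<lambda>j. (hd j, tl j)" "\<lambda>(i, w). i # w"])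
         (auto simp: K_def L_def image_iff intro!: bexI)
    also have "emeasure (measure_pmf p) A0 * \<dots> = (\<Prod>j\<in>J. emeasure (measure_pmf p) (A j))"
      using J by (auto simp: A0_def prod.remove)
    finally show "emeasure ?D ?X = (\<Prod>j\<in>J. emeasure (measure_pmf p) (A j))" .
  qed
  then show ?thesis by (simp add: gw_measure_def)
qed

lemma nn_integral_gw:
  assumes g [measurable]: "g \<in> borel_measurable (gw_measure p)"
  shows "(\<integral>\<^sup>+\<omega>. g \<omega> \<partial>gw_measure p) = (\<integral>\<^sup>+k. \<integral>\<^sup>+t. g (node k t) \<partial>gw_forest p \<partial>measure_pmf p)"
proof -
  interpret F: prob_space "gw_forest p" by (rule prob_space_gw_forest)
  have "(\<integral>\<^sup>+\<omega>. g \<omega> \<partial>gw_measure p)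
      = (\<integral>\<^sup>+\<omega>. g \<omega> \<partial>distr (measure_pmf p \<Otimes>\<^sub>M gw_forest p) (gw_measure p) (\<lambda>(k, t). node k t))"
    by (simp add: distr_node)
  also have "\<dots> = (\<integral>\<^sup>+x. g (case x of (k, t) \<Rightarrow> node k t) \<partial>(measure_pmf p \<Otimes>\<^sub>M gw_forest p))"
    by (rule nn_integral_distr[OF measurable_node]) simp
  also have "\<dots> = (\<integral>\<^sup>+k. \<integral>\<^sup>+t. g (node k t) \<partial>gw_forest p \<partial>measure_pmf p)"
    by (subst F.nn_integral_fst[symmetric]) auto
  finally show ?thesis .
qed

lemma nn_integral_gw_forest:
  assumes g [measurable]: "g \<in> borel_measurable (gw_forest p)"
  shows "(\<integral>\<^sup>+t. g t \<partial>gw_forest p) = (\<integral>\<^sup>+\<omega>. \<integral>\<^sup>+t. g (case_nat \<omega> t) \<partial>gw_forest p \<partial>gw_measure p)"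
proof -
  interpret F: prob_space "gw_forest p" by (rule prob_space_gw_forest)
  interpret G: prob_space "gw_measure p" by (rule prob_space_gw_measure)
  interpret sequence_space "gw_measure p" by unfold_locales
  have [measurable]: "(\<lambda>(\<omega>, t). case_nat \<omega> t) \<in> gw_measure p \<Otimes>\<^sub>M gw_forest p \<rightarrow>\<^sub>M gw_forest p"
  proof (rule measurable_gw_forestI)
    fix i
    show "(\<lambda>x. (case x of (\<omega>, t) \<Rightarrow> case_nat \<omega> t) i) \<in> gw_measure p \<Otimes>\<^sub>M gw_forest p \<rightarrow>\<^sub>M gw_measure p"
      by (cases i) (auto simp: split_beta')
  qed
  have "(\<integral>\<^sup>+t. g t \<partial>gw_forest p)
     = (\<integral>\<^sup>+t. g t \<partial>distr (gw_measure p \<Otimes>\<^sub>M gw_forest p) (gw_forest p) (\<lambda>(\<omega>, t). case_nat \<omega> t))"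
    using PiM_iter by (simp add: gw_forest_def)
  also have "\<dots> = (\<integral>\<^sup>+x. g (case x of (\<omega>, t) \<Rightarrow> case_nat \<omega> t) \<partial>(gw_measure p \<Otimes>\<^sub>M gw_forest p))"
    by (rule nn_integral_distr) measurable
  also have "\<dots> = (\<integral>\<^sup>+\<omega>. \<integral>\<^sup>+t. g (case_nat \<omega> t) \<partial>gw_forest p \<partial>gw_measure p)"
    by (subst F.nn_integral_fst[symmetric]) auto
  finally show ?thesis .
qed

lemma distr_subtree: "distr (gw_measure p) (gw_measure p) (\<lambda>\<omega>. subtree \<omega> v) = gw_measure p"
  using distr_PiM_reindex[of UNIV "\<lambda>_. measure_pmf p" "\<lambda>w. v @ w" UNIV]
  by (auto simp: gw_measure_def subtree_def[abs_def] inj_on_def restrict_UNIV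
      intro: prob_space_measure_pmf)

lemma distr_gw_forest_permute:
  assumes "bij \<pi>"
  shows "distr (gw_forest p) (gw_forest p) (\<lambda>t i. t (\<pi> i)) = gw_forest p"
  using distr_PiM_reindex[of UNIV "\<lambda>_. gw_measure p" \<pi> UNIV] assms
  by (auto simp: gw_forest_def bij_def restrict_UNIV intro: prob_space_gw_measure)

lemma nn_integral_prod_gw_forest:
  assumes h [measurable]: "h \<in> borel_measurable (gw_measure p)"
  shows "(\<integral>\<^sup>+t. (\<Prod>i<k. h (t i)) \<partial>gw_forest p) = (\<integral>\<^sup>+\<omega>. h \<omega> \<partial>gw_measure p) ^ k"
proof (induction k)
  case 0
  interpret F: prob_space "gw_forest p" by (rule prob_space_gw_forest)
  show ?case using F.emeasure_space_1 by simp
next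
  case (Suc k)
  have "(\<integral>\<^sup>+t. (\<Prod>i<Suc k. h (t i)) \<partial>gw_forest p)
    = (\<integral>\<^sup>+\<omega>. \<integral>\<^sup>+t. (\<Prod>i<Suc k. h (case_nat \<omega> t i)) \<partial>gw_forest p \<partial>gw_measure p)"
    by (rule nn_integral_gw_forest) measurable
  also have "\<dots> = (\<integral>\<^sup>+\<omega>. \<integral>\<^sup>+t. h \<omega> * (\<Prod>i<k. h (t i)) \<partial>gw_forest p \<partial>gw_measure p)"
    by (simp only: prod.lessThan_Suc_shift) simp
  also have "\<dots> = (\<integral>\<^sup>+\<omega>. h \<omega> * (\<integral>\<^sup>+\<omega>. h \<omega> \<partial>gw_measure p) ^ k \<partial>gw_measure p)"
    by (subst nn_integral_cmult) (auto simp: Suc)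
  also have "\<dots> = (\<integral>\<^sup>+\<omega>. h \<omega> \<partial>gw_measure p) ^ Suc k"
    by (subst nn_integral_multc) auto
  finally show ?case .
qed

lemma nn_integral_gw_prod:
  assumes h [measurable]: "h \<in> borel_measurable (gw_measure p)"
  shows "(\<integral>\<^sup>+\<omega>. (\<Prod>i<\<omega> []. h (subtree \<omega> [i])) \<partial>gw_measure p)
    = (\<integral>\<^sup>+k. (\<integral>\<^sup>+\<omega>. h \<omega> \<partial>gw_measure p) ^ k \<partial>measure_pmf p)"
proof -
  have "(\<lambda>\<omega>. (\<lambda>k. \<Prod>i<k. h (subtree \<omega> [i])) (\<omega> [])) \<in> borel_measurable (gw_measure p)"
    by (rule measurable_compose_countable) measurable
  then show ?thesis
    by (subst nn_integral_gw) (simp_all add: nn_integral_prod_gw_forest)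
qed

section \<open>Supercriticality and generating functions\<close>

text \<open>The mean may be infinite; a finite partial sum above 1 is what the real-valued estimates
  can work with.\<close>

lemma supercritical_truncation:
  assumes "supercritical p"
  obtains K where "1 < (\<Sum>k<K. real k * pmf p k)"
proof -
  have "1 < (SUP K. \<Sum>k<K. of_nat k * ennreal (pmf p k))"
    using assms by (simp add: supercritical_def suminf_eq_SUP)
  then obtain K where "1 < (\<Sum>k<K. of_nat k * ennreal (pmf p k))"
    by (auto simp: less_SUP_iff)
  also have "(\<Sum>k<K. of_nat k * ennreal (pmf p k)) = ennreal (\<Sum>k<K. real k * pmf p k)"
    by (subst sum_ennreal[symmetric]) (auto simp: ennreal_mult ennreal_of_nat_eq_real_of_nat)
  finally show ?thesis by (intro that) (simp add: one_ennreal_def[symmetric] del: sum_ennreal)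
qed

lemma supercritical_branching:
  assumes "supercritical p"
  obtains k where "2 \<le> k" "0 < pmf p k"
proof (rule ccontr)
  assume "\<not> thesis"
  then have "\<not> (2 \<le> k \<and> 0 < pmf p k)" for k using that by blast
  then have z: "pmf p k = 0" if "2 \<le> k" for k
    using that pmf_nonneg[of p k] by (auto simp: less_le)
  obtain K where "1 < (\<Sum>k<K. real k * pmf p k)"
    using supercritical_truncation[OF assms] .
  also have "(\<Sum>k<K. real k * pmf p k) \<le> (\<Sum>k<K. if k = 1 then 1 else 0)"
  proof (rule sum_mono)
    fix k
    show "real k * pmf p k \<le> (if k = 1 then 1 else 0)"
      using z[of k] pmf_le_1[of p k] by (cases "k = 0"; cases "k = 1") auto
  qed
  also have "\<dots> \<le> 1" by (simp add: sum.delta)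
  finally show False by simp
qed

text \<open>Bernoulli's inequality and \<open>(1 - x) * (1 + x) \<le> 1\<close> give
  \<open>(1 - x) ^ k \<le> 1 / (1 + real k * x)\<close>. The denominator is then coarsened from
  \<open>k\<close> to \<open>K\<close>, so that all terms of a sum over \<open>k < K\<close> share
  it.\<close>

lemma pow_one_minus_le:
  fixes x :: real
  assumes "0 \<le> x" "x \<le> 1" "k \<le> K"
  shows "real k * x / (1 + real K * x) \<le> 1 - (1 - x) ^ k"
proof -
  have "(1 - x) ^ k * (1 + real k * x) \<le> (1 - x) ^ k * (1 + x) ^ k"
    using assms Bernoulli_inequality[of x k] by (intro mult_left_mono) (auto simp: algebra_simps)
  also have "\<dots> = ((1 - x) * (1 + x)) ^ k" by (simp add: power_mult_distrib)
  also have "\<dots> \<le> 1" using assms by (intro power_le_one) (auto simp: algebra_simps mult_le_one)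
  finally have "(1 - x) ^ k * (1 + real k * x) \<le> 1" .
  then have "(1 - x) ^ k \<le> 1 / (1 + real k * x)"
    using assms by (simp add: pos_le_divide_eq add_pos_nonneg)
  then have "1 - 1 / (1 + real k * x) \<le> 1 - (1 - x) ^ k" by simp
  moreover have "1 - 1 / (1 + real k * x) = real k * x / (1 + real k * x)"
    using assms add_pos_nonneg[of 1 "real k * x"] by (simp add: divide_simps)
  moreover have "real k * x / (1 + real K * x) \<le> real k * x / (1 + real k * x)"
    using assms by (intro divide_left_mono mult_pos_pos add_pos_nonneg) (auto simp: mult_right_mono)
  ultimately show ?thesis by simp
qed

lemma integrable_pgf:
  fixes x :: real
  assumes "0 \<le> x" "x \<le> 1"
  shows "integrable (measure_pmf p) (\<lambda>k. x ^ k)"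
  using assms by (intro measure_pmf.integrable_const_bound[where B = 1]) (auto simp: power_le_one)

lemma nn_integral_pgf:
  fixes x :: real
  assumes "0 \<le> x" "x \<le> 1"
  shows "(\<integral>\<^sup>+k. ennreal x ^ k \<partial>measure_pmf p) = ennreal (measure_pmf.expectation p (\<lambda>k. x ^ k))"
  using assms by (simp add: ennreal_power nn_integral_eq_integral integrable_pgf)

text \<open>A Galton-Watson tree whose edges are retained with probability \<open>r\<close> is still supercritical for
  \<open>r\<close> close to 1; the number \<open>a\<close> is a lower bound for its survival probability.\<close>

lemma supercritical_thinning:
  assumes "supercritical p"
  obtains r a :: real where "0 < r" "r < 1" "0 < a" "a < 1"
    "measure_pmf.expectation p (\<lambda>k. (1 - r * a) ^ k) \<le> 1 - a"
proof -
  obtain K where K: "1 < (\<Sum>k<K. real k * pmf p k)"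
    using supercritical_truncation[OF assms] .
  define m where "m = (\<Sum>k<K. real k * pmf p k)"
  \<comment> \<open>The midpoint of \<open>1 / m\<close> and 1, so that \<open>r < 1\<close> while
    the thinned truncated mean \<open>r * m\<close> still exceeds 1.\<close>
  define r where "r = (1 + 1 / m) / 2"
  have m: "1 < m" using K by (simp add: m_def)
  have r: "0 < r" "r < 1" "1 < r * m" using m by (auto simp: r_def field_simps)
  have K0: "0 < K" using K by (cases K) auto
  \<comment> \<open>The second entry is the solution of \<open>1 + real K * (r * a) = r * m\<close>,
    where the bound from \<open>pow_one_minus_le\<close> just suffices; the first entry keeps
    \<open>a\<close> below 1.\<close>
  define a where "a = min (1 / 2) ((r * m - 1) / (real K * r))"
  have a: "0 < a" "a < 1" using r K0 by (auto simp: a_def)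
  have ra: "0 \<le> r * a" "r * a \<le> 1" using r a by (auto simp: mult_le_one)
  have "a \<le> (r * m - 1) / (real K * r)" by (simp add: a_def)
  then have "real K * (r * a) \<le> r * m - 1" using r K0 by (simp add: pos_le_divide_eq ac_simps)
  then have "1 + real K * (r * a) \<le> r * m" by simp
  then have "a * (1 + real K * (r * a)) \<le> a * (r * m)" using a by (intro mult_left_mono) auto
  then have le: "a \<le> m * (r * a) / (1 + real K * (r * a))"
    using r a by (subst pos_le_divide_eq) (auto simp: ac_simps intro!: add_pos_nonneg)
  have "m * (r * a) / (1 + real K * (r * a))
      = (\<Sum>k<K. (real k * (r * a) / (1 + real K * (r * a))) * pmf p k)"
    by (simp add: m_def sum_distrib_right sum_divide_distrib) (simp add: ac_simps)
  also have "\<dots> \<le> (\<Sum>k<K. (1 - (1 - r * a) ^ k) * pmf p k)"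
    using ra by (intro sum_mono mult_right_mono pow_one_minus_le) auto
  also have "\<dots> = measure_pmf.expectation p (\<lambda>k. indicator {..<K} k * (1 - (1 - r * a) ^ k))"
    by (subst integral_measure_pmf_real[of "{..<K}"]) (auto simp: indicator_def)
  also have "\<dots> \<le> measure_pmf.expectation p (\<lambda>k. 1 - (1 - r * a) ^ k)"
  proof (rule integral_mono)
    show "integrable (measure_pmf p) (\<lambda>k. indicator {..<K} k * (1 - (1 - r * a) ^ k))"
      using ra by (intro measure_pmf.integrable_const_bound[where B = 1])
        (auto simp: power_le_one indicator_def)
    show "integrable (measure_pmf p) (\<lambda>k. 1 - (1 - r * a) ^ k)"
      using ra by (intro Bochner_Integration.integrable_diff integrable_pgf) auto
  qed (use ra in \<open>auto simp: indicator_def power_le_one\<close>)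
  also have "\<dots> = 1 - measure_pmf.expectation p (\<lambda>k. (1 - r * a) ^ k)"
    using ra by (subst Bochner_Integration.integral_diff) (auto intro!: integrable_pgf)
  finally show ?thesis using le r a by (intro that[of r a]) auto
qed

text \<open>For the generating function f, the quotient (1 - f x) / (1 - x) is the expectation of
  \<open>\<Sum>i<k. x ^ i\<close>. It is strictly increasing because some \<open>k \<ge> 2\<close>
  has positive mass, yet it equals 1 at every fixed point below 1. The functions \<open>?g\<close>
  and \<open>?h\<close> express this comparison with the denominators cleared.\<close>

lemma pgf_fixed_point_unique_aux:
  fixes x y :: real
  assumes p: "supercritical p" and xy: "0 \<le> x" "x < y" "y < 1"
    and fx: "measure_pmf.expectation p (\<lambda>k. x ^ k) = x"
    and fy: "measure_pmf.expectation p (\<lambda>k. y ^ k) = y"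
  shows False
proof -
  obtain k where k: "2 \<le> k" "0 < pmf p k" using supercritical_branching[OF p] .
  let ?g = "\<lambda>k. (1 - y) * (1 - x ^ k)" and ?h = "\<lambda>k. (1 - x) * (1 - y ^ k)"
  have sum_le: "(\<Sum>i<j. x ^ i) \<le> (\<Sum>i<j. y ^ i)" for j
    using xy by (intro sum_mono power_mono) auto
  have g: "?g j = (1 - x) * (1 - y) * (\<Sum>i<j. x ^ i)" and h: "?h j = (1 - x) * (1 - y) * (\<Sum>i<j. y ^ i)" for j
    by (simp_all add: one_diff_power_eq)
  have le: "?g j \<le> ?h j" for j
    unfolding g h using xy sum_le by (intro mult_left_mono) auto
  have int: "integrable (measure_pmf p) ?g" "integrable (measure_pmf p) ?h"
    using xy by (auto intro!: integrable_pgf)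
  have "measure_pmf.expectation p (\<lambda>k. ?h k - ?g k) = 0"
    using xy fx fy by (subst Bochner_Integration.integral_diff)
      (auto intro!: integrable_pgf simp: Bochner_Integration.integral_diff integrable_pgf)
  then have "AE k in measure_pmf p. ?h k - ?g k = 0"
    using int le by (subst (asm) integral_nonneg_eq_0_iff_AE) auto
  then have "?h k = ?g k" using k by (simp add: AE_measure_pmf_iff set_pmf_iff)
  moreover have "(\<Sum>i<k. x ^ i) < (\<Sum>i<k. y ^ i)"
    using k xy by (intro sum_strict_mono_ex1) (auto intro!: power_mono bexI[of _ 1])
  then have "?g k < ?h k" unfolding g h using xy by (intro mult_strict_left_mono) auto
  ultimately show False by simp
qed

lemma pgf_fixed_point_unique:
  fixes x y :: real
  assumes "supercritical p" "0 \<le> x" "x < 1" "0 \<le> y" "y < 1"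
    and "measure_pmf.expectation p (\<lambda>k. x ^ k) = x" "measure_pmf.expectation p (\<lambda>k. y ^ k) = y"
  shows "x = y"
  using pgf_fixed_point_unique_aux[of p x y] pgf_fixed_point_unique_aux[of p y x] assms
  by (meson linorder_neqE_linordered_idom)

section \<open>Positive escape probability on survival\<close>

lemma measurable_children_sum:
  assumes [measurable]: "\<And>i. (\<lambda>\<omega>. f \<omega> i) \<in> borel_measurable (gw_measure p)"
  shows "(\<lambda>\<omega>. \<Sum>i<\<omega> v. f \<omega> i :: real) \<in> borel_measurable (gw_measure p)"
proof -
  have "(\<lambda>\<omega>. (\<lambda>k. \<Sum>i<k. f \<omega> i) (\<omega> v)) \<in> borel_measurable (gw_measure p)"
    by (rule measurable_compose_countable) measurable
  then show ?thesis .
qed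

lemma measurable_children_prod:
  assumes [measurable]: "\<And>i. (\<lambda>\<omega>. f \<omega> i) \<in> borel_measurable (gw_measure p)"
  shows "(\<lambda>\<omega>. \<Prod>i<\<omega> v. f \<omega> i :: real) \<in> borel_measurable (gw_measure p)"
proof -
  have "(\<lambda>\<omega>. (\<lambda>k. \<Prod>i<k. f \<omega> i) (\<omega> v)) \<in> borel_measurable (gw_measure p)"
    by (rule measurable_compose_countable) measurable
  then show ?thesis .
qed

lemma measurable_escape_upto [measurable]:
  "(\<lambda>\<omega>. escape_upto U \<omega> n v) \<in> borel_measurable (gw_measure p)"
proof (induction n arbitrary: v)
  case (Suc n)
  note [measurable] = measurable_children_sum[OF Suc]
  show ?case by (cases "v \<in> U") auto
qed simp

lemma measurable_escape [measurable]: "(\<lambda>\<omega>. escape U \<omega> v) \<in> borel_measurable (gw_measure p)"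
  by (rule borel_measurable_LIMSEQ_real[OF escape_upto_LIMSEQ]) measurable

lemma measurable_perc_upto:
  assumes [measurable]: "\<And>v. (\<lambda>\<omega>. r \<omega> v) \<in> borel_measurable (gw_measure p)"
  shows "(\<lambda>\<omega>. perc_upto (r \<omega>) \<omega> n v) \<in> borel_measurable (gw_measure p)"
proof (induction n arbitrary: v)
  case (Suc n)
  note [measurable] = Suc measurable_children_prod
  show ?case by simp
qed simp

text \<open>The mean probability of not reaching level \<open>n\<close> starts at 0 and is iterated
  by the increasing map that sends q to the mean of \<open>(1 - r + r * q) ^ k\<close>. By
  \<open>fix_le\<close> this map sends \<open>1 - a\<close> to at most \<open>1 - a\<close>, so the
  iterates never pass it.\<close>

lemma perc_upto_const_gw:
  fixes r a :: real
  assumes r: "0 < r" "r < 1" and a: "0 < a" "a < 1"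
    and fix_le: "measure_pmf.expectation p (\<lambda>k. (1 - r * a) ^ k) \<le> 1 - a"
  shows "(\<integral>\<^sup>+\<omega>. ennreal (1 - perc_upto (\<lambda>_. r) \<omega> n []) \<partial>gw_measure p) \<le> ennreal (1 - a)"
proof (induction n)
  case (Suc n)
  interpret G: prob_space "gw_measure p" by (rule prob_space_gw_measure)
  note [measurable] = measurable_perc_upto[of "\<lambda>_ _. r", simplified]
  let ?y = "\<lambda>\<omega>. perc_upto (\<lambda>_. r) \<omega> n []"
  have y: "0 \<le> perc_upto (\<lambda>_. r) \<omega> n v" "perc_upto (\<lambda>_. r) \<omega> n v \<le> 1" for \<omega> v
    using perc_upto_bounds[of "\<lambda>_. r" \<omega> n v] r by auto
  have ry: "r * perc_upto (\<lambda>_. r) \<omega> n v \<le> 1" for \<omega> v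
    using y[of \<omega> v] r by (intro mult_le_one) auto
  have ra: "0 \<le> 1 - r * a" using r a by (simp add: mult_le_one)
  have step: "1 - perc_upto (\<lambda>_. r) \<omega> (Suc n) [] = (\<Prod>i<\<omega> []. 1 - r * ?y (subtree \<omega> [i]))" for \<omega>
    using perc_upto_subtree[of "\<lambda>_. r" \<omega> n "[i]" "[]" for i] by simp
  have "(\<integral>\<^sup>+\<omega>. ennreal (1 - r * ?y \<omega>) \<partial>gw_measure p)
      = (\<integral>\<^sup>+\<omega>. ennreal (1 - r) + ennreal r * ennreal (1 - ?y \<omega>) \<partial>gw_measure p)"
    using r y by (intro nn_integral_cong)
      (auto simp: ennreal_mult[symmetric] ennreal_plus[symmetric] algebra_simps simp del: ennreal_plus)
  also have "\<dots> = ennreal (1 - r) + ennreal r * (\<integral>\<^sup>+\<omega>. ennreal (1 - ?y \<omega>) \<partial>gw_measure p)"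
    using G.emeasure_space_1 by (simp add: nn_integral_add nn_integral_cmult)
  also have "\<dots> \<le> ennreal (1 - r) + ennreal r * ennreal (1 - a)"
    by (intro add_left_mono mult_left_mono Suc) auto
  also have "\<dots> = ennreal (1 - r * a)"
    using r a by (auto simp: ennreal_mult[symmetric] ennreal_plus[symmetric] algebra_simps simp del: ennreal_plus)
  finally have le: "(\<integral>\<^sup>+\<omega>. ennreal (1 - r * ?y \<omega>) \<partial>gw_measure p) \<le> ennreal (1 - r * a)" .
  have "(\<integral>\<^sup>+\<omega>. ennreal (1 - perc_upto (\<lambda>_. r) \<omega> (Suc n) []) \<partial>gw_measure p)
      = (\<integral>\<^sup>+\<omega>. (\<Prod>i<\<omega> []. ennreal (1 - r * ?y (subtree \<omega> [i]))) \<partial>gw_measure p)"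
    unfolding step using ry by (intro nn_integral_cong) (simp add: prod_ennreal)
  also have "\<dots> = (\<integral>\<^sup>+k. (\<integral>\<^sup>+\<omega>. ennreal (1 - r * ?y \<omega>) \<partial>gw_measure p) ^ k \<partial>measure_pmf p)"
    by (rule nn_integral_gw_prod) measurable
  also have "\<dots> \<le> (\<integral>\<^sup>+k. ennreal (1 - r * a) ^ k \<partial>measure_pmf p)"
    using le by (intro nn_integral_mono power_mono) auto
  also have "\<dots> = ennreal (measure_pmf.expectation p (\<lambda>k. (1 - r * a) ^ k))"
    using ra r a by (intro nn_integral_pgf) auto
  also have "\<dots> \<le> ennreal (1 - a)" using fix_le by (rule ennreal_leI)
  finally show ?case .
qed simp

text \<open>Taking expectations in \<open>perc_le_escape_upto\<close> bounds the mean of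
  \<open>1 - escape_upto\<close> by \<open>1 - (1 - r) * a\<close>, which is less than 1 and does
  not depend on the level.\<close>

lemma escape_not_AE_0:
  assumes "supercritical p"
  shows "\<not> (AE \<omega> in gw_measure p. escape UNIV \<omega> [] = 0)"
proof
  interpret G: prob_space "gw_measure p" by (rule prob_space_gw_measure)
  assume AE0: "AE \<omega> in gw_measure p. escape UNIV \<omega> [] = 0"
  obtain r a :: real where r: "0 < r" "r < 1" and a: "0 < a" "a < 1"
    and fix_le: "measure_pmf.expectation p (\<lambda>k. (1 - r * a) ^ k) \<le> 1 - a"
    using supercritical_thinning[OF assms] .
  note [measurable] = measurable_perc_upto[of "\<lambda>_ _. r", simplified]
  have bound: "(\<integral>\<^sup>+\<omega>. ennreal (1 - escape_upto UNIV \<omega> n []) \<partial>gw_measure p) \<le> ennreal (1 - (1 - r) * a)" for n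
  proof -
    let ?y = "\<lambda>\<omega>. perc_upto (\<lambda>_. r) \<omega> n []"
    have y: "0 \<le> ?y \<omega>" "?y \<omega> \<le> 1" for \<omega>
      using perc_upto_bounds[of "\<lambda>_. r" \<omega> n "[]"] r by auto
    have "(\<integral>\<^sup>+\<omega>. ennreal (1 - escape_upto UNIV \<omega> n []) \<partial>gw_measure p)
       \<le> (\<integral>\<^sup>+\<omega>. ennreal r + ennreal (1 - r) * ennreal (1 - ?y \<omega>) \<partial>gw_measure p)"
    proof (rule nn_integral_mono)
      fix \<omega>
      have "1 - escape_upto UNIV \<omega> n [] \<le> r + (1 - r) * (1 - ?y \<omega>)"
        using perc_le_escape_upto[OF r, of \<omega> n "[]"] by (simp add: algebra_simps)
      then show "ennreal (1 - escape_upto UNIV \<omega> n []) \<le> ennreal r + ennreal (1 - r) * ennreal (1 - ?y \<omega>)"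
        using r y by (auto simp: ennreal_mult[symmetric] ennreal_plus[symmetric] simp del: ennreal_plus
            intro: ennreal_leI)
    qed
    also have "\<dots> = ennreal r + ennreal (1 - r) * (\<integral>\<^sup>+\<omega>. ennreal (1 - ?y \<omega>) \<partial>gw_measure p)"
      using G.emeasure_space_1 by (simp add: nn_integral_add nn_integral_cmult)
    also have "\<dots> \<le> ennreal r + ennreal (1 - r) * ennreal (1 - a)"
      by (intro add_left_mono mult_left_mono perc_upto_const_gw[OF r a fix_le]) auto
    also have "\<dots> = ennreal (r + (1 - r) * (1 - a))"
      using r a by (simp add: ennreal_mult)
    also have "r + (1 - r) * (1 - a) = 1 - (1 - r) * a" by (simp add: algebra_simps)
    finally show ?thesis .
  qed
  have "(\<lambda>n. \<integral>\<^sup>+\<omega>. ennreal (1 - escape_upto UNIV \<omega> n []) \<partial>gw_measure p)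
      \<longlonglongrightarrow> (\<integral>\<^sup>+\<omega>. ennreal (1 - escape UNIV \<omega> []) \<partial>gw_measure p)"
    by (rule nn_integral_dominated_convergence[where w = "\<lambda>_. 1"])
       (use G.emeasure_space_1 in \<open>auto intro!: tendsto_intros escape_upto_LIMSEQ simp: ennreal_le_1\<close>)
  then have "(\<integral>\<^sup>+\<omega>. ennreal (1 - escape UNIV \<omega> []) \<partial>gw_measure p) \<le> ennreal (1 - (1 - r) * a)"
    using bound by (intro LIMSEQ_le_const2) auto
  moreover have "(\<integral>\<^sup>+\<omega>. ennreal (1 - escape UNIV \<omega> []) \<partial>gw_measure p) = (\<integral>\<^sup>+\<omega>. 1 \<partial>gw_measure p)"
    using AE0 by (intro nn_integral_cong_AE) auto
  ultimately have "1 \<le> ennreal (1 - (1 - r) * a)" using G.emeasure_space_1 by simp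
  then have "1 \<le> 1 - (1 - r) * a" by (simp add: one_ennreal_def[symmetric] ennreal_le_iff2 del: ennreal_1)
  moreover have "0 < (1 - r) * a" using r a by simp
  ultimately show False by linarith
qed

text \<open>Given the number of children, their subtrees are independent copies of the tree, so the
  condition on all of them has probability a power of that of \<open>A\<close>. It is applied to
  extinction and to vanishing escape probability.\<close>

lemma hereditary_prob_fixed_point:
  assumes A [measurable]: "A \<in> sets (gw_measure p)"
    and her: "\<And>\<omega>. \<omega> \<in> A \<longleftrightarrow> (\<forall>i<\<omega> []. subtree \<omega> [i] \<in> A)"
  shows "measure_pmf.expectation p (\<lambda>k. measure (gw_measure p) A ^ k) = measure (gw_measure p) A"
proof -
  interpret G: prob_space "gw_measure p" by (rule prob_space_gw_measure)
  let ?x = "measure (gw_measure p) A"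
  have "ennreal ?x = (\<integral>\<^sup>+\<omega>. indicator A \<omega> \<partial>gw_measure p)"
    by (simp add: G.emeasure_eq_measure)
  also have "\<dots> = (\<integral>\<^sup>+\<omega>. (\<Prod>i<\<omega> []. indicator A (subtree \<omega> [i])) \<partial>gw_measure p)"
  proof (rule nn_integral_cong)
    fix \<omega>
    show "(indicator A \<omega> :: ennreal) = (\<Prod>i<\<omega> []. indicator A (subtree \<omega> [i]))"
      using her[of \<omega>] by (auto simp: indicator_def)
  qed
  also have "\<dots> = (\<integral>\<^sup>+k. (\<integral>\<^sup>+\<omega>. indicator A \<omega> \<partial>gw_measure p) ^ k \<partial>measure_pmf p)"
    by (rule nn_integral_gw_prod) measurable
  also have "\<dots> = ennreal (measure_pmf.expectation p (\<lambda>k. ?x ^ k))"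
    by (simp add: G.emeasure_eq_measure nn_integral_pgf)
  finally show ?thesis by (simp add: ennreal_inj integral_nonneg_AE)
qed

lemma finite_gw_verts_iff:
  "finite (gw_verts \<omega>) \<longleftrightarrow> (\<forall>i<\<omega> []. finite (gw_verts (subtree \<omega> [i])))"
proof -
  have eq: "gw_verts \<omega> = insert [] (\<Union>i<\<omega> []. (#) i ` gw_verts (subtree \<omega> [i]))"
  proof (rule set_eqI)
    fix w show "w \<in> gw_verts \<omega> \<longleftrightarrow> w \<in> insert [] (\<Union>i<\<omega> []. (#) i ` gw_verts (subtree \<omega> [i]))"
      by (cases w) (auto simp: gw_verts_Cons)
  qed
  show ?thesis by (subst eq) (auto simp: finite_image_iff)
qed

text \<open>Extinction implies zero escape probability. Both events are hereditary and have
  probability below 1, so both probabilities are the unique fixed point below 1 of the generating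
  function, and the events differ by a null set.\<close>

lemma AE_survival_imp_escape:
  assumes p: "supercritical p"
  shows "AE \<omega> in gw_measure p. \<omega> \<in> survival \<longrightarrow> 0 < escape UNIV \<omega> []"
proof -
  interpret G: prob_space "gw_measure p" by (rule prob_space_gw_measure)
  define E where "E = - survival"
  define Z where "Z = {\<omega>. escape UNIV \<omega> [] = 0}"
  have E: "E \<in> sets (gw_measure p)"
    using sets.compl_sets[OF survival_measurable[of p]] by (simp add: E_def Compl_eq_Diff_UNIV)
  have "Z = {\<omega>\<in>space (gw_measure p). escape UNIV \<omega> [] = 0}" by (simp add: Z_def)
  also have "\<dots> \<in> sets (gw_measure p)" by measurable
  finally have Z: "Z \<in> sets (gw_measure p)" .
  have EZ: "E \<subseteq> Z" by (auto simp: E_def Z_def survival_def gw_tree_def escape_finite)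
  have "\<omega> \<in> Z \<longleftrightarrow> (\<forall>i<\<omega> []. subtree \<omega> [i] \<in> Z)" for \<omega>
  proof -
    let ?S = "\<Sum>i<\<omega> []. escape UNIV (subtree \<omega> [i]) []"
    have "escape UNIV \<omega> [] = ?S / (1 + ?S)"
      using escape_rec[of "[]" UNIV \<omega>] escape_subtree[of \<omega> "[i]" "[]" for i] by simp
    moreover have "0 \<le> ?S" by (intro sum_nonneg) auto
    ultimately have "escape UNIV \<omega> [] = 0 \<longleftrightarrow> ?S = 0" by (auto simp: add_nonneg_eq_0_iff)
    also have "\<dots> \<longleftrightarrow> (\<forall>i<\<omega> []. escape UNIV (subtree \<omega> [i]) [] = 0)"
      by (subst sum_nonneg_eq_0_iff) auto
    finally show ?thesis by (simp add: Z_def)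
  qed
  then have fZ: "measure_pmf.expectation p (\<lambda>k. measure (gw_measure p) Z ^ k) = measure (gw_measure p) Z"
    by (intro hereditary_prob_fixed_point Z)
  have "\<omega> \<in> E \<longleftrightarrow> (\<forall>i<\<omega> []. subtree \<omega> [i] \<in> E)" for \<omega>
    using finite_gw_verts_iff[of \<omega>] by (simp add: E_def survival_def gw_tree_def)
  then have fE: "measure_pmf.expectation p (\<lambda>k. measure (gw_measure p) E ^ k) = measure (gw_measure p) E"
    by (intro hereditary_prob_fixed_point E)
  have Z1: "measure (gw_measure p) Z < 1"
  proof (rule ccontr)
    assume "\<not> measure (gw_measure p) Z < 1"
    then have "measure (gw_measure p) Z = 1" using G.prob_le_1[of Z] by simp
    then have "AE \<omega> in gw_measure p. \<omega> \<in> Z" using Z by (simp add: G.prob_eq_1)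
    then show False using escape_not_AE_0[OF p] by (simp add: Z_def)
  qed
  have "measure (gw_measure p) E \<le> measure (gw_measure p) Z"
    using EZ Z by (intro G.finite_measure_mono) auto
  with Z1 have "measure (gw_measure p) Z = measure (gw_measure p) E"
    by (intro pgf_fixed_point_unique[OF p _ _ _ _ fZ fE]) auto
  then have "measure (gw_measure p) (Z - E) = 0"
    using EZ E Z by (simp add: G.finite_measure_Diff)
  then have "AE \<omega> in gw_measure p. \<omega> \<notin> Z - E"
    using E Z by (intro G.prob_eq_0[THEN iffD1]) auto
  then show ?thesis
  proof eventually_elim
    case (elim \<omega>)
    then show ?case using escape_nonneg[of UNIV \<omega> "[]"] by (auto simp: Z_def E_def less_le)
  qed
qed

section \<open>Finiteness of the past\<close>

definition retain :: "(nat list \<Rightarrow> nat) \<Rightarrow> nat list \<Rightarrow> real" where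
  "retain \<omega> v = 1 - escape UNIV \<omega> v"

definition past_prob :: "(nat list \<Rightarrow> nat) \<Rightarrow> nat list \<Rightarrow> real" where
  "past_prob \<omega> v = perc (retain \<omega>) \<omega> v"

lemma retain_bounds: "0 \<le> retain \<omega> v \<and> retain \<omega> v \<le> 1"
  by (simp add: retain_def)

lemma past_prob_bounds: "0 \<le> past_prob \<omega> v" "past_prob \<omega> v \<le> 1"
  using perc_bounds[OF retain_bounds] by (simp_all add: past_prob_def)

lemma past_prob_subtree: "past_prob \<omega> (v @ w) = past_prob (subtree \<omega> v) w"
proof -
  have "(\<lambda>u. retain \<omega> (v @ u)) = retain (subtree \<omega> v)"
    by (simp add: retain_def escape_subtree fun_eq_iff)
  then show ?thesis by (simp add: past_prob_def perc_def perc_upto_subtree)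
qed

lemma measurable_past_prob [measurable]: "(\<lambda>\<omega>. past_prob \<omega> v) \<in> borel_measurable (gw_measure p)"
  unfolding past_prob_def
  by (rule borel_measurable_LIMSEQ_real[OF perc_upto_LIMSEQ[OF retain_bounds]])
     (intro measurable_perc_upto, simp add: retain_def)

text \<open>The tree on the parent's side becomes branch 0 of an i.i.d. sequence in which the
  children have the indices 1 to \<open>k\<close>. This puts the parent's side on the same footing
  as the children, which the exchange of branches requires.\<close>

lemma nn_integral_root_branch:
  assumes g [measurable]: "\<And>k. g k \<in> borel_measurable (gw_forest p)"
  shows "(\<integral>\<^sup>+\<omega>. \<integral>\<^sup>+k. \<integral>\<^sup>+t. g k (case_nat \<omega> t) \<partial>gw_forest p \<partial>measure_pmf p \<partial>gw_measure p)
    = (\<integral>\<^sup>+k. \<integral>\<^sup>+u. g k u \<partial>gw_forest p \<partial>measure_pmf p)"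
proof -
  interpret F: prob_space "gw_forest p" by (rule prob_space_gw_forest)
  interpret G: prob_space "gw_measure p" by (rule prob_space_gw_measure)
  interpret PG: pair_sigma_finite "measure_pmf p" "gw_measure p" by unfold_locales
  have [measurable]: "(\<lambda>(\<omega>, t). case_nat \<omega> t) \<in> gw_measure p \<Otimes>\<^sub>M gw_forest p \<rightarrow>\<^sub>M gw_forest p"
  proof (rule measurable_gw_forestI)
    fix i
    show "(\<lambda>x. (case x of (\<omega>, t) \<Rightarrow> case_nat \<omega> t) i) \<in> gw_measure p \<Otimes>\<^sub>M gw_forest p \<rightarrow>\<^sub>M gw_measure p"
      by (cases i) (auto simp: split_beta')
  qed
  have [measurable]: "(\<lambda>\<omega>. \<integral>\<^sup>+t. g k (case_nat \<omega> t) \<partial>gw_forest p) \<in> borel_measurable (gw_measure p)" for k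
  proof (rule F.borel_measurable_nn_integral)
    have "(\<lambda>x. g k ((\<lambda>(\<omega>, t). case_nat \<omega> t) x)) \<in> borel_measurable (gw_measure p \<Otimes>\<^sub>M gw_forest p)"
      by measurable
    then show "(\<lambda>(\<omega>, t). g k (case_nat \<omega> t)) \<in> borel_measurable (gw_measure p \<Otimes>\<^sub>M gw_forest p)"
      by (simp add: split_beta')
  qed
  have "(\<lambda>x. \<integral>\<^sup>+t. g (fst x) (case_nat (snd x) t) \<partial>gw_forest p)
      \<in> borel_measurable (count_space UNIV \<Otimes>\<^sub>M gw_measure p)"
    by (rule measurable_pair_measure_countable1) auto
  also have "measurable (count_space UNIV \<Otimes>\<^sub>M gw_measure p) borel
      = (measurable (measure_pmf p \<Otimes>\<^sub>M gw_measure p) borel :: (nat \<times> _ \<Rightarrow> ennreal) set)"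
    by (intro measurable_cong_sets sets_pair_measure_cong) auto
  finally have m: "(\<lambda>(k, \<omega>). \<integral>\<^sup>+t. g k (case_nat \<omega> t) \<partial>gw_forest p)
      \<in> borel_measurable (measure_pmf p \<Otimes>\<^sub>M gw_measure p)" by (simp add: split_beta')
  show ?thesis
    using PG.Fubini'[OF m] by (simp add: nn_integral_gw_forest[of "g _"])
qed

lemma AE_eq_of_nn_integral_eq:
  assumes "f \<in> borel_measurable M" "g \<in> borel_measurable M" "\<And>x. f x \<le> g x"
    and "(\<integral>\<^sup>+x. f x \<partial>M) = (\<integral>\<^sup>+x. g x \<partial>M)" "(\<integral>\<^sup>+x. f x \<partial>M) \<noteq> \<infinity>"
  shows "AE x in M. f x = (g x :: ennreal)"
proof -
  have "AE x in M. g x \<le> f x" using nn_integral_less[of f M g] assms by auto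
  then show ?thesis using assms(3) by (auto intro: antisym)
qed

text \<open>The harmonic measure on bi-infinite paths gives the edge joining the roots of two independent
  trees with escape conductances \<open>c'\<close> and \<open>c\<close> the mass \<open>1 / (1 / c' + 1 + 1 / c)\<close> and gives the pair
  of branches \<open>i\<close> and \<open>j\<close> at a vertex the mass \<open>b\<^sub>i b\<^sub>j / (\<Sum>k. b\<^sub>k)\<close>. It is symmetric under
  exchanging branches, so the expectation of \<open>past_prob / c\<close> under it does not change from a vertex to
  its child; the inequality between \<open>past_prob\<close> of a vertex and the sum over its children is
  therefore an equality.\<close>

context
  fixes p :: "nat pmf" and B Q s C :: "(nat list \<Rightarrow> nat) \<Rightarrow> real"
  defines "B \<equiv> \<lambda>\<omega>. escape UNIV \<omega> []"
    and "Q \<equiv> \<lambda>\<omega>. past_prob \<omega> []"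
    and "s \<equiv> \<lambda>\<omega>. (1 - escape UNIV \<omega> []) * past_prob \<omega> []"
    and "C \<equiv> \<lambda>\<omega>. \<Sum>i<\<omega> []. escape UNIV (subtree \<omega> [i]) []"
begin

private lemma B_bounds: "0 \<le> B \<omega>" "B \<omega> \<le> 1" by (auto simp: B_def)
private lemma Q_bounds: "0 \<le> Q \<omega>" "Q \<omega> \<le> 1" using past_prob_bounds by (auto simp: Q_def)
private lemma s_bounds: "0 \<le> s \<omega>" "s \<omega> \<le> 1"
  using past_prob_bounds[of \<omega> "[]"] by (auto simp: s_def intro: mult_le_one)
private lemma C_nonneg: "0 \<le> C \<omega>" by (auto simp: C_def intro: sum_nonneg)

private lemma measurable_BQsC [measurable]:
  "B \<in> borel_measurable (gw_measure p)" "Q \<in> borel_measurable (gw_measure p)"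
  "s \<in> borel_measurable (gw_measure p)" "C \<in> borel_measurable (gw_measure p)"
  unfolding B_def Q_def s_def C_def by (auto intro!: measurable_children_sum)

private lemma B_eq: "B \<omega> = C \<omega> / (1 + C \<omega>)"
  using escape_rec[of "[]" UNIV \<omega>] escape_subtree[of \<omega> "[i]" "[]" for i] by (simp add: B_def C_def)

private lemma s_eq: "s \<omega> = Q \<omega> / (1 + C \<omega>)"
proof -
  have "1 - B \<omega> = 1 / (1 + C \<omega>)" using C_nonneg[of \<omega>] by (simp add: B_eq divide_simps)
  then show ?thesis by (simp add: s_def Q_def B_def)
qed

private lemma C_node: "C (node k t) = (\<Sum>i<k. B (t i))"
  by (simp add: C_def B_def)

private lemma Q_node: "Q (node k t) = 1 - (\<Prod>i<k. 1 - s (t i))"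
proof -
  have "Q \<omega> = 1 - (\<Prod>i<\<omega> []. 1 - s (subtree \<omega> [i]))" for \<omega>
    using perc_rec[of "retain \<omega>" \<omega> "[]", OF retain_bounds] past_prob_subtree[of \<omega> "[i]" "[]" for i]
      escape_subtree[of \<omega> "[i]" "[]" for i]
    by (simp add: Q_def s_def past_prob_def retain_def)
  then show ?thesis by simp
qed

text \<open>With c and c' the values of \<open>C\<close> at \<omega> and \<omega>', both sides are
  \<open>Q \<omega>\<close> times c' / (c + c' + c c'), one edge being viewed from its two ends. For
  positive c this factor is the harmonic mass of the edge divided by c. If c' = 0, both numerators
  vanish, whatever the denominators.\<close>

private lemma reversal_pointwise: "B \<omega>' / (B \<omega>' + C \<omega>) * Q \<omega> = s \<omega> * C \<omega>' / (B \<omega> + C \<omega>')"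
proof -
  define c c' where "c = C \<omega>" and "c' = C \<omega>'"
  have c: "0 \<le> c" "0 \<le> c'" using C_nonneg by (auto simp: c_def c'_def)
  have pos: "0 < 1 + c" "0 < 1 + c'" using c by auto
  show ?thesis
  proof (cases "c' = 0")
    case True
    then show ?thesis by (simp add: B_eq c'_def)
  next
    case False
    then have d: "0 < c' + c + c * c'" using c by (simp add: add_pos_nonneg)
    have "c' / (1 + c') + c = (c' + c + c * c') / (1 + c')"
      "c / (1 + c) + c' = (c' + c + c * c') / (1 + c)"
      using pos by (simp_all add: field_simps)
    then show ?thesis
      using pos d by (simp add: B_eq s_eq flip: c_def c'_def)
  qed
qed

text \<open>Transposing branch 0 with a child preserves the i.i.d. law and the normalising sum, so
  each term of the sum over \<open>j\<close> may be rewritten separately.\<close>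

private lemma swap_branches:
  "(\<integral>\<^sup>+u. ennreal (B (u 0) / (\<Sum>i<Suc k. B (u i)) * (\<Sum>j<k. s (u (Suc j)))) \<partial>gw_forest p)
    = (\<integral>\<^sup>+u. ennreal (s (u 0) * (\<Sum>j<k. B (u (Suc j))) / (\<Sum>i<Suc k. B (u i))) \<partial>gw_forest p)"
proof -
  let ?D = "\<lambda>u. \<Sum>i<Suc k. B (u i)"
  have D: "0 \<le> ?D u" for u by (intro sum_nonneg B_bounds)
  have "(\<integral>\<^sup>+u. ennreal (B (u 0) / ?D u * (\<Sum>j<k. s (u (Suc j)))) \<partial>gw_forest p)
      = (\<integral>\<^sup>+u. (\<Sum>j<k. ennreal (B (u 0) / ?D u * s (u (Suc j)))) \<partial>gw_forest p)"
    using D by (intro nn_integral_cong) (simp add: sum_distrib_left sum_ennreal B_bounds s_bounds del: sum.lessThan_Suc)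
  also have "\<dots> = (\<Sum>j<k. \<integral>\<^sup>+u. ennreal (B (u 0) / ?D u * s (u (Suc j))) \<partial>gw_forest p)"
    by (rule nn_integral_sum) measurable
  also have "\<dots> = (\<Sum>j<k. \<integral>\<^sup>+u. ennreal (B (u (Suc j)) / ?D u * s (u 0)) \<partial>gw_forest p)"
  proof (rule sum.cong[OF refl])
    fix j assume "j \<in> {..<k}"
    define \<pi> where "\<pi> = Transposition.transpose 0 (Suc j)"
    have \<pi>: "bij \<pi>" by (simp add: \<pi>_def)
    have Dp: "?D (\<lambda>i. u (\<pi> i)) = ?D u" for u
      by (rule sum.reindex_bij_witness[of _ \<pi> \<pi>])
         (use \<open>j \<in> {..<k}\<close> in \<open>auto simp: \<pi>_def Transposition.transpose_def\<close>)
    have "(\<integral>\<^sup>+u. ennreal (B (u 0) / ?D u * s (u (Suc j))) \<partial>gw_forest p)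
      = (\<integral>\<^sup>+u. ennreal (B (u 0) / ?D u * s (u (Suc j))) \<partial>distr (gw_forest p) (gw_forest p) (\<lambda>t i. t (\<pi> i)))"
      using distr_gw_forest_permute[OF \<pi>] by simp
    also have "\<dots> = (\<integral>\<^sup>+u. ennreal (B (u (\<pi> 0)) / ?D (\<lambda>i. u (\<pi> i)) * s (u (\<pi> (Suc j)))) \<partial>gw_forest p)"
      by (rule nn_integral_distr) (auto intro!: measurable_gw_forestI simp del: sum.lessThan_Suc)
    also have "\<dots> = (\<integral>\<^sup>+u. ennreal (B (u (Suc j)) / ?D u * s (u 0)) \<partial>gw_forest p)"
      unfolding Dp by (simp add: \<pi>_def)
    finally show "(\<integral>\<^sup>+u. ennreal (B (u 0) / ?D u * s (u (Suc j))) \<partial>gw_forest p)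
      = (\<integral>\<^sup>+u. ennreal (B (u (Suc j)) / ?D u * s (u 0)) \<partial>gw_forest p)" .
  qed
  also have "\<dots> = (\<integral>\<^sup>+u. (\<Sum>j<k. ennreal (B (u (Suc j)) / ?D u * s (u 0))) \<partial>gw_forest p)"
    by (rule nn_integral_sum[symmetric]) measurable
  also have "\<dots> = (\<integral>\<^sup>+u. ennreal (s (u 0) * (\<Sum>j<k. B (u (Suc j))) / ?D u) \<partial>gw_forest p)"
    using D by (intro nn_integral_cong)
      (simp add: sum_distrib_left sum_divide_distrib sum_ennreal B_bounds s_bounds ac_simps del: sum.lessThan_Suc)
  finally show ?thesis .
qed

private lemma sum_shift: "(\<Sum>i<Suc k. B (case_nat \<omega> t i)) = B \<omega> + (\<Sum>j<k. B (t j))"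
  by (simp only: sum.lessThan_Suc_shift) simp

text \<open>The edge between the roots of \<omega>' and \<omega> is read first from the root of
  \<omega> and, after \<open>reversal_pointwise\<close>, from the root of \<omega>', where \<omega>
  is one of the exchangeable branches; \<open>swap_branches\<close> turns it into a child. The two
  sides differ only by the union bound at the vertex.\<close>

lemma stationarity:
  "(\<integral>\<^sup>+k. \<integral>\<^sup>+u. ennreal (B (u 0) / (\<Sum>i<Suc k. B (u i)) * (1 - (\<Prod>j<k. 1 - s (u (Suc j))))) \<partial>gw_forest p \<partial>measure_pmf p)
   = (\<integral>\<^sup>+k. \<integral>\<^sup>+u. ennreal (B (u 0) / (\<Sum>i<Suc k. B (u i)) * (\<Sum>j<k. s (u (Suc j)))) \<partial>gw_forest p \<partial>measure_pmf p)"
  (is "?L = ?R")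
proof -
  interpret G: prob_space "gw_measure p" by (rule prob_space_gw_measure)
  interpret GG: pair_sigma_finite "gw_measure p" "gw_measure p" by unfold_locales
  note [simp del] = sum.lessThan_Suc
  have "?L = (\<integral>\<^sup>+\<omega>'. \<integral>\<^sup>+k. \<integral>\<^sup>+t. ennreal (B \<omega>' / (B \<omega>' + C (node k t)) * Q (node k t)) \<partial>gw_forest p \<partial>measure_pmf p \<partial>gw_measure p)"
    by (subst nn_integral_root_branch[symmetric]) (simp_all add: sum_shift C_node Q_node)
  also have "\<dots> = (\<integral>\<^sup>+\<omega>'. \<integral>\<^sup>+\<omega>. ennreal (B \<omega>' / (B \<omega>' + C \<omega>) * Q \<omega>) \<partial>gw_measure p \<partial>gw_measure p)"
    by (intro nn_integral_cong nn_integral_gw[symmetric]) measurable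
  also have "\<dots> = (\<integral>\<^sup>+\<omega>'. \<integral>\<^sup>+\<omega>. ennreal (s \<omega> * C \<omega>' / (B \<omega> + C \<omega>')) \<partial>gw_measure p \<partial>gw_measure p)"
    by (simp only: reversal_pointwise)
  also have "\<dots> = (\<integral>\<^sup>+\<omega>. \<integral>\<^sup>+\<omega>'. ennreal (s \<omega> * C \<omega>' / (B \<omega> + C \<omega>')) \<partial>gw_measure p \<partial>gw_measure p)"
    by (rule GG.Fubini') measurable
  also have "\<dots> = (\<integral>\<^sup>+\<omega>. \<integral>\<^sup>+k. \<integral>\<^sup>+t. ennreal (s \<omega> * C (node k t) / (B \<omega> + C (node k t))) \<partial>gw_forest p \<partial>measure_pmf p \<partial>gw_measure p)"
    by (intro nn_integral_cong nn_integral_gw) measurable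
  also have "\<dots> = (\<integral>\<^sup>+k. \<integral>\<^sup>+u. ennreal (s (u 0) * (\<Sum>j<k. B (u (Suc j))) / (\<Sum>i<Suc k. B (u i))) \<partial>gw_forest p \<partial>measure_pmf p)"
    by (subst nn_integral_root_branch[symmetric]) (simp_all add: sum_shift C_node)
  also have "\<dots> = ?R" by (simp only: swap_branches)
  finally show ?thesis .
qed

text \<open>The weights are at most 1, so the left side of \<open>stationarity\<close> is finite and
  the union bound must be an almost sure equality for every \<open>k\<close> of positive mass. For
  \<open>k \<ge> 2\<close> it is strict when branch 0 escapes and branches 1 and 2 have positive
  \<open>s\<close>. These three events are independent, so one of them is null, and it is not the
  first.\<close>

lemma AE_past_prob_root_0:
  assumes p: "supercritical p"
  shows "AE \<omega> in gw_measure p. Q \<omega> = 0"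
proof -
  interpret F: prob_space "gw_forest p" by (rule prob_space_gw_forest)
  interpret G: prob_space "gw_measure p" by (rule prob_space_gw_measure)
  note [simp del] = sum.lessThan_Suc
  obtain k where k: "2 \<le> k" "0 < pmf p k" using supercritical_branching[OF p] .
  let ?w = "\<lambda>k u. B (u 0) / (\<Sum>i<Suc k. B (u i))"
  let ?f = "\<lambda>k u. ennreal (?w k u * (1 - (\<Prod>j<k. 1 - s (u (Suc j)))))"
  let ?g = "\<lambda>k u. ennreal (?w k u * (\<Sum>j<k. s (u (Suc j))))"
  have w: "0 \<le> ?w n u" "?w n u \<le> 1" for n u
  proof -
    have "B (u 0) \<le> (\<Sum>i<Suc n. B (u i))"
      by (rule member_le_sum) (auto simp: B_bounds)
    then show "0 \<le> ?w n u" "?w n u \<le> 1" using B_bounds[of "u 0"] by (auto simp: divide_simps)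
  qed
  have pr: "0 \<le> (\<Prod>j<n. 1 - s (u (Suc j)))" "(\<Prod>j<n. 1 - s (u (Suc j))) \<le> 1" for n u
    by (auto intro!: prod_nonneg prod_le_1 simp: s_bounds)
  have le: "?f n u \<le> ?g n u" for n u
    using w s_bounds by (intro ennreal_leI mult_left_mono one_minus_prod_le_sum) auto
  have f1: "?f n u \<le> 1" for n u
    unfolding ennreal_le_1 using w pr by (intro mult_le_one) auto
  have fint: "(\<integral>\<^sup>+u. ?f n u \<partial>gw_forest p) \<le> 1" for n
    using nn_integral_mono[of "gw_forest p" "?f n" "\<lambda>_. 1"] f1 F.emeasure_space_1 by simp
  have "(\<integral>\<^sup>+k. \<integral>\<^sup>+u. ?f k u \<partial>gw_forest p \<partial>measure_pmf p) \<le> (\<integral>\<^sup>+k. 1 \<partial>measure_pmf p)"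
    by (intro nn_integral_mono fint)
  then have fin: "(\<integral>\<^sup>+k. \<integral>\<^sup>+u. ?f k u \<partial>gw_forest p \<partial>measure_pmf p) \<noteq> \<infinity>"
    by (auto simp: top_unique)
  have "AE k in measure_pmf p. (\<integral>\<^sup>+u. ?f k u \<partial>gw_forest p) = (\<integral>\<^sup>+u. ?g k u \<partial>gw_forest p)"
    by (rule AE_eq_of_nn_integral_eq) (use le fin stationarity in \<open>auto intro!: nn_integral_mono\<close>)
  then have "(\<integral>\<^sup>+u. ?f k u \<partial>gw_forest p) = (\<integral>\<^sup>+u. ?g k u \<partial>gw_forest p)"
    using k by (simp add: AE_measure_pmf_iff set_pmf_iff)
  moreover have "(\<integral>\<^sup>+u. ?f k u \<partial>gw_forest p) \<noteq> \<infinity>"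
    using fint[of k] by (auto simp: top_unique)
  ultimately have "AE u in gw_forest p. ?f k u = ?g k u"
    by (intro AE_eq_of_nn_integral_eq le) auto
  then have AE: "AE u in gw_forest p. \<not> (\<forall>i\<in>{0, 1, 2}. u i \<in> (if i = 0 then {\<omega>. 0 < B \<omega>} else {\<omega>. 0 < s \<omega>}))"
  proof eventually_elim
    case (elim u)
    show ?case
    proof
      assume "\<forall>i\<in>{0, 1, 2}. u i \<in> (if i = 0 then {\<omega>. 0 < B \<omega>} else {\<omega>. 0 < s \<omega>})"
      then have pos: "0 < B (u 0)" "0 < s (u 1)" "0 < s (u 2)" by auto
      have "B (u 0) \<le> (\<Sum>i<Suc k. B (u i))"
        by (rule member_le_sum) (auto simp: B_bounds)
      then have "0 < ?w k u" using pos by simp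
      moreover have "1 - (\<Prod>j<k. 1 - s (u (Suc j))) < (\<Sum>j<k. s (u (Suc j)))"
        using k pos s_bounds by (intro one_minus_prod_less_sum[where a = 0 and b = 1]) (auto simp: numeral_2_eq_2)
      ultimately have "?w k u * (1 - (\<Prod>j<k. 1 - s (u (Suc j)))) < ?w k u * (\<Sum>j<k. s (u (Suc j)))"
        by (intro mult_strict_left_mono)
      moreover have "0 \<le> ?w k u * (1 - (\<Prod>j<k. 1 - s (u (Suc j))))"
        using w pr by (intro mult_nonneg_nonneg) auto
      ultimately have "?f k u < ?g k u" by (intro ennreal_lessI) auto
      with elim show False by simp
    qed
  qed
  have pB: "{\<omega>. 0 < B \<omega>} \<in> sets (gw_measure p)"
    using measurable_sets[OF measurable_BQsC(1), of "{0<..}"] by (simp add: vimage_def)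
  have ps: "{\<omega>. 0 < s \<omega>} \<in> sets (gw_measure p)"
    using measurable_sets[OF measurable_BQsC(3), of "{0<..}"] by (simp add: vimage_def)
  define X where "X i = (if i = (0::nat) then {\<omega>. 0 < B \<omega>} else {\<omega>. 0 < s \<omega>})" for i
  have X: "X i \<in> sets (gw_measure p)" for i using pB ps by (simp add: X_def)
  have "{u\<in>space (gw_forest p). \<forall>i\<in>{0, 1, 2}. u i \<in> X i} \<in> sets (gw_forest p)" using X by measurable
  then have "{u. \<forall>i\<in>{0, 1, 2}. u i \<in> X i} \<in> sets (gw_forest p)" by simp
  then have "emeasure (gw_forest p) {u. \<forall>i\<in>{0, 1, 2}. u i \<in> X i} = 0"
    using AE by (subst (asm) AE_iff_measurable[where N = "{u. \<forall>i\<in>{0, 1, 2}. u i \<in> X i}"]) (auto simp: X_def)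
  then have "(\<Prod>i\<in>{0::nat, 1, 2}. emeasure (gw_measure p) (X i)) = 0"
    using emeasure_gw_forest_cylinder[of "{0, 1, 2}" X p] X by simp
  moreover have "emeasure (gw_measure p) (X 0) \<noteq> 0"
  proof
    assume "emeasure (gw_measure p) (X 0) = 0"
    then have "AE \<omega> in gw_measure p. \<omega> \<notin> X 0" using X by (intro AE_not_in) (auto simp: null_sets_def)
    then have "AE \<omega> in gw_measure p. escape UNIV \<omega> [] = 0"
    proof eventually_elim
      case (elim \<omega>)
      then show ?case
        using escape_nonneg[of UNIV \<omega> "[]"] by (simp add: X_def B_def del: escape_nonneg)
    qed
    with escape_not_AE_0[OF p] show False by simp
  qed
  ultimately have "emeasure (gw_measure p) (X 1) = 0" by (auto simp: X_def)
  then have "AE \<omega> in gw_measure p. \<omega> \<notin> X 1" using X by (intro AE_not_in) (auto simp: null_sets_def)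
  then show ?thesis
  proof eventually_elim
    case (elim \<omega>)
    have "0 < 1 + C \<omega>" using C_nonneg[of \<omega>] by simp
    moreover have "\<not> 0 < Q \<omega> / (1 + C \<omega>)" using elim by (simp add: X_def s_eq)
    ultimately show ?case using Q_bounds(1)[of \<omega>] divide_pos_pos[of "Q \<omega>" "1 + C \<omega>"] by linarith
  qed
qed

end

text \<open>The labels are i.i.d. over all words, so \<open>subtree \<omega> v\<close> has the law
  of \<omega> for every word \<open>v\<close>, in the tree or not, and there are countably many
  words.\<close>

lemma AE_past_prob_0:
  assumes "supercritical p"
  shows "AE \<omega> in gw_measure p. \<forall>v. past_prob \<omega> v = 0"
proof -
  have "AE \<omega> in gw_measure p. past_prob \<omega> v = 0" for v
  proof -
    have "AE \<omega> in distr (gw_measure p) (gw_measure p) (\<lambda>\<omega>. subtree \<omega> v). past_prob \<omega> [] = 0"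
      unfolding distr_subtree by (rule AE_past_prob_root_0[OF assms])
    then have "AE \<omega> in gw_measure p. past_prob (subtree \<omega> v) [] = 0"
      by (rule AE_distrD[rotated]) measurable
    then show ?thesis using past_prob_subtree[of _ v "[]"] by simp
  qed
  then show ?thesis by (simp add: AE_all_countable)
qed

section \<open>Walks\<close>

text \<open>Reachability is treated as a reflexive transitive closure, for which rule induction is
  available; walks with their edge lists remain where cycles occur.\<close>

definition adj :: "('v, 'e) mgraph \<Rightarrow> 'v \<Rightarrow> 'v \<Rightarrow> bool" where
  "adj G u v \<longleftrightarrow> u \<in> verts G \<and> v \<in> verts G \<and> (\<exists>e\<in>edges G. ends G e = {u, v})"

lemma adj_sym: "adj G u v \<Longrightarrow> adj G v u"
  by (auto simp: adj_def insert_commute)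

lemma walk_Cons:
  "walk G (u # vs) (e # es) \<longleftrightarrow>
     u \<in> verts G \<and> e \<in> edges G \<and> vs \<noteq> [] \<and> ends G e = {u, hd vs} \<and> walk G vs es"
  by (cases vs) (auto simp: walk_def nth_Cons less_Suc_eq_0_disj split: nat.splits)

lemma walk_single: "walk G [u] [] \<longleftrightarrow> u \<in> verts G"
  by (simp add: walk_def)

lemma walk_imp_adj:
  "walk G vs es \<Longrightarrow> hd vs \<in> verts G \<and> (adj G)\<^sup>*\<^sup>* (hd vs) (last vs)"
proof (induction es arbitrary: vs)
  case Nil
  then show ?case by (cases vs) (auto simp: walk_def)
next
  case (Cons e es)
  then obtain u ws where vs: "vs = u # ws" by (cases vs) (auto simp: walk_def)
  with Cons.prems have w: "u \<in> verts G" "e \<in> edges G" "ws \<noteq> []" "ends G e = {u, hd ws}" "walk G ws es"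
    by (auto simp: walk_Cons)
  then have "adj G u (hd ws)" "(adj G)\<^sup>*\<^sup>* (hd ws) (last ws)"
    using Cons.IH[of ws] by (auto simp: adj_def[of G u])
  then show ?case using vs w by (auto intro: converse_rtranclp_into_rtranclp)
qed

lemma adj_imp_reachable:
  assumes "(adj G)\<^sup>*\<^sup>* u v" "v \<in> verts G"
  shows "reachable G u v"
  using assms
proof (induction rule: converse_rtranclp_induct)
  case base
  then show ?case
    unfolding reachable_def by (intro exI[where x = "[v]"], intro exI[where x = "[]"]) (simp add: walk_single)
next
  case (step x y)
  then obtain vs es where w: "walk G vs es" "hd vs = y" "last vs = v" by (auto simp: reachable_def)
  from step(1) obtain e where "e \<in> edges G" "ends G e = {x, y}" "x \<in> verts G" by (auto simp: adj_def)
  moreover have "vs \<noteq> []" using w by (auto simp: walk_def)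
  ultimately show ?case unfolding reachable_def using w
    by (intro exI[of _ "x # vs"] exI[of _ "e # es"]) (auto simp: walk_Cons)
qed

lemma reachable_iff: "reachable G u v \<longleftrightarrow> v \<in> verts G \<and> (adj G)\<^sup>*\<^sup>* u v"
proof
  assume "reachable G u v"
  then obtain vs es where w: "walk G vs es" "hd vs = u" "last vs = v" by (auto simp: reachable_def)
  then have "vs \<noteq> []" by (auto simp: walk_def)
  then have "v \<in> verts G" using w last_in_set by (force simp: walk_def)
  then show "v \<in> verts G \<and> (adj G)\<^sup>*\<^sup>* u v" using walk_imp_adj[OF w(1)] w by simp
qed (auto intro: adj_imp_reachable)

lemma rtranclp_adj_sym: "(adj G)\<^sup>*\<^sup>* u v \<Longrightarrow> (adj G)\<^sup>*\<^sup>* v u"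
  by (induction rule: rtranclp_induct) (auto intro: adj_sym converse_rtranclp_into_rtranclp)

text \<open>A new first vertex is prepended unless it already lies on the walk, in which case the
  walk is cut so as to start there.\<close>

lemma reachable_distinct_walk:
  assumes "reachable G u v"
  obtains vs es where "walk G vs es" "hd vs = u" "last vs = v" "distinct vs"
proof -
  have "v \<in> verts G" "(adj G)\<^sup>*\<^sup>* v u" using assms by (auto simp: reachable_iff intro: rtranclp_adj_sym)
  from this(2) have "\<exists>vs es. walk G vs es \<and> hd vs = u \<and> last vs = v \<and> distinct vs"
  proof (induction rule: rtranclp_induct)
    case base
    show ?case using \<open>v \<in> verts G\<close>
      by (intro exI[where x = "[v]"], intro exI[where x = "[]"]) (simp add: walk_single)
  next
    case (step y z)
    then obtain vs es where w: "walk G vs es" "hd vs = y" "last vs = v" "distinct vs" by auto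
    show ?case
    proof (cases "z \<in> set vs")
      case True
      then obtain k where k: "k < length vs" "vs ! k = z" by (auto simp: in_set_conv_nth)
      have "walk G (drop k vs) (drop k es)"
        using w(1) k set_drop_subset[of k vs] set_drop_subset[of k es] by (auto simp: walk_def)
      then show ?thesis using w k
        by (intro exI[of _ "drop k vs"] exI[of _ "drop k es"]) (auto simp: hd_drop_conv_nth)
    next
      case False
      from step(2) obtain e where "e \<in> edges G" "ends G e = {z, y}" "z \<in> verts G"
        by (auto simp: adj_def insert_commute)
      moreover have "vs \<noteq> []" using w by (auto simp: walk_def)
      ultimately show ?thesis using w False
        by (intro exI[of _ "z # vs"] exI[of _ "e # es"]) (auto simp: walk_Cons)
    qed
  qed
  then show thesis using that by blast
qed

lemma walk_closing_cycle:
  assumes w: "walk G vs es" "distinct vs" and e: "e \<in> edges G" "e \<notin> set es" "ends G e = {last vs, hd vs}"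
  shows "cycle G (vs @ [hd vs]) (es @ [e])"
proof -
  have len: "length vs = Suc (length es)" using w by (simp add: walk_def)
  then have ne: "vs \<noteq> []" by auto
  have "walk G (vs @ [hd vs]) (es @ [e])"
    using w e len ne by (auto simp: walk_def nth_append less_Suc_eq last_conv_nth)
  moreover have "distinct es"
    unfolding distinct_conv_nth
  proof (intro allI impI notI)
    fix i j assume ij: "i < length es" "j < length es" "i \<noteq> j" "es ! i = es ! j"
    have "ends G (es ! k) = {vs ! k, vs ! Suc k}" if "k < length es" for k
      using that w(1) by (simp add: walk_def)
    from this[OF ij(1)] this[OF ij(2)] have "{vs ! i, vs ! Suc i} = {vs ! j, vs ! Suc j}"
      using ij(4) by simp
    then show False using ij w(2) len by (auto simp: doubleton_eq_iff nth_eq_iff_index_eq)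
  qed
  moreover have "distinct (tl (vs @ [hd vs]))" using w(2) ne by (cases vs) auto
  ultimately show ?thesis using e ne by (auto simp: cycle_def)
qed

section \<open>Spanning trees of the wired tree as orientations\<close>

text \<open>Orient a spanning tree of the wired graph towards the boundary vertex: \<open>\<sigma> v = None\<close> if the
  edge leaving \<open>v\<close> goes up to the parent, \<open>\<sigma> v = Some i\<close> if it goes down to the child \<open>v @ [i]\<close>.\<close>

definition next_vertex :: "(nat list \<Rightarrow> nat option) \<Rightarrow> nat list \<Rightarrow> nat list" where
  "next_vertex \<sigma> v = (case \<sigma> v of None \<Rightarrow> butlast v | Some i \<Rightarrow> v @ [i])"

definition used_edges :: "(nat list \<Rightarrow> nat option) \<Rightarrow> nat list set \<Rightarrow> nat list set set" where
  "used_edges \<sigma> A = (\<lambda>v. {v, next_vertex \<sigma> v}) ` A"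

definition rooted_subtree :: "(nat list \<Rightarrow> nat) \<Rightarrow> nat list set \<Rightarrow> bool" where
  "rooted_subtree \<omega> A \<longleftrightarrow> finite A \<and> A \<subseteq> gw_verts \<omega> \<and> [] \<in> A \<and> (\<forall>v i. v @ [i] \<in> A \<longrightarrow> v \<in> A)"

text \<open>The conditions say that no edge is chosen from both its ends: the root has no parent to
  climb to, and a vertex to which its parent points must not point back.\<close>

definition orientations :: "(nat list \<Rightarrow> nat) \<Rightarrow> nat list set \<Rightarrow> (nat list \<Rightarrow> nat option) set" where
  "orientations \<omega> A = {\<sigma> \<in> A \<rightarrow>\<^sub>E UNIV. \<sigma> [] \<noteq> None \<and>
     (\<forall>v\<in>A. \<forall>i. \<sigma> v = Some i \<longrightarrow> i < \<omega> v \<and> (v @ [i] \<in> A \<longrightarrow> \<sigma> (v @ [i]) \<noteq> None))}"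

lemma finite_orientations:
  assumes "finite A"
  shows "finite (orientations \<omega> A)"
proof (rule finite_subset)
  show "orientations \<omega> A \<subseteq> (\<Pi>\<^sub>E v\<in>A. insert None (Some ` {..<\<omega> v}))"
  proof
    fix \<sigma> assume "\<sigma> \<in> orientations \<omega> A"
    then have "\<sigma> \<in> A \<rightarrow>\<^sub>E UNIV" "\<And>v i. v \<in> A \<Longrightarrow> \<sigma> v = Some i \<Longrightarrow> i < \<omega> v"
      by (auto simp: orientations_def)
    moreover from this(2) have "\<sigma> v \<in> insert None (Some ` {..<\<omega> v})" if "v \<in> A" for v
      using that by (cases "\<sigma> v") auto
    ultimately show "\<sigma> \<in> (\<Pi>\<^sub>E v\<in>A. insert None (Some ` {..<\<omega> v}))"
      by (simp add: PiE_iff)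
  qed
  show "finite (\<Pi>\<^sub>E v\<in>A. insert None (Some ` {..<\<omega> v}))"
    using assms by (intro finite_PiE) auto
qed

lemma edges_gw_tree: "e \<in> edges (gw_tree \<omega>) \<longleftrightarrow> (\<exists>u i. e = {u, u @ [i]} \<and> u @ [i] \<in> gw_verts \<omega>)"
  by (auto simp: gw_tree_def gw_verts_snoc)

lemma edges_gw_tree_cases:
  assumes "{v, w} \<in> edges (gw_tree \<omega>)"
  obtains i where "w = v @ [i]" "i < \<omega> v" | i where "v = w @ [i]" "i < \<omega> w"
  using assms by (auto simp: edges_gw_tree gw_verts_snoc doubleton_eq_iff)

lemma butlast_neq_snoc: "butlast v \<noteq> v @ [i]"
proof
  assume "butlast v = v @ [i]"
  then have "length (butlast v) = length (v @ [i])" by (rule arg_cong)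
  then show False by simp
qed

lemma next_vertex_inj:
  assumes "next_vertex \<sigma> v = next_vertex \<tau> v"
  shows "\<sigma> v = \<tau> v"
proof (cases "\<sigma> v")
  case None
  then show ?thesis
    using assms butlast_neq_snoc[of v] by (cases "\<tau> v") (simp_all add: next_vertex_def)
next
  case (Some i)
  then show ?thesis
    using assms[symmetric] butlast_neq_snoc[of v] by (cases "\<tau> v") (simp_all add: next_vertex_def)
qed

section \<open>Orientations correspond to spanning trees\<close>

context
  fixes \<omega> :: "nat list \<Rightarrow> nat" and U :: "nat list set"
  assumes U: "rooted_subtree \<omega> U"
begin

private lemma U_facts: "finite U" "[] \<in> U" "v \<in> U \<Longrightarrow> v \<in> gw_verts \<omega>" "v @ [i] \<in> U \<Longrightarrow> v \<in> U"
  using U by (auto simp: rooted_subtree_def)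

text \<open>Following \<sigma>, a path climbs at most to the root, and once it goes down it can
  never turn back. It therefore leaves the finite set \<open>U\<close>, which justifies induction
  along it: the inner induction serves vertices pointing down, the outer one vertices pointing
  up.\<close>

lemma orientation_induct:
  assumes \<sigma>: "\<sigma> \<in> orientations \<omega> U" and v: "v \<in> U"
    and step: "\<And>v. v \<in> U \<Longrightarrow> next_vertex \<sigma> v \<notin> U \<or> P (next_vertex \<sigma> v) \<Longrightarrow> P v"
  shows "P v"
proof -
  obtain M where M: "\<And>v. v \<in> U \<Longrightarrow> length v < M"
    using U_facts(1) finite_nat_set_iff_bounded[of "length ` U"] by auto
  have down: "P v" if "v \<in> U" "\<sigma> v \<noteq> None" for v
    using that
  proof (induction "M - length v" arbitrary: v rule: less_induct)
    case less
    then obtain i where i: "\<sigma> v = Some i" by auto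
    then have n: "next_vertex \<sigma> v = v @ [i]" by (simp add: next_vertex_def)
    show ?case
    proof (rule step[OF less.prems(1)])
      show "next_vertex \<sigma> v \<notin> U \<or> P (next_vertex \<sigma> v)"
      proof (cases "v @ [i] \<in> U")
        case True
        then have "\<sigma> (v @ [i]) \<noteq> None" using \<sigma> i less.prems by (auto simp: orientations_def)
        moreover have "M - length (v @ [i]) < M - length v" using M[OF True] by auto
        ultimately show ?thesis using less.hyps True n by metis
      qed (simp add: n)
    qed
  qed
  show ?thesis using v
  proof (induction "length v" arbitrary: v rule: less_induct)
    case less
    show ?case
    proof (cases "\<sigma> v = None")
      case True
      then have "v \<noteq> []" using \<sigma> by (auto simp: orientations_def)
      then have "butlast v \<in> U" "length (butlast v) < length v"
        using less.prems U_facts(4)[of "butlast v" "last v"] by auto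
      then have "P (butlast v)" using less.hyps by blast
      then show ?thesis using step[OF less.prems] True by (simp add: next_vertex_def)
    qed (use down less.prems in auto)
  qed
qed

lemma used_edge_mem:
  assumes "\<sigma> \<in> orientations \<omega> U" "v \<in> U"
  shows "{v, next_vertex \<sigma> v} \<in> edges (gw_tree \<omega>)"
proof (cases "\<sigma> v")
  case None
  then have "v \<noteq> []" using assms by (auto simp: orientations_def)
  then have "v = butlast v @ [last v]" by simp
  moreover have "v \<in> gw_verts \<omega>" using assms U_facts by auto
  ultimately show ?thesis using None unfolding edges_gw_tree next_vertex_def
    by (intro exI[of _ "butlast v"] exI[of _ "last v"]) auto
next
  case (Some i)
  then have "i < \<omega> v" using assms by (auto simp: orientations_def)
  then show ?thesis using Some assms(2) U_facts unfolding edges_gw_tree next_vertex_def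
    by (intro exI[of _ v] exI[of _ i]) (auto simp: gw_verts_snoc)
qed

text \<open>Two different owners of an edge would point at each other, but a vertex pointing down
  forbids its child to point up.\<close>

lemma used_edge_inj:
  assumes \<sigma>: "\<sigma> \<in> orientations \<omega> U" and uv: "u \<in> U" "v \<in> U"
    and eq: "{u, next_vertex \<sigma> u} = {v, next_vertex \<sigma> v}"
  shows "u = v"
proof (rule ccontr)
  have *: False if "a \<in> U" "b \<in> U" "next_vertex \<sigma> a = b" "next_vertex \<sigma> b = a" "length a < length b" for a b
  proof -
    have "\<sigma> a \<noteq> None"
    proof
      assume "\<sigma> a = None"
      then have "length (next_vertex \<sigma> a) \<le> length a" by (simp add: next_vertex_def)
      then show False using that by simp
    qed
    then obtain i where i: "\<sigma> a = Some i" by auto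
    then have b: "b = a @ [i]" using that by (simp add: next_vertex_def)
    note i = i this
    then have "\<sigma> b \<noteq> None" using \<sigma> that by (auto simp: orientations_def)
    then show False using that i by (auto simp: next_vertex_def)
  qed
  assume "u \<noteq> v"
  then have n: "next_vertex \<sigma> u = v" "next_vertex \<sigma> v = u" using eq by (auto simp: doubleton_eq_iff)
  have "length u \<noteq> length v"
  proof (cases "\<sigma> u")
    case None
    then have "u \<noteq> []" using \<sigma> by (auto simp: orientations_def)
    then have "length (next_vertex \<sigma> u) < length u" using None by (simp add: next_vertex_def)
    then show ?thesis using n by simp
  qed (use n in \<open>auto simp: next_vertex_def\<close>)
  then show False using *[of u v] *[of v u] n uv by linarith
qed

definition wired_vertex :: "nat list \<Rightarrow> nat list option" where
  "wired_vertex v = (if v \<in> U then Some v else None)"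

lemma wired_simps:
  "verts (wired (gw_tree \<omega>) U) = insert None (Some ` U)"
  "ends (wired (gw_tree \<omega>) U) e = wired_vertex ` e"
  "edges (wired (gw_tree \<omega>) U) = {e \<in> edges (gw_tree \<omega>). e \<inter> U \<noteq> {}}"
  by (simp_all add: wired_def gw_tree_def wired_vertex_def)

lemma used_edges_connected:
  assumes \<sigma>: "\<sigma> \<in> orientations \<omega> U"
  shows "connected_graph ((wired (gw_tree \<omega>) U)\<lparr>edges := used_edges \<sigma> U\<rparr>)"
proof -
  let ?K = "(wired (gw_tree \<omega>) U)\<lparr>edges := used_edges \<sigma> U\<rparr>"
  have r: "(adj ?K)\<^sup>*\<^sup>* (Some v) None" if "v \<in> U" for v
  proof (rule orientation_induct[OF \<sigma> that])
    fix v assume v: "v \<in> U" and IH: "next_vertex \<sigma> v \<notin> U \<or> (adj ?K)\<^sup>*\<^sup>* (Some (next_vertex \<sigma> v)) None"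
    have "adj ?K (Some v) (wired_vertex (next_vertex \<sigma> v))"
      using v by (auto simp: adj_def wired_simps used_edges_def wired_vertex_def)
    moreover have "(adj ?K)\<^sup>*\<^sup>* (wired_vertex (next_vertex \<sigma> v)) None"
      using IH by (auto simp: wired_vertex_def)
    ultimately show "(adj ?K)\<^sup>*\<^sup>* (Some v) None" by (rule converse_rtranclp_into_rtranclp)
  qed
  then have r': "(adj ?K)\<^sup>*\<^sup>* x None" if "x \<in> verts ?K" for x
    using that by (auto simp: wired_simps)
  show ?thesis unfolding connected_graph_def reachable_iff
    using r' rtranclp_adj_sym[OF r'] by (auto simp: wired_simps intro: rtranclp_trans)
qed

text \<open>A counting argument. A cycle has as many vertices as edges, and each of its edges has
  one owner, which lies on the cycle. Hence the owners are all the vertices of the cycle; the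
  boundary is not among them and they are closed under \<open>next_vertex\<close>. This contradicts
  that every path leaves \<open>U\<close>.\<close>

lemma used_edges_acyclic:
  assumes \<sigma>: "\<sigma> \<in> orientations \<omega> U"
  shows "\<not> cycle ((wired (gw_tree \<omega>) U)\<lparr>edges := used_edges \<sigma> U\<rparr>) vs es"
proof
  let ?K = "(wired (gw_tree \<omega>) U)\<lparr>edges := used_edges \<sigma> U\<rparr>"
  assume c: "cycle ?K vs es"
  then have len: "length vs = Suc (length es)" and es: "set es \<subseteq> used_edges \<sigma> U" "es \<noteq> []" "distinct es"
    and ends: "\<And>i. i < length es \<Longrightarrow> wired_vertex ` (es ! i) = {vs ! i, vs ! Suc i}"
    and hl: "hd vs = last vs" "distinct (tl vs)"
    by (auto simp: cycle_def walk_def wired_simps)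
  obtain x ws where vs: "vs = x # ws" using len by (cases vs) auto
  then have "ws \<noteq> []" using len es(2) by auto
  note vs = vs this
  then have set_vs: "set vs = set (tl vs)" using hl by (auto simp: last_in_set)
  then have card_vs: "card (set vs) = length es"
    using hl(2) len by (simp add: distinct_card)
  define Own where "Own = {v\<in>U. {v, next_vertex \<sigma> v} \<in> set es}"
  have "bij_betw (\<lambda>v. {v, next_vertex \<sigma> v}) Own (set es)"
    unfolding bij_betw_def
  proof
    show "inj_on (\<lambda>v. {v, next_vertex \<sigma> v}) Own"
      using used_edge_inj[OF \<sigma>] by (auto simp: inj_on_def Own_def)
    show "(\<lambda>v. {v, next_vertex \<sigma> v}) ` Own = set es"
      using es(1) by (auto simp: Own_def used_edges_def)
  qed
  then have "card Own = length es" using es(3) by (simp add: bij_betw_same_card distinct_card)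
  then have card_Own: "card (Some ` Own) = length es" by (simp add: card_image)
  have sub: "wired_vertex ` e \<subseteq> set vs" if "e \<in> set es" for e
  proof -
    obtain i where "i < length es" "e = es ! i"
      using \<open>e \<in> set es\<close> by (auto simp: in_set_conv_nth)
    then show ?thesis using ends[of i] len by simp
  qed
  have "Some ` Own \<subseteq> set vs"
  proof
    fix y assume "y \<in> Some ` Own"
    then obtain v where "y = Some v" "v \<in> U" "{v, next_vertex \<sigma> v} \<in> set es" by (auto simp: Own_def)
    then show "y \<in> set vs" using sub[of "{v, next_vertex \<sigma> v}"] by (auto simp: wired_vertex_def)
  qed
  then have eq: "Some ` Own = set vs" using card_Own card_vs by (intro card_subset_eq) auto
  have closed: "next_vertex \<sigma> v \<in> Own" if "v \<in> Own" for v
  proof -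
    have "wired_vertex (next_vertex \<sigma> v) \<in> Some ` Own"
      using that sub[of "{v, next_vertex \<sigma> v}"] unfolding eq by (auto simp: Own_def)
    then show ?thesis by (auto simp: wired_vertex_def split: if_splits)
  qed
  have "v \<notin> Own" if "v \<in> U" for v
    by (rule orientation_induct[OF \<sigma> that]) (use closed Own_def in blast)
  then have "Own = {}" by (auto simp: Own_def)
  then show False using eq vs by auto
qed

lemma used_edges_spanning_tree:
  assumes \<sigma>: "\<sigma> \<in> orientations \<omega> U"
  shows "spanning_tree (wired (gw_tree \<omega>) U) (used_edges \<sigma> U)"
  unfolding spanning_tree_def
  using used_edges_connected[OF \<sigma>] used_edges_acyclic[OF \<sigma>] used_edge_mem[OF \<sigma>]
  by (auto simp: wired_simps used_edges_def)

text \<open>The induction starts where the path of \<sigma> leaves \<open>U\<close> and works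
  backwards. If the edge from \<open>v\<close> had another owner \<open>w\<close> under \<tau>, then
  \<open>w\<close> would be the next vertex of \<open>v\<close> under \<sigma>, and the induction
  hypothesis would make \<sigma> point from \<open>w\<close> back to \<open>v\<close>.\<close>

lemma used_edges_determine:
  assumes \<sigma>: "\<sigma> \<in> orientations \<omega> U" and \<tau>: "\<tau> \<in> orientations \<omega> U"
    and eq: "used_edges \<sigma> U = used_edges \<tau> U"
  shows "\<sigma> = \<tau>"
proof -
  have "next_vertex \<sigma> v = next_vertex \<tau> v" if "v \<in> U" for v
  proof (rule orientation_induct[OF \<sigma> that])
    fix v assume v: "v \<in> U" and IH: "next_vertex \<sigma> v \<notin> U \<or>
      next_vertex \<sigma> (next_vertex \<sigma> v) = next_vertex \<tau> (next_vertex \<sigma> v)"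
    have "{v, next_vertex \<sigma> v} \<in> used_edges \<tau> U" using v eq by (auto simp: used_edges_def)
    then obtain w where w: "w \<in> U" "{v, next_vertex \<sigma> v} = {w, next_vertex \<tau> w}" by (auto simp: used_edges_def)
    show "next_vertex \<sigma> v = next_vertex \<tau> v"
    proof (cases "w = v")
      case False
      then have "next_vertex \<sigma> v = w" "next_vertex \<tau> w = v" using w(2) by (auto simp: doubleton_eq_iff)
      then have "next_vertex \<sigma> w = v" using IH w(1) by auto
      then show ?thesis using used_edge_inj[OF \<sigma> v w(1)] \<open>next_vertex \<sigma> v = w\<close> False
        by (auto simp: insert_commute)
    qed (use w(2) in \<open>auto simp: doubleton_eq_iff\<close>)
  qed
  then have "\<sigma> v = \<tau> v" if "v \<in> U" for v
    using that next_vertex_inj by auto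
  then show ?thesis using \<sigma> \<tau> by (intro PiE_ext[of \<sigma> U "\<lambda>_. UNIV" \<tau>]) (auto simp: orientations_def)
qed

text \<open>Every vertex points along the first edge of a shortest path in \<open>T\<close> to the
  boundary. The distance \<open>d\<close> drops at each step, so neighbours cannot point at each
  other. The chosen edges already connect the wired graph, so a further edge of \<open>T\<close>
  would close a cycle.\<close>

lemma spanning_tree_orientation:
  assumes T: "spanning_tree (wired (gw_tree \<omega>) U) T"
  shows "T \<in> (\<lambda>\<sigma>. used_edges \<sigma> U) ` orientations \<omega> U"
proof -
  let ?H = "wired (gw_tree \<omega>) U"
  let ?K = "?H\<lparr>edges := T\<rparr>"
  define d where "d x = (LEAST n. (adj ?K ^^ n) x None)" for x
  have TE: "T \<subseteq> edges ?H" and con: "connected_graph ?K" and acyc: "\<And>vs es. \<not> cycle ?K vs es"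
    using T by (auto simp: spanning_tree_def)
  have "\<exists>w. {v, w} \<in> T \<and> d (wired_vertex w) < d (Some v)" if v: "v \<in> U" for v
  proof -
    have "reachable ?K (Some v) None" using con v by (auto simp: connected_graph_def wired_simps)
    then have "\<exists>n. (adj ?K ^^ n) (Some v) None" by (auto simp: reachable_iff rtranclp_power)
    then have dv: "(adj ?K ^^ d (Some v)) (Some v) None" unfolding d_def by (rule LeastI_ex)
    then obtain m where m: "d (Some v) = Suc m" by (cases "d (Some v)") auto
    have "\<exists>y. adj ?K (Some v) y \<and> (adj ?K ^^ m) y None"
      by (rule relpowp_Suc_D2) (use dv m in simp)
    then obtain y where y: "adj ?K (Some v) y" "(adj ?K ^^ m) y None" by auto
    have dy: "d y \<le> m" unfolding d_def by (rule Least_le) (rule y)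
    from y(1) obtain e where e: "e \<in> T" "wired_vertex ` e = {Some v, y}" by (auto simp: adj_def wired_simps)
    then have "Some v \<in> wired_vertex ` e" by simp
    then have "v \<in> e" by (auto simp: wired_vertex_def split: if_splits)
    have "e \<in> edges (gw_tree \<omega>)" using TE e(1) by (auto simp: wired_simps)
    then obtain a i where "e = {a, a @ [i]}" by (auto simp: edges_gw_tree)
    with \<open>v \<in> e\<close> obtain w where w: "e = {v, w}" by (metis insertE insert_commute singletonD)
    have "wired_vertex v = Some v" using v by (simp add: wired_vertex_def)
    then have "{Some v, wired_vertex w} = {Some v, y}" using e(2) w by simp
    then have "y = wired_vertex w \<or> y = Some v" by (auto simp: doubleton_eq_iff)
    moreover have "y \<noteq> Some v" using dy m by auto
    ultimately have "d (wired_vertex w) < d (Some v)" using dy m by simp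
    then show ?thesis using e w by auto
  qed
  then have "\<forall>v\<in>U. \<exists>w. {v, w} \<in> T \<and> d (wired_vertex w) < d (Some v)" by blast
  then obtain f where "\<forall>v\<in>U. {v, f v} \<in> T \<and> d (wired_vertex (f v)) < d (Some v)"
    by (rule bchoice[THEN exE])
  then have f: "\<And>v. v \<in> U \<Longrightarrow> {v, f v} \<in> T" "\<And>v. v \<in> U \<Longrightarrow> d (wired_vertex (f v)) < d (Some v)"
    by auto
  define \<sigma> where "\<sigma> = (\<lambda>v\<in>U. if v \<noteq> [] \<and> f v = butlast v then None else Some (last (f v)))"
  have fe: "{v, f v} \<in> edges (gw_tree \<omega>)" if "v \<in> U" for v using f(1)[OF that] TE by (auto simp: wired_simps)
  have \<sigma>v: "(\<sigma> v = None \<and> f v = butlast v \<and> v \<noteq> []) \<or> (\<exists>i<\<omega> v. \<sigma> v = Some i \<and> f v = v @ [i])" if "v \<in> U" for v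
  proof (rule edges_gw_tree_cases[OF fe[OF that]])
    fix i assume i: "f v = v @ [i]" "i < \<omega> v"
    then have "length (f v) \<noteq> length (butlast v)" by simp
    then have "f v \<noteq> butlast v" by auto
    then show ?thesis using i that by (auto simp: \<sigma>_def)
  next
    fix i assume i: "v = f v @ [i]"
    have "butlast v = butlast (f v @ [i])" "length v = length (f v @ [i])"
      using i by (rule arg_cong)+
    then have "f v = butlast v" "v \<noteq> []" by auto
    then show ?thesis using that by (auto simp: \<sigma>_def)
  qed
  have n: "next_vertex \<sigma> v = f v" if "v \<in> U" for v
    using \<sigma>v[OF that] by (auto simp: next_vertex_def)
  have \<sigma>: "\<sigma> \<in> orientations \<omega> U"
    unfolding orientations_def
  proof (intro CollectI conjI ballI allI impI)
    show "\<sigma> \<in> U \<rightarrow>\<^sub>E UNIV" by (simp add: \<sigma>_def)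
    show "\<sigma> [] \<noteq> None" using \<sigma>v[of "[]"] U_facts by auto
    fix v i assume v: "v \<in> U" "\<sigma> v = Some i"
    then show "i < \<omega> v" using \<sigma>v[of v] by auto
    assume vi: "v @ [i] \<in> U"
    have fv: "f v = v @ [i]" using \<sigma>v[OF v(1)] v(2) by auto
    show "\<sigma> (v @ [i]) \<noteq> None"
    proof
      assume "\<sigma> (v @ [i]) = None"
      then have "f (v @ [i]) = v" using \<sigma>v[OF vi] by auto
      then show False using f(2)[OF v(1)] f(2)[OF vi] fv v(1) vi by (simp add: wired_vertex_def)
    qed
  qed
  have sub: "used_edges \<sigma> U \<subseteq> T" using f(1) n by (auto simp: used_edges_def)
  have "T \<subseteq> used_edges \<sigma> U"
  proof
    fix e assume e: "e \<in> T"
    show "e \<in> used_edges \<sigma> U"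
    proof (rule ccontr)
      assume ne: "e \<notin> used_edges \<sigma> U"
      have "e \<in> edges (gw_tree \<omega>)" using TE e by (auto simp: wired_simps)
      then obtain u i where ui: "e = {u, u @ [i]}" by (auto simp: edges_gw_tree)
      let ?K' = "?H\<lparr>edges := used_edges \<sigma> U\<rparr>"
      have "wired_vertex (u @ [i]) \<in> verts ?K'" "wired_vertex u \<in> verts ?K'"
        by (auto simp: wired_simps wired_vertex_def)
      then have "reachable ?K' (wired_vertex u) (wired_vertex (u @ [i]))"
        using used_edges_connected[OF \<sigma>] by (auto simp: connected_graph_def)
      then obtain vs es where w: "walk ?K' vs es" "hd vs = wired_vertex u"
          "last vs = wired_vertex (u @ [i])" "distinct vs"
        by (rule reachable_distinct_walk)
      have "walk ?K vs es" using w(1) sub by (auto simp: walk_def)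
      moreover have "e \<notin> set es" using ne w(1) by (auto simp: walk_def)
      ultimately have "cycle ?K (vs @ [hd vs]) (es @ [e])"
        using w e ui by (intro walk_closing_cycle) (auto simp: wired_simps)
      then show False using acyc by blast
    qed
  qed
  with sub \<sigma> show ?thesis by blast
qed

lemma spanning_trees_wired:
  "{T. spanning_tree (wired (gw_tree \<omega>) U) T} = (\<lambda>\<sigma>. used_edges \<sigma> U) ` orientations \<omega> U"
  using spanning_tree_orientation used_edges_spanning_tree by blast

lemma UST_wired_prob:
  assumes "orientations \<omega> U \<noteq> {}"
  shows "measure_pmf.prob (UST (wired (gw_tree \<omega>) U)) {T. S \<subseteq> T}
    = real (card {\<sigma>\<in>orientations \<omega> U. S \<subseteq> used_edges \<sigma> U}) / real (card (orientations \<omega> U))"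
proof -
  have inj: "inj_on (\<lambda>\<sigma>. used_edges \<sigma> U) (orientations \<omega> U)"
    using used_edges_determine by (auto simp: inj_on_def)
  have "(\<lambda>\<sigma>. used_edges \<sigma> U) ` orientations \<omega> U \<inter> {T. S \<subseteq> T}
      = (\<lambda>\<sigma>. used_edges \<sigma> U) ` {\<sigma>\<in>orientations \<omega> U. S \<subseteq> used_edges \<sigma> U}" by auto
  moreover have "card \<dots> = card {\<sigma>\<in>orientations \<omega> U. S \<subseteq> used_edges \<sigma> U}"
    by (rule card_image) (rule inj_on_subset[OF inj], auto)
  ultimately show ?thesis
    using assms finite_orientations[OF U_facts(1), of \<omega>] inj
    by (simp add: UST_def spanning_trees_wired measure_pmf_of_set card_image)
qed

end

section \<open>Independent choices\<close>

definition child_sum :: "(nat list \<Rightarrow> nat) \<Rightarrow> (nat list \<Rightarrow> real) \<Rightarrow> nat list \<Rightarrow> real" where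
  "child_sum \<omega> b v = (\<Sum>i<\<omega> v. b (v @ [i]))"

text \<open>If \<open>child_sum \<omega> b v = 0\<close>, the choice of a child is a junk value.\<close>

definition child_law :: "(nat list \<Rightarrow> nat) \<Rightarrow> (nat list \<Rightarrow> real) \<Rightarrow> nat list \<Rightarrow> nat pmf" where
  "child_law \<omega> b v = (if child_sum \<omega> b v = 0 then return_pmf 0
     else embed_pmf (\<lambda>i. if i < \<omega> v then b (v @ [i]) / child_sum \<omega> b v else 0))"

definition vertex_law :: "(nat list \<Rightarrow> nat) \<Rightarrow> (nat list \<Rightarrow> real) \<Rightarrow> nat list \<Rightarrow> (bool \<times> nat) pmf" where
  "vertex_law \<omega> b v = pair_pmf (bernoulli_pmf (b v)) (child_law \<omega> b v)"

definition orient_measure :: "(nat list \<Rightarrow> nat) \<Rightarrow> (nat list \<Rightarrow> real) \<Rightarrow> (nat list \<Rightarrow> bool \<times> nat) measure" where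
  "orient_measure \<omega> b = PiM UNIV (\<lambda>v. measure_pmf (vertex_law \<omega> b v))"

text \<open>The first component of \<open>x v\<close> says whether the path from \<open>v\<close> avoids the parent of \<open>v\<close> when the
  parent does not send its own path through \<open>v\<close>; the second is the child through which the path
  from \<open>v\<close> leaves if it goes down.\<close>

inductive down :: "(nat list \<Rightarrow> bool \<times> nat) \<Rightarrow> nat list \<Rightarrow> bool" for x where
  down_root: "down x []"
| down_flag: "fst (x v) \<Longrightarrow> down x v"
| down_step: "down x v \<Longrightarrow> down x (v @ [snd (x v)])"

definition orient :: "(nat list \<Rightarrow> bool \<times> nat) \<Rightarrow> nat list \<Rightarrow> nat option" where
  "orient x v = (if down x v then Some (snd (x v)) else None)"

lemma down_snoc: "down x (v @ [i]) \<longleftrightarrow> fst (x (v @ [i])) \<or> (down x v \<and> snd (x v) = i)"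
  by (auto intro: down.intros elim: down.cases)

lemma measurable_orient_measure_coord [measurable]:
  "(\<lambda>x. x v) \<in> orient_measure \<omega> b \<rightarrow>\<^sub>M count_space UNIV"
  unfolding orient_measure_def
  by (rule measurable_compose[OF measurable_component_singleton]) auto

lemma measurable_orient_measure_fst_snd [measurable]:
  "Measurable.pred (orient_measure \<omega> b) (\<lambda>x. fst (x v))"
  "(\<lambda>x. snd (x v)) \<in> orient_measure \<omega> b \<rightarrow>\<^sub>M count_space UNIV"
  by (rule measurable_compose[OF measurable_orient_measure_coord], simp)+

lemma space_orient_measure [simp]: "space (orient_measure \<omega> b) = UNIV"
  by (simp add: orient_measure_def space_PiM)

lemma prob_space_orient_measure: "prob_space (orient_measure \<omega> b)"
  unfolding orient_measure_def by (intro prob_space_PiM prob_space_measure_pmf)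

lemma measurable_down [measurable]: "Measurable.pred (orient_measure \<omega> b) (\<lambda>x. down x v)"
proof (induction v rule: rev_induct)
  case Nil
  then show ?case by (simp add: down_root)
next
  case (snoc i v)
  note [measurable] = snoc
  show ?case unfolding down_snoc by measurable
qed

lemma measurable_orient [measurable]: "(\<lambda>x. orient x v) \<in> orient_measure \<omega> b \<rightarrow>\<^sub>M count_space UNIV"
  unfolding orient_def by measurable

lemma AE_orient_measure_coord:
  assumes "\<And>y. y \<in> set_pmf (vertex_law \<omega> b v) \<Longrightarrow> P y"
  shows "AE x in orient_measure \<omega> b. P (x v)"
  unfolding orient_measure_def
  by (rule AE_PiM_component) (auto simp: prob_space_measure_pmf AE_measure_pmf_iff assms)

lemma prob_orient_measure_cylinder:
  assumes "finite J"
  shows "measure (orient_measure \<omega> b) {x. \<forall>v\<in>J. x v \<in> X v}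
    = (\<Prod>v\<in>J. measure_pmf.prob (vertex_law \<omega> b v) (X v))"
proof -
  interpret product_prob_space "\<lambda>v. measure_pmf (vertex_law \<omega> b v)" UNIV
    by unfold_locales
  have "{x. \<forall>v\<in>J. x v \<in> X v} = prod_emb UNIV (\<lambda>v. measure_pmf (vertex_law \<omega> b v)) J (Pi\<^sub>E J X)"
    by (auto simp: prod_emb_def PiE_iff)
  then show ?thesis using measure_PiM_emb[of J X] assms by (simp add: orient_measure_def)
qed

text \<open>This is the condition of \<open>orientations\<close> without extensionality, because
  \<open>orient x\<close> is defined on all words.\<close>

definition oriented :: "(nat list \<Rightarrow> nat) \<Rightarrow> nat list set \<Rightarrow> (nat list \<Rightarrow> nat option) \<Rightarrow> bool" where
  "oriented \<omega> A \<sigma> \<longleftrightarrow> \<sigma> [] \<noteq> None \<and>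
     (\<forall>v\<in>A. \<forall>i. \<sigma> v = Some i \<longrightarrow> i < \<omega> v \<and> (v @ [i] \<in> A \<longrightarrow> \<sigma> (v @ [i]) \<noteq> None))"

lemma orientations_alt: "orientations \<omega> A = {\<sigma> \<in> A \<rightarrow>\<^sub>E UNIV. oriented \<omega> A \<sigma>}"
  by (simp add: orientations_def oriented_def)

text \<open>The parent sends its path through \<open>v\<close>. The root counts as claimed because
  it cannot climb, in agreement with \<open>down_root\<close>.\<close>

definition claimed :: "(nat list \<Rightarrow> nat option) \<Rightarrow> nat list \<Rightarrow> bool" where
  "claimed \<sigma> v \<longleftrightarrow> v = [] \<or> \<sigma> (butlast v) = Some (last v)"

text \<open>A claimed vertex goes down whatever its flag says, an unclaimed one exactly when its
  flag is set. Prescribing \<sigma> thus confines each \<open>x v\<close> to a rectangle, and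
  independence applies.\<close>

definition local_event :: "(nat list \<Rightarrow> nat option) \<Rightarrow> nat list \<Rightarrow> (bool \<times> nat) set" where
  "local_event \<sigma> v = (case \<sigma> v of None \<Rightarrow> {False} \<times> UNIV
     | Some j \<Rightarrow> (if claimed \<sigma> v then UNIV else {True}) \<times> {j})"

lemma claimed_simps [simp]: "claimed \<sigma> []" "claimed \<sigma> (v @ [i]) \<longleftrightarrow> \<sigma> v = Some i"
  by (auto simp: claimed_def)

text \<open>Whether \<open>down x v\<close> holds depends only on the flag at \<open>v\<close> and
  on the value of \<open>orient x\<close> at the parent. Once the parent's value is known, the
  condition at \<open>v\<close> concerns \<open>x v\<close> alone.\<close>

lemma orient_cylinder:
  assumes A: "rooted_subtree \<omega> A" and \<sigma>: "oriented \<omega> A \<sigma>"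
  shows "(\<forall>v\<in>A. orient x v = \<sigma> v) \<longleftrightarrow> (\<forall>v\<in>A. x v \<in> local_event \<sigma> v)"
proof (intro iffI ballI)
  fix v assume *: "\<forall>v\<in>A. orient x v = \<sigma> v" and v: "v \<in> A"
  show "x v \<in> local_event \<sigma> v"
  proof (cases "\<sigma> v")
    case None
    then have "\<not> down x v" using * v by (auto simp: orient_def split: if_splits)
    then have "\<not> fst (x v)" using down_flag by auto
    then show ?thesis using None by (cases "x v") (auto simp: local_event_def)
  next
    case (Some j)
    then have d: "down x v" "snd (x v) = j" using * v by (auto simp: orient_def split: if_splits)
    have "fst (x v)" if n: "\<not> claimed \<sigma> v"
    proof (cases v rule: rev_cases)
      case (snoc u i)
      then have "u \<in> A" using A v by (auto simp: rooted_subtree_def)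
      then have "orient x u \<noteq> Some i" using * n snoc by auto
      then show ?thesis using d(1) snoc by (auto simp: down_snoc orient_def split: if_splits)
    qed (use n in simp)
    then show ?thesis using Some d(2) by (cases "x v") (auto simp: local_event_def)
  qed
next
  fix v assume *: "\<forall>v\<in>A. x v \<in> local_event \<sigma> v" and v: "v \<in> A"
  show "orient x v = \<sigma> v" using v
  proof (induction v rule: rev_induct)
    case Nil
    then obtain j where "\<sigma> [] = Some j" using \<sigma> by (auto simp: oriented_def)
    then show ?case using *[rule_format, OF Nil] by (auto simp: orient_def local_event_def down_root)
  next
    case (snoc i u)
    then have u: "u \<in> A" using A by (auto simp: rooted_subtree_def)
    have IH: "orient x u = \<sigma> u" using snoc.IH u by simp
    have loc: "x (u @ [i]) \<in> local_event \<sigma> (u @ [i])" using * snoc.prems by blast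
    show ?case
    proof (cases "\<sigma> (u @ [i])")
      case None
      then have "\<sigma> u \<noteq> Some i" using \<sigma> u snoc.prems by (auto simp: oriented_def)
      then have "\<not> down x (u @ [i])"
        using loc None IH by (auto simp: down_snoc local_event_def orient_def split: if_splits)
      then show ?thesis using None by (simp add: orient_def)
    next
      case (Some j)
      then have "down x (u @ [i])"
        using loc IH by (auto simp: down_snoc local_event_def orient_def split: if_splits)
      then show ?thesis using Some loc by (auto simp: orient_def local_event_def)
    qed
  qed
qed

section \<open>Explicit probabilities of orientations\<close>

text \<open>A path leaving \<open>A\<close> into the child \<open>v @ [j]\<close> still has to
  escape below that child, which costs the factor \<open>b (v @ [j])\<close>.\<close>

definition exit_factor :: "(nat list \<Rightarrow> real) \<Rightarrow> nat list set \<Rightarrow> (nat list \<Rightarrow> nat option) \<Rightarrow> nat list \<Rightarrow> real" where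
  "exit_factor b A \<sigma> v = (case \<sigma> v of None \<Rightarrow> 1 | Some j \<Rightarrow> if v @ [j] \<in> A then 1 else b (v @ [j]))"

definition weight :: "(nat list \<Rightarrow> real) \<Rightarrow> nat list set \<Rightarrow> (nat list \<Rightarrow> nat option) \<Rightarrow> real" where
  "weight b A \<sigma> = (\<Prod>v\<in>A. 1 - b v) * (\<Prod>v\<in>A. exit_factor b A \<sigma> v)"

text \<open>A vertex of maximal length has no child in \<open>A\<close> and can be removed.\<close>

lemma rooted_subtree_remove_leaf:
  assumes A: "rooted_subtree \<omega> A" and "A \<noteq> {[]}"
  obtains u i where "u @ [i] \<in> A" "u \<in> A" "\<forall>j. u @ [i] @ [j] \<notin> A" "rooted_subtree \<omega> (A - {u @ [i]})"
proof -
  have fin: "finite A" "[] \<in> A" using A by (auto simp: rooted_subtree_def)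
  then have "finite (length ` A)" "length ` A \<noteq> {}" by auto
  then have "Max (length ` A) \<in> length ` A" by (rule Max_in)
  then obtain w where w: "Max (length ` A) = length w" "w \<in> A" by (rule imageE)
  have max: "length v \<le> length w" if "v \<in> A" for v
    unfolding w(1)[symmetric] using that fin by (intro Max_ge) auto
  have "w \<noteq> []"
  proof
    assume "w = []"
    then have "A \<subseteq> {[]}" using max by auto
    then show False using assms(2) fin by auto
  qed
  then obtain u i where ui: "w = u @ [i]" by (cases w rule: rev_cases) auto
  have no: "u @ [i] @ [j] \<notin> A" for j using max[of "u @ [i] @ [j]"] ui by auto
  have "v \<noteq> w" if "v @ [j] \<in> A" for v j using max[OF that] by auto
  then have "rooted_subtree \<omega> (A - {w})"
    using A \<open>w \<noteq> []\<close> unfolding rooted_subtree_def by blast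
  moreover have "u \<in> A" using A w(2) ui unfolding rooted_subtree_def by blast
  ultimately show thesis using that[of u i] no w(2) ui by simp
qed

text \<open>Two instances matter: \<open>escape U \<omega>\<close> on a finite \<open>U\<close>,
  which yields uniform spanning trees, and \<open>escape UNIV \<omega>\<close>, which yields their
  limit.\<close>

context
  fixes \<omega> :: "nat list \<Rightarrow> nat" and b :: "nat list \<Rightarrow> real" and U :: "nat list set"
  assumes b01: "\<And>v. 0 \<le> b v" "\<And>v. b v \<le> 1"
    and b_rec: "\<And>v. v \<in> U \<Longrightarrow> b v = child_sum \<omega> b v / (1 + child_sum \<omega> b v)"
    and b_root: "0 < b []"
    and U_prefix: "\<And>v i. v @ [i] \<in> U \<Longrightarrow> v \<in> U"
begin

lemma child_sum_nonneg: "0 \<le> child_sum \<omega> b v"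
  unfolding child_sum_def by (intro sum_nonneg b01)

lemma pmf_child_law:
  assumes "child_sum \<omega> b v \<noteq> 0"
  shows "pmf (child_law \<omega> b v) i = (if i < \<omega> v then b (v @ [i]) / child_sum \<omega> b v else 0)"
proof -
  have "(\<integral>\<^sup>+i. ennreal (if i < \<omega> v then b (v @ [i]) / child_sum \<omega> b v else 0) \<partial>count_space UNIV)
      = (\<Sum>i<\<omega> v. ennreal (b (v @ [i]) / child_sum \<omega> b v))"
    by (subst nn_integral_count_space'[of "{..<\<omega> v}"]) auto
  also have "\<dots> = ennreal (\<Sum>i<\<omega> v. b (v @ [i]) / child_sum \<omega> b v)"
    using child_sum_nonneg[of v] b01 by (intro sum_ennreal) auto
  also have "(\<Sum>i<\<omega> v. b (v @ [i]) / child_sum \<omega> b v) = 1"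
    using assms by (simp add: child_sum_def flip: sum_divide_distrib)
  finally show ?thesis
    using assms child_sum_nonneg[of v] b01 by (simp add: child_law_def pmf_embed_pmf)
qed

text \<open>With S the child sum, \<open>b v\<close> is S / (1 + S), so both sides are
  \<open>b (v @ [j])\<close> / (1 + S). When S = 0 both vanish, which makes the junk value of
  \<open>child_law\<close> harmless.\<close>

lemma child_law_balance:
  assumes "v \<in> U" "j < \<omega> v"
  shows "b v * pmf (child_law \<omega> b v) j = (1 - b v) * b (v @ [j])"
proof (cases "child_sum \<omega> b v = 0")
  case True
  then have "b (v @ [j]) = 0"
    using assms(2) b01 unfolding child_sum_def by (subst (asm) sum_nonneg_eq_0_iff) auto
  then show ?thesis using True b_rec[OF assms(1)] by simp
next
  case False
  have pos: "1 + child_sum \<omega> b v \<noteq> 0" using child_sum_nonneg[of v] by simp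
  have "1 - b v = 1 / (1 + child_sum \<omega> b v)" using b_rec[OF assms(1)] pos by (simp add: field_simps)
  then show ?thesis
    using False pos b_rec[OF assms(1)] assms(2) by (simp add: pmf_child_law)
qed

lemma prob_local_event:
  "measure_pmf.prob (vertex_law \<omega> b v) (local_event \<sigma> v) = (case \<sigma> v of None \<Rightarrow> 1 - b v
     | Some j \<Rightarrow> (if claimed \<sigma> v then 1 else b v) * pmf (child_law \<omega> b v) j)"
proof -
  have prod: "measure_pmf.prob (vertex_law \<omega> b v) (X \<times> Y)
      = measure_pmf.prob (bernoulli_pmf (b v)) X * measure_pmf.prob (child_law \<omega> b v) Y" for X Y
    unfolding vertex_law_def by (intro measure_pmf_prob_product) auto
  show ?thesis
  proof (cases "\<sigma> v")
    case None
    then show ?thesis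
      using prod[of "{False}" UNIV] b01 by (simp add: local_event_def measure_pmf_single)
  next
    case (Some j)
    then show ?thesis
      using prod[of UNIV "{j}"] prod[of "{True}" "{j}"] b01
      by (simp add: local_event_def measure_pmf_single)
  qed
qed

text \<open>A deepest vertex w is removed. If it points up, it contributes \<open>1 - b w\<close>.
  If it points down unclaimed, \<open>child_law_balance\<close> turns its probability into
  \<open>1 - b w\<close> times its exit factor. If it is claimed, the missing \<open>b w\<close> is
  the exit factor of its parent in the smaller set. The leading \<open>b []\<close> supplies this
  missing factor for the root.\<close>

lemma prod_local_events:
  assumes "rooted_subtree \<omega> A" "A \<subseteq> U" "oriented \<omega> A \<sigma>"
  shows "b [] * (\<Prod>v\<in>A. measure_pmf.prob (vertex_law \<omega> b v) (local_event \<sigma> v)) = weight b A \<sigma>"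
  using assms
proof (induction "card A" arbitrary: A rule: less_induct)
  case less
  have fin: "finite A" using less.prems by (auto simp: rooted_subtree_def)
  let ?\<phi> = "\<lambda>v. measure_pmf.prob (vertex_law \<omega> b v) (local_event \<sigma> v)"
  show ?case
  proof (cases "A = {[]}")
    case True
    obtain j where j: "\<sigma> [] = Some j" "j < \<omega> []" using less.prems True by (auto simp: oriented_def)
    then have "?\<phi> [] = pmf (child_law \<omega> b []) j" by (simp add: prob_local_event)
    then show ?thesis
      using child_law_balance[of "[]" j] j less.prems True by (simp add: weight_def exit_factor_def)
  next
    case False
    obtain u i where ui: "u @ [i] \<in> A" "u \<in> A" "\<forall>j. u @ [i] @ [j] \<notin> A" "rooted_subtree \<omega> (A - {u @ [i]})"
      using rooted_subtree_remove_leaf[OF less.prems(1) False] .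
    define w where "w = u @ [i]"
    define B where "B = A - {w}"
    have B: "A = insert w B" "w \<notin> B" "finite B" "u \<in> B" using ui fin by (auto simp: w_def B_def)
    have card: "card B < card A" using B by simp
    have IH: "b [] * (\<Prod>v\<in>B. ?\<phi> v) = weight b B \<sigma>"
      using less.prems ui card by (intro less.hyps) (auto simp: B_def w_def oriented_def)
    have wU: "w \<in> U" using less.prems ui by (auto simp: w_def)
    have ex: "exit_factor b A \<sigma> v = exit_factor b B \<sigma> v" if "v \<in> B" "v \<noteq> u" for v
      using that B(1) by (auto simp: exit_factor_def w_def split: option.splits)
    define R where "R = (\<Prod>v\<in>B. 1 - b v) * (\<Prod>v\<in>B - {u}. exit_factor b B \<sigma> v)"
    have MB: "weight b B \<sigma> = R * exit_factor b B \<sigma> u"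
      using B by (simp add: weight_def R_def prod.remove[of B u])
    have "(\<Prod>v\<in>B. exit_factor b A \<sigma> v) = exit_factor b A \<sigma> u * (\<Prod>v\<in>B - {u}. exit_factor b A \<sigma> v)"
      using B by (simp add: prod.remove)
    also have "(\<Prod>v\<in>B - {u}. exit_factor b A \<sigma> v) = (\<Prod>v\<in>B - {u}. exit_factor b B \<sigma> v)"
      using ex by (intro prod.cong) auto
    finally have MA: "weight b A \<sigma> = R * exit_factor b A \<sigma> u * ((1 - b w) * exit_factor b A \<sigma> w)"
      using B by (simp add: weight_def R_def)
    have "b [] * (\<Prod>v\<in>A. ?\<phi> v) = weight b B \<sigma> * ?\<phi> w"
      using B IH by (simp add: ac_simps)
    also have "\<dots> = weight b A \<sigma>"
    proof (cases "\<sigma> w")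
      case None
      then have "\<sigma> u \<noteq> Some i" using less.prems ui by (auto simp: oriented_def w_def)
      then have "exit_factor b A \<sigma> u = exit_factor b B \<sigma> u"
        using B(1) by (auto simp: exit_factor_def w_def split: option.splits)
      then show ?thesis using MA MB None by (simp add: prob_local_event exit_factor_def[of b A \<sigma> w])
    next
      case (Some j)
      then have j: "j < \<omega> w" using less.prems(3) ui(1) unfolding oriented_def w_def by blast
      have ew: "exit_factor b A \<sigma> w = b (w @ [j])" using Some ui by (simp add: exit_factor_def w_def)
      show ?thesis
      proof (cases "\<sigma> u = Some i")
        case True
        then have "exit_factor b A \<sigma> u = 1" "exit_factor b B \<sigma> u = b w"
          using B ui by (auto simp: exit_factor_def w_def)
        then show ?thesis
          using MA MB ew Some True child_law_balance[OF wU j] by (simp add: prob_local_event w_def)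
      next
        case False
        then have "exit_factor b A \<sigma> u = exit_factor b B \<sigma> u"
          using B(1) by (auto simp: exit_factor_def w_def split: option.splits)
        then show ?thesis
          using MA MB ew Some False child_law_balance[OF wU j] by (simp add: prob_local_event w_def)
      qed
    qed
    finally show ?thesis .
  qed
qed

lemma prob_orient_cylinder:
  assumes "rooted_subtree \<omega> A" "A \<subseteq> U" "oriented \<omega> A \<sigma>"
  shows "b [] * measure (orient_measure \<omega> b) {x. \<forall>v\<in>A. orient x v = \<sigma> v} = weight b A \<sigma>"
proof -
  have "finite A" using assms by (auto simp: rooted_subtree_def)
  then show ?thesis
    using prod_local_events[OF assms] by (simp add: orient_cylinder[OF assms(1,3)] prob_orient_measure_cylinder)
qed

text \<open>Almost surely, a vertex that goes down has positive \<open>b\<close>: the root by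
  assumption, a flagged vertex because its flag has probability \<open>b v\<close>, and a claimed
  one because it was chosen proportionally to \<open>b\<close>. Then the child sum is positive too,
  and the chosen child is not the junk value.\<close>

lemma AE_down:
  "AE x in orient_measure \<omega> b. \<forall>v\<in>U. down x v \<longrightarrow> snd (x v) < \<omega> v"
proof -
  have coord: "AE x in orient_measure \<omega> b. (fst (x v) \<longrightarrow> 0 < b v) \<and>
      (0 < child_sum \<omega> b v \<longrightarrow> snd (x v) < \<omega> v \<and> 0 < b (v @ [snd (x v)]))" for v
  proof (rule AE_orient_measure_coord)
    fix y assume y: "y \<in> set_pmf (vertex_law \<omega> b v)"
    then have f: "fst y \<in> set_pmf (bernoulli_pmf (b v))" and s: "snd y \<in> set_pmf (child_law \<omega> b v)"
      by (auto simp: vertex_law_def)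
    have "0 < b v" if "fst y"
      using f that b01[of v] by (auto simp: set_pmf_iff less_le)
    moreover have "snd y < \<omega> v \<and> 0 < b (v @ [snd y])" if "0 < child_sum \<omega> b v"
      using s that b01[of "v @ [snd y]"] by (auto simp: set_pmf_iff pmf_child_law less_le split: if_splits)
    ultimately show "(fst y \<longrightarrow> 0 < b v) \<and>
      (0 < child_sum \<omega> b v \<longrightarrow> snd y < \<omega> v \<and> 0 < b (v @ [snd y]))" by blast
  qed
  have "AE x in orient_measure \<omega> b. \<forall>v. (fst (x v) \<longrightarrow> 0 < b v) \<and>
      (0 < child_sum \<omega> b v \<longrightarrow> snd (x v) < \<omega> v \<and> 0 < b (v @ [snd (x v)]))"
    by (intro AE_all_countable[THEN iffD2] allI coord)
  then show ?thesis
  proof eventually_elim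
    case (elim x)
    have cs: "0 < child_sum \<omega> b v" if "v \<in> U" "0 < b v" for v
      using b_rec[OF that(1)] that(2) child_sum_nonneg[of v] by (cases "child_sum \<omega> b v = 0") auto
    have "0 < b v" if "down x v" "v \<in> U" for v
      using that
    proof (induction rule: down.induct)
      case (down_step v)
      then have "v \<in> U" using U_prefix by blast
      then show ?case using down_step elim cs by blast
    qed (use elim b_root in auto)
    then show ?case using cs elim by blast
  qed
qed

lemma AE_oriented:
  assumes "A \<subseteq> U"
  shows "AE x in orient_measure \<omega> b. oriented \<omega> A (orient x)"
  using AE_down
proof eventually_elim
  case (elim x)
  then show ?case using assms
    by (auto simp: oriented_def orient_def down_root intro: down_step split: if_splits)
qed

text \<open>Since \<open>orient x\<close> is almost surely admissible on \<open>A\<close>, the event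
  is up to a null set a finite disjoint union of cylinders.\<close>

lemma prob_used_edges:
  assumes A: "rooted_subtree \<omega> A" "A \<subseteq> U"
  shows "b [] * measure (orient_measure \<omega> b) {x. S \<subseteq> used_edges (orient x) A}
    = (\<Sum>\<sigma>\<in>{\<sigma>\<in>orientations \<omega> A. S \<subseteq> used_edges \<sigma> A}. weight b A \<sigma>)"
proof -
  interpret P: prob_space "orient_measure \<omega> b" by (rule prob_space_orient_measure)
  have finA: "finite A" using A by (auto simp: rooted_subtree_def)
  let ?\<Omega> = "{\<sigma>\<in>orientations \<omega> A. S \<subseteq> used_edges \<sigma> A}"
  let ?C = "\<lambda>\<sigma>. {x. \<forall>v\<in>A. orient x v = \<sigma> v}"
  have fin: "finite ?\<Omega>" using finite_orientations[OF finA] by simp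
  have C: "?C \<sigma> \<in> P.events" for \<sigma>
  proof -
    have "{x\<in>space (orient_measure \<omega> b). \<forall>v\<in>A. orient x v = \<sigma> v} \<in> P.events"
      using finA by measurable
    then show ?thesis by simp
  qed
  have ue: "used_edges (restrict \<sigma> A) A = used_edges \<sigma> A" for \<sigma>
    by (auto simp: used_edges_def next_vertex_def)
  have ue': "used_edges \<sigma> A = used_edges \<tau> A" if "\<forall>v\<in>A. \<sigma> v = \<tau> v" for \<sigma> \<tau>
    using that by (auto simp: used_edges_def next_vertex_def)
  have disj: "disjoint_family_on ?C ?\<Omega>"
    unfolding disjoint_family_on_def
  proof (intro ballI impI)
    fix \<sigma> \<tau> assume st: "\<sigma> \<in> ?\<Omega>" "\<tau> \<in> ?\<Omega>" "\<sigma> \<noteq> \<tau>"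
    then obtain v where "v \<in> A" "\<sigma> v \<noteq> \<tau> v"
      using PiE_ext[of \<sigma> A "\<lambda>_. UNIV" \<tau>] by (auto simp: orientations_alt)
    then show "?C \<sigma> \<inter> ?C \<tau> = {}" by auto
  qed
  have un: "(\<Union>\<sigma>\<in>?\<Omega>. ?C \<sigma>) \<in> P.events" using C fin by auto
  have root: "[] \<in> A" using A by (auto simp: rooted_subtree_def)
  have ev: "{x. S \<subseteq> used_edges (orient x) A} \<in> P.events"
  proof -
    have "{x. S \<subseteq> used_edges (orient x) A}
        = (\<Union>\<sigma>\<in>{\<sigma>\<in>A \<rightarrow>\<^sub>E UNIV. S \<subseteq> used_edges \<sigma> A}. ?C \<sigma>)"
    proof (intro set_eqI iffI)
      fix x assume "x \<in> {x. S \<subseteq> used_edges (orient x) A}"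
      then show "x \<in> (\<Union>\<sigma>\<in>{\<sigma>\<in>A \<rightarrow>\<^sub>E UNIV. S \<subseteq> used_edges \<sigma> A}. ?C \<sigma>)"
        using ue by (intro UN_I[of "restrict (orient x) A"]) auto
    qed (use ue' in fastforce)
    also have "\<dots> \<in> P.events"
    proof (rule sets.countable_UN')
      have "countable (A \<rightarrow>\<^sub>E (UNIV :: nat option set))" using finA by (intro countable_PiE) auto
      then show "countable {\<sigma>\<in>A \<rightarrow>\<^sub>E UNIV. S \<subseteq> used_edges \<sigma> A}" by (rule countable_subset[rotated]) auto
    qed (use C in auto)
    finally show ?thesis .
  qed
  have "measure (orient_measure \<omega> b) {x. S \<subseteq> used_edges (orient x) A}
      = measure (orient_measure \<omega> b) (\<Union>\<sigma>\<in>?\<Omega>. ?C \<sigma>)"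
  proof (rule P.finite_measure_eq_AE[OF _ ev un])
    show "AE x in orient_measure \<omega> b. x \<in> {x. S \<subseteq> used_edges (orient x) A} \<longleftrightarrow> x \<in> (\<Union>\<sigma>\<in>?\<Omega>. ?C \<sigma>)"
      using AE_oriented[OF A(2)]
    proof eventually_elim
      case (elim x)
      have "restrict (orient x) A \<in> orientations \<omega> A"
        using elim root by (auto simp: orientations_alt oriented_def)
      then show ?case
        using ue[of "orient x"] ue'[of "orient x"] by (auto intro!: exI[of _ "restrict (orient x) A"])
    qed
  qed
  also have "\<dots> = (\<Sum>\<sigma>\<in>?\<Omega>. measure (orient_measure \<omega> b) (?C \<sigma>))"
    using C by (intro P.finite_measure_finite_Union fin disj) auto
  finally show ?thesis
    using A by (simp add: sum_distrib_left prob_orient_cylinder orientations_alt)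
qed

end

section \<open>The wired uniform spanning forest of a tree\<close>

lemma escape_child_sum:
  "v \<in> U \<Longrightarrow> escape U \<omega> v = child_sum \<omega> (escape U \<omega>) v / (1 + child_sum \<omega> (escape U \<omega>) v)"
  unfolding child_sum_def by (rule escape_rec)

text \<open>On \<open>U\<close> itself all exit factors are 1, because escape probabilities outside
  \<open>U\<close> are 1; so every orientation of \<open>U\<close> has the same weight \<kappa>, and
  the empty \<open>S\<close> identifies the normalisation. Computing the same probability on the
  smaller set \<open>A\<close> gives an expression over a finite set that need not grow with
  \<open>U\<close>.\<close>

lemma UST_wired_prob_weights:
  assumes U: "rooted_subtree \<omega> U" and A: "rooted_subtree \<omega> A" "A \<subseteq> U"
    and S: "\<Union>S \<subseteq> A" and pos: "0 < escape U \<omega> []"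
  shows "measure_pmf.prob (UST (wired (gw_tree \<omega>) U)) {T. S \<subseteq> T}
    = (\<Sum>\<sigma>\<in>{\<sigma>\<in>orientations \<omega> A. S \<subseteq> used_edges \<sigma> A}. weight (escape U \<omega>) A \<sigma>) / escape U \<omega> []"
proof -
  interpret P: prob_space "orient_measure \<omega> (escape U \<omega>)" by (rule prob_space_orient_measure)
  have finU: "finite (orientations \<omega> U)"
    using U by (intro finite_orientations) (simp add: rooted_subtree_def)
  have prefix: "v \<in> U" if "v @ [i] \<in> U" for v i using U that unfolding rooted_subtree_def by blast
  have pue: "escape U \<omega> [] * P.prob {x. R \<subseteq> used_edges (orient x) B}
      = (\<Sum>\<sigma>\<in>{\<sigma>\<in>orientations \<omega> B. R \<subseteq> used_edges \<sigma> B}. weight (escape U \<omega>) B \<sigma>)"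
    if "rooted_subtree \<omega> B" "B \<subseteq> U" for B R
    using escape_child_sum pos prefix that by (intro prob_used_edges) auto
  define \<kappa> where "\<kappa> = (\<Prod>v\<in>U. 1 - escape U \<omega> v)"
  have w: "weight (escape U \<omega>) U \<sigma> = \<kappa>" for \<sigma>
  proof -
    have "exit_factor (escape U \<omega>) U \<sigma> v = 1" for v
      by (simp add: exit_factor_def escape_outside split: option.split)
    then show ?thesis by (simp add: weight_def \<kappa>_def)
  qed
  have eq: "escape U \<omega> [] * P.prob {x. R \<subseteq> used_edges (orient x) U}
      = \<kappa> * real (card {\<sigma>\<in>orientations \<omega> U. R \<subseteq> used_edges \<sigma> U})" for R
    using pue[OF U order_refl, of R] by (simp add: w)
  have "P.prob {x. {} \<subseteq> used_edges (orient x) U} = 1" using P.prob_space by simp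
  then have one: "escape U \<omega> [] = \<kappa> * real (card (orientations \<omega> U))"
    using eq[of "{}"] by simp
  then have ne: "orientations \<omega> U \<noteq> {}" "\<kappa> \<noteq> 0" using pos by auto
  have "used_edges \<sigma> A \<subseteq> used_edges \<sigma> U" for \<sigma> using A by (auto simp: used_edges_def)
  \<comment> \<open>Both ends of an edge of \<open>S\<close> lie in \<open>A\<close>, so the vertex
    that uses it does too.\<close>
  moreover have "S \<subseteq> used_edges \<sigma> A" if sub: "S \<subseteq> used_edges \<sigma> U" for \<sigma>
  proof
    fix e assume e: "e \<in> S"
    then obtain v where "e = {v, next_vertex \<sigma> v}" using sub by (auto simp: used_edges_def)
    then show "e \<in> used_edges \<sigma> A" using e S by (auto simp: used_edges_def)
  qed
  ultimately have "S \<subseteq> used_edges \<sigma> U \<longleftrightarrow> S \<subseteq> used_edges \<sigma> A" for \<sigma> by blast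
  then have "(\<Sum>\<sigma>\<in>{\<sigma>\<in>orientations \<omega> A. S \<subseteq> used_edges \<sigma> A}. weight (escape U \<omega>) A \<sigma>)
      = \<kappa> * real (card {\<sigma>\<in>orientations \<omega> U. S \<subseteq> used_edges \<sigma> U})"
    using pue[OF A, of S] eq[of S] by simp
  then show ?thesis
    using ne by (simp add: UST_wired_prob[OF U] one)
qed

lemma exhaustion_eventually_mem:
  assumes "exhaustion G Gs" "v \<in> verts G"
  shows "eventually (\<lambda>n. v \<in> verts (Gs n)) sequentially"
proof -
  have "verts (Gs n) \<subseteq> verts (Gs (Suc n))" for n using assms by (auto simp: exhaustion_def subgraph_def)
  then have inc: "verts (Gs m) \<subseteq> verts (Gs n)" if "m \<le> n" for m n
    using that by (rule lift_Suc_mono_le)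
  obtain m where "v \<in> verts (Gs m)" using assms by (force simp: exhaustion_def)
  then show ?thesis using inc by (auto simp: eventually_sequentially)
qed

text \<open>A path in the connected subgraph from \<open>v @ [i]\<close> to the root must leave the
  set of words extending \<open>v @ [i]\<close>, and in a tree the only exit is to
  \<open>v\<close>.\<close>

lemma exhaustion_rooted_subtree:
  assumes ex: "exhaustion (gw_tree \<omega>) Gs" and root: "[] \<in> verts (Gs n)"
  shows "rooted_subtree \<omega> (verts (Gs n))"
proof -
  let ?K = "Gs n"
  have K: "finite (verts ?K)" "connected_graph ?K" "subgraph ?K (gw_tree \<omega>)"
    using ex by (auto simp: exhaustion_def)
  have "v \<in> verts ?K" if v: "v @ [i] \<in> verts ?K" for v i
  proof -
    have "(adj ?K)\<^sup>*\<^sup>* (v @ [i]) []"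
      using K(2) v root by (auto simp: connected_graph_def reachable_iff)
    moreover have "v \<in> verts ?K" if "(adj ?K)\<^sup>*\<^sup>* x []" "x = v @ i # w" for x w
      using that
    proof (induction arbitrary: w rule: converse_rtranclp_induct)
      case (step x y)
      then obtain e where e: "e \<in> edges ?K" "ends ?K e = {x, y}" and y: "y \<in> verts ?K"
        by (auto simp: adj_def)
      then have "e \<in> edges (gw_tree \<omega>)" "ends ?K e = e"
        using K(3) by (auto simp: subgraph_def gw_tree_def)
      then have "{x, y} \<in> edges (gw_tree \<omega>)" using e by simp
      then show ?case
      proof (cases rule: edges_gw_tree_cases)
        case (1 j)
        then show ?thesis using step.IH[of "w @ [j]"] step.prems by simp
      next
        case (2 j)
        then show ?thesis
          using step.IH step.prems y by (cases w rule: rev_cases) auto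
      qed
    qed simp
    ultimately show ?thesis by auto
  qed
  then show ?thesis
    using K root unfolding rooted_subtree_def by (auto simp: subgraph_def gw_tree_def)
qed

lemma finite_edges_rooted_subtree:
  assumes "finite S" "S \<subseteq> edges (gw_tree \<omega>)"
  obtains A where "rooted_subtree \<omega> A" "\<Union>S \<subseteq> A"
proof -
  define A where "A = insert [] (\<Union>v\<in>\<Union>S. (\<lambda>k. take k v) ` {..length v})"
  have "finite e" "e \<subseteq> gw_verts \<omega>" if "e \<in> S" for e
  proof -
    have "e \<in> edges (gw_tree \<omega>)" using that assms(2) by auto
    then show "finite e" "e \<subseteq> gw_verts \<omega>" by (auto simp: edges_gw_tree gw_verts_snoc)
  qed
  then have fin: "finite (\<Union>S)" "\<Union>S \<subseteq> gw_verts \<omega>" using assms(1) by auto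
  have "take k v \<in> gw_verts \<omega>" if "v \<in> gw_verts \<omega>" for k v
    using that gw_verts_append[of "take k v" "drop k v" \<omega>] by simp
  then have "A \<subseteq> gw_verts \<omega>" using fin(2) by (auto simp: A_def)
  moreover have "u \<in> A" if "u @ [i] \<in> A" for u i
  proof -
    obtain v k where v: "v \<in> \<Union>S" "k \<le> length v" "u @ [i] = take k v"
      using \<open>u @ [i] \<in> A\<close> by (auto simp: A_def)
    have "butlast (u @ [i]) = butlast (take k v)" using v(3) by (rule arg_cong)
    then have "u = take (k - 1) v" using v(2) by (simp add: butlast_take)
    then show ?thesis using v unfolding A_def by (intro insertI2 UN_I[OF v(1)] image_eqI[of _ _ "k - 1"]) auto
  qed
  moreover have "finite A" unfolding A_def using fin(1) by (intro finite.insertI finite_UN_I) auto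
  moreover have "[] \<in> A" by (simp add: A_def)
  ultimately have "rooted_subtree \<omega> A" unfolding rooted_subtree_def by blast
  moreover have "\<Union>S \<subseteq> A"
  proof
    fix v assume "v \<in> \<Union>S"
    then show "v \<in> A" unfolding A_def by (intro insertI2 UN_I[of v] image_eqI[of _ _ "length v"]) auto
  qed
  ultimately show thesis by (rule that)
qed

lemma weight_tendsto:
  assumes A: "rooted_subtree \<omega> A" and \<sigma>: "\<sigma> \<in> orientations \<omega> A"
    and U: "\<And>v. v \<in> gw_verts \<omega> \<Longrightarrow> eventually (\<lambda>n. v \<in> U n) sequentially"
  shows "(\<lambda>n. weight (escape (U n) \<omega>) A \<sigma>) \<longlonglongrightarrow> weight (escape UNIV \<omega>) A \<sigma>"
  unfolding weight_def
proof (intro tendsto_mult tendsto_prod tendsto_diff tendsto_const)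
  fix v assume v: "v \<in> A"
  then have vT: "v \<in> gw_verts \<omega>" using A by (auto simp: rooted_subtree_def)
  then show "(\<lambda>n. escape (U n) \<omega> v) \<longlonglongrightarrow> escape UNIV \<omega> v" by (intro escape_exhaustion U)
  show "(\<lambda>n. exit_factor (escape (U n) \<omega>) A \<sigma> v) \<longlonglongrightarrow> exit_factor (escape UNIV \<omega>) A \<sigma> v"
  proof (cases "\<sigma> v")
    case (Some j)
    then have "v @ [j] \<in> gw_verts \<omega>" using \<sigma> v vT by (auto simp: orientations_def gw_verts_snoc)
    then show ?thesis using Some by (auto simp: exit_factor_def intro: escape_exhaustion U)
  qed (simp add: exit_factor_def)
qed

text \<open>On a null set of \<open>x\<close> a junk choice may produce a pair that is not an edge.
  The intersection makes the value an edge configuration for every \<open>x\<close>.\<close>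

definition forest_of :: "(nat list \<Rightarrow> nat) \<Rightarrow> (nat list \<Rightarrow> bool \<times> nat) \<Rightarrow> nat list set set" where
  "forest_of \<omega> x = used_edges (orient x) (gw_verts \<omega>) \<inter> edges (gw_tree \<omega>)"

lemma space_edge_config_algebra: "space (edge_config_algebra G) = Pow (edges G)"
  and sets_edge_config_algebra: "sets (edge_config_algebra G)
    = sigma_sets (Pow (edges G)) ((\<lambda>e. {F \<in> Pow (edges G). e \<in> F}) ` edges G)"
  unfolding edge_config_algebra_def by (auto intro!: space_measure_of sets_measure_of)

lemma measurable_forest_of [measurable]:
  "forest_of \<omega> \<in> orient_measure \<omega> b \<rightarrow>\<^sub>M edge_config_algebra (gw_tree \<omega>)"
  unfolding edge_config_algebra_def
proof (rule measurable_measure_of)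
  show "forest_of \<omega> \<in> space (orient_measure \<omega> b) \<rightarrow> Pow (edges (gw_tree \<omega>))"
    by (auto simp: forest_of_def)
  fix Y assume "Y \<in> (\<lambda>e. {F \<in> Pow (edges (gw_tree \<omega>)). e \<in> F}) ` edges (gw_tree \<omega>)"
  then obtain e where e: "e \<in> edges (gw_tree \<omega>)" "Y = {F \<in> Pow (edges (gw_tree \<omega>)). e \<in> F}" by auto
  have "forest_of \<omega> -` Y \<inter> space (orient_measure \<omega> b)
      = {x\<in>space (orient_measure \<omega> b). \<exists>v\<in>gw_verts \<omega>. e = {v, next_vertex (orient x) v}}"
    using e by (auto simp: forest_of_def used_edges_def)
  also have "\<dots> \<in> sets (orient_measure \<omega> b)"
  proof -
    have [measurable]: "(\<lambda>x. next_vertex (orient x) v) \<in> orient_measure \<omega> b \<rightarrow>\<^sub>M count_space UNIV" for v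
      unfolding next_vertex_def by measurable
    show ?thesis by measurable
  qed
  finally show "forest_of \<omega> -` Y \<inter> space (orient_measure \<omega> b) \<in> sets (orient_measure \<omega> b)" .
qed auto

lemma contains_sets_edge_config_algebra:
  assumes "finite S" "S \<subseteq> edges G"
  shows "{F \<in> Pow (edges G). S \<subseteq> F} \<in> sets (edge_config_algebra G)"
  using assms
proof (induction S)
  case empty
  show ?case using sets.top[of "edge_config_algebra G"] by (simp add: space_edge_config_algebra Pow_def)
next
  case (insert e S)
  have "{F \<in> Pow (edges G). e \<in> F} \<in> sets (edge_config_algebra G)"
    unfolding sets_edge_config_algebra using insert by (intro sigma_sets.Basic) auto
  then have "{F \<in> Pow (edges G). e \<in> F} \<inter> {F \<in> Pow (edges G). S \<subseteq> F} \<in> sets (edge_config_algebra G)"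
    using insert by auto
  also have "{F \<in> Pow (edges G). e \<in> F} \<inter> {F \<in> Pow (edges G). S \<subseteq> F} = {F \<in> Pow (edges G). insert e S \<subseteq> F}"
    by auto
  finally show ?case .
qed

text \<open>Once the exhaustion contains a finite rooted subtree \<open>A\<close> around
  \<open>S\<close>, the spanning tree probability and the probability under the forest are the same
  continuous expression in escape probabilities on finitely many vertices, and
  \<open>escape_exhaustion\<close> gives convergence.\<close>

lemma is_WUSF_forest_of:
  assumes pos: "0 < escape UNIV \<omega> []"
  shows "is_WUSF (gw_tree \<omega>)
    (distr (orient_measure \<omega> (escape UNIV \<omega>)) (edge_config_algebra (gw_tree \<omega>)) (forest_of \<omega>))"
    (is "is_WUSF _ ?\<mu>")
proof -
  interpret P: prob_space "orient_measure \<omega> (escape UNIV \<omega>)" by (rule prob_space_orient_measure)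
  have "(\<lambda>n. measure_pmf.prob (UST (wired (gw_tree \<omega>) (verts (Gs n)))) {T. S \<subseteq> T})
      \<longlonglongrightarrow> measure ?\<mu> {F \<in> space ?\<mu>. S \<subseteq> F}"
    if ex: "exhaustion (gw_tree \<omega>) Gs" and S: "finite S" "S \<subseteq> edges (gw_tree \<omega>)" for Gs S
  proof -
    obtain A where A: "rooted_subtree \<omega> A" "\<Union>S \<subseteq> A" using finite_edges_rooted_subtree[OF S] .
    have AT: "finite A" "A \<subseteq> gw_verts \<omega>" "[] \<in> A" using A by (auto simp: rooted_subtree_def)
    let ?\<Omega> = "{\<sigma>\<in>orientations \<omega> A. S \<subseteq> used_edges \<sigma> A}"
    let ?U = "\<lambda>n. verts (Gs n)"
    have U: "eventually (\<lambda>n. v \<in> ?U n) sequentially" if "v \<in> gw_verts \<omega>" for v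
      using exhaustion_eventually_mem[OF ex] that by (simp add: gw_tree_def)
    have "eventually (\<lambda>n. \<forall>v\<in>A. v \<in> ?U n) sequentially"
      using AT U by (intro eventually_ball_finite) auto
    then have ev: "eventually (\<lambda>n. (\<Sum>\<sigma>\<in>?\<Omega>. weight (escape (?U n) \<omega>) A \<sigma>) / escape (?U n) \<omega> []
        = measure_pmf.prob (UST (wired (gw_tree \<omega>) (?U n))) {T. S \<subseteq> T}) sequentially"
    proof eventually_elim
      case (elim n)
      then have "rooted_subtree \<omega> (?U n)" using AT by (intro exhaustion_rooted_subtree[OF ex]) auto
      moreover have "0 < escape (?U n) \<omega> []"
        using pos escape_antimono[of "?U n" UNIV \<omega> "[]"] by simp
      ultimately show ?case using elim A by (intro UST_wired_prob_weights[symmetric]) auto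
    qed
    have lim: "(\<lambda>n. (\<Sum>\<sigma>\<in>?\<Omega>. weight (escape (?U n) \<omega>) A \<sigma>) / escape (?U n) \<omega> [])
        \<longlonglongrightarrow> (\<Sum>\<sigma>\<in>?\<Omega>. weight (escape UNIV \<omega>) A \<sigma>) / escape UNIV \<omega> []"
      using pos A by (intro tendsto_divide tendsto_sum escape_exhaustion weight_tendsto U) auto
    have "(\<Sum>\<sigma>\<in>?\<Omega>. weight (escape UNIV \<omega>) A \<sigma>) / escape UNIV \<omega> []
        = P.prob {x. S \<subseteq> used_edges (orient x) A}"
      using prob_used_edges[where b = "escape UNIV \<omega>" and U = UNIV and \<omega> = \<omega>,
          OF escape_nonneg escape_le_1 escape_child_sum pos UNIV_I A(1), of S] pos
      by (simp add: divide_eq_eq ac_simps)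
    also have "{x. S \<subseteq> used_edges (orient x) A} = forest_of \<omega> -` {F \<in> space ?\<mu>. S \<subseteq> F}"
    proof -
      have "S \<subseteq> used_edges \<sigma> A \<longleftrightarrow> S \<subseteq> used_edges \<sigma> (gw_verts \<omega>)" for \<sigma>
      proof
        assume *: "S \<subseteq> used_edges \<sigma> (gw_verts \<omega>)"
        show "S \<subseteq> used_edges \<sigma> A"
        proof
          fix e assume e: "e \<in> S"
          then obtain v where "e = {v, next_vertex \<sigma> v}" using * by (auto simp: used_edges_def)
          then show "e \<in> used_edges \<sigma> A" using e A by (auto simp: used_edges_def)
        qed
      qed (use AT in \<open>auto simp: used_edges_def\<close>)
      then show ?thesis using S(2) by (auto simp: forest_of_def space_edge_config_algebra)
    qed
    also have "P.prob (forest_of \<omega> -` {F \<in> space ?\<mu>. S \<subseteq> F}) = measure ?\<mu> {F \<in> space ?\<mu>. S \<subseteq> F}"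
      using contains_sets_edge_config_algebra[OF S]
      by (subst measure_distr) (auto simp: space_edge_config_algebra)
    finally show ?thesis
      using Lim_transform_eventually[OF lim ev] by simp
  qed
  moreover have "prob_space ?\<mu>" by (rule P.prob_space_distr) measurable
  ultimately show ?thesis by (simp add: is_WUSF_def)
qed

text \<open>The events that \<open>F\<close> contains a given finite set are stable under
  intersection and generate the algebra. A single exhaustion fixes their probabilities; without any,
  the limit condition would be vacuous.\<close>

lemma is_WUSF_unique:
  assumes ex: "exhaustion G Gs" and \<mu>: "is_WUSF G \<mu>" and \<nu>: "is_WUSF G \<nu>"
  shows "\<mu> = \<nu>"
proof -
  define gen where "gen S = {F \<in> Pow (edges G). S \<subseteq> F}" for S
  define E where "E = gen ` {S. finite S \<and> S \<subseteq> edges G}"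
  have s: "sets \<mu> = sets (edge_config_algebra G)" "sets \<nu> = sets (edge_config_algebra G)"
    using \<mu> \<nu> by (auto simp: is_WUSF_def)
  have sp: "space \<mu> = Pow (edges G)" "space \<nu> = Pow (edges G)"
    using s[THEN sets_eq_imp_space_eq] by (simp_all add: space_edge_config_algebra)
  have sub: "E \<subseteq> sets (edge_config_algebra G)"
    unfolding E_def gen_def using contains_sets_edge_config_algebra by blast
  have sigma: "sets (edge_config_algebra G) = sigma_sets (Pow (edges G)) E"
  proof
    show "sigma_sets (Pow (edges G)) E \<subseteq> sets (edge_config_algebra G)"
      using sets.sigma_sets_subset[OF sub] by (simp add: space_edge_config_algebra)
    have "(\<lambda>e. {F \<in> Pow (edges G). e \<in> F}) ` edges G \<subseteq> E"
    proof (rule image_subsetI)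
      fix e assume "e \<in> edges G"
      then show "{F \<in> Pow (edges G). e \<in> F} \<in> E"
        unfolding E_def by (intro image_eqI[of _ _ "{e}"]) (simp_all add: gen_def)
    qed
    then show "sets (edge_config_algebra G) \<subseteq> sigma_sets (Pow (edges G)) E"
      unfolding sets_edge_config_algebra by (rule sigma_sets_mono')
  qed
  interpret M: prob_space \<mu> using \<mu> by (simp add: is_WUSF_def)
  interpret N: prob_space \<nu> using \<nu> by (simp add: is_WUSF_def)
  show ?thesis
  proof (rule measure_eqI_generator_eq[of E "Pow (edges G)" _ _ "\<lambda>_. Pow (edges G)"])
    show "sets \<mu> = sigma_sets (Pow (edges G)) E" "sets \<nu> = sigma_sets (Pow (edges G)) E"
      using s sigma by simp_all
    show "E \<subseteq> Pow (Pow (edges G))" unfolding E_def gen_def by blast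
    show "Int_stable E"
    proof (rule Int_stableI)
      fix a b assume "a \<in> E" "b \<in> E"
      then obtain S R where "finite S" "S \<subseteq> edges G" "finite R" "R \<subseteq> edges G" "a = gen S" "b = gen R"
        unfolding E_def by blast
      moreover have "gen S \<inter> gen R = gen (S \<union> R)" unfolding gen_def by blast
      ultimately show "a \<inter> b \<in> E" unfolding E_def by (intro image_eqI[of _ _ "S \<union> R"]) simp_all
    qed
    show "emeasure \<mu> X = emeasure \<nu> X" if X: "X \<in> E" for X
    proof -
      obtain S where S: "finite S" "S \<subseteq> edges G" "X = gen S" using X unfolding E_def by blast
      let ?u = "\<lambda>n. measure_pmf.prob (UST (wired G (verts (Gs n)))) {T. S \<subseteq> T}"
      have "?u \<longlonglongrightarrow> measure \<mu> {F \<in> space \<mu>. S \<subseteq> F}" "?u \<longlonglongrightarrow> measure \<nu> {F \<in> space \<nu>. S \<subseteq> F}"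
        using \<mu> \<nu> ex S(1,2) unfolding is_WUSF_def by blast+
      then have "measure \<mu> X = measure \<nu> X"
        unfolding S(3) gen_def sp by (rule LIMSEQ_unique)
      then show ?thesis by (simp add: M.emeasure_eq_measure N.emeasure_eq_measure)
    qed
    have "Pow (edges G) = gen {}" unfolding gen_def by blast
    then show "range (\<lambda>_ :: nat. Pow (edges G)) \<subseteq> E"
      unfolding E_def by (intro image_subsetI image_eqI[of _ _ "{}"]) simp_all
    show "emeasure \<mu> (Pow (edges G)) \<noteq> \<infinity>" for i :: nat by (simp add: M.emeasure_eq_measure)
  qed simp
qed

lemma finite_gw_ball: "finite {w \<in> gw_verts \<omega>. length w \<le> n}"
proof (induction n)
  case (Suc n)
  have "{w \<in> gw_verts \<omega>. length w \<le> Suc n}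
     \<subseteq> insert [] (\<Union>v\<in>{w \<in> gw_verts \<omega>. length w \<le> n}. (\<lambda>i. v @ [i]) ` {..<\<omega> v})"
  proof
    fix w assume "w \<in> {w \<in> gw_verts \<omega>. length w \<le> Suc n}"
    then show "w \<in> insert [] (\<Union>v\<in>{w \<in> gw_verts \<omega>. length w \<le> n}. (\<lambda>i. v @ [i]) ` {..<\<omega> v})"
      by (cases w rule: rev_cases) (auto simp: gw_verts_snoc)
  qed
  then show ?case by (rule finite_subset) (use Suc in auto)
qed simp

lemma exhaustion_gw_balls:
  "exhaustion (gw_tree \<omega>) (\<lambda>n. induced (gw_tree \<omega>) {w. length w \<le> n})"
proof -
  let ?B = "\<lambda>n. induced (gw_tree \<omega>) {w. length w \<le> n}"
  have v: "verts (?B n) = {w \<in> gw_verts \<omega>. length w \<le> n}" for n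
    by (auto simp: induced_def gw_tree_def)
  have e: "edges (?B n) = {e \<in> edges (gw_tree \<omega>). e \<subseteq> {w. length w \<le> n}}" for n
    by (auto simp: induced_def gw_tree_def)
  have en: "ends (?B n) = (\<lambda>e. e)" "ends (gw_tree \<omega>) = (\<lambda>e. e)" for n
    by (auto simp: induced_def gw_tree_def)
  have vt: "verts (gw_tree \<omega>) = gw_verts \<omega>" by (simp add: gw_tree_def)
  have fin: "finite (verts (?B n))" for n using finite_gw_ball by (simp add: v)
  have eP: "edges (?B n) \<subseteq> Pow (verts (?B n))" for n
    by (auto simp: e v edges_gw_tree gw_verts_snoc)
  have card: "card e = 1 \<or> card e = 2" if "e \<in> edges (gw_tree \<omega>)" for e
    using that by (auto simp: edges_gw_tree)
  have wf: "wf_graph (?B n)" for n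
    using eP card by (auto simp: wf_graph_def en e)
  have root: "(adj (?B n))\<^sup>*\<^sup>* w []" if "w \<in> verts (?B n)" for n w
    using that
  proof (induction w rule: rev_induct)
    case (snoc i w)
    then have "adj (?B n) (w @ [i]) w" "w \<in> verts (?B n)"
      unfolding adj_def en by (auto simp: v e gw_verts_snoc edges_gw_tree intro!: bexI[of _ "{w @ [i], w}"])
    then show ?case using snoc.IH by (auto intro: converse_rtranclp_into_rtranclp)
  qed simp
  have con: "connected_graph (?B n)" for n
    unfolding connected_graph_def reachable_iff
  proof (intro conjI ballI)
    have "[] \<in> verts (?B n)" by (simp add: v)
    then show "verts (?B n) \<noteq> {}" by blast
    fix x y assume "x \<in> verts (?B n)" "y \<in> verts (?B n)"
    then show "(adj (?B n))\<^sup>*\<^sup>* x y" by (intro rtranclp_trans[OF root rtranclp_adj_sym[OF root]])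
  qed
  show ?thesis
    unfolding exhaustion_def
  proof (intro conjI allI)
    fix n
    show "finite (verts (?B n))" "connected_graph (?B n)" by (fact fin con)+
    show "finite (edges (?B n))" using fin eP by (meson finite_Pow_iff finite_subset)
    have "verts (?B n) \<subseteq> verts (gw_tree \<omega>)" "verts (?B n) \<subseteq> verts (?B (Suc n))"
      unfolding v vt by auto
    moreover have "edges (?B n) \<subseteq> edges (gw_tree \<omega>)" "edges (?B n) \<subseteq> edges (?B (Suc n))"
      unfolding e by auto
    ultimately show "subgraph (?B n) (gw_tree \<omega>)" "subgraph (?B n) (?B (Suc n))"
      using wf unfolding subgraph_def en by simp_all
    show "(\<Union>n. verts (?B n)) = verts (gw_tree \<omega>)" unfolding v vt by auto
    have "\<exists>n. f \<in> edges (?B n)" if f: "f \<in> edges (gw_tree \<omega>)" for f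
    proof -
      obtain u i where "f = {u, u @ [i]}" using f by (auto simp: edges_gw_tree)
      then have "f \<in> edges (?B (Suc (length u)))" using f unfolding e by simp
      then show ?thesis by blast
    qed
    moreover have "edges (?B n) \<subseteq> edges (gw_tree \<omega>)" for n unfolding e by auto
    ultimately show "(\<Union>n. edges (?B n)) = edges (gw_tree \<omega>)" by blast
  qed
qed

lemma WUSF_gw_tree:
  assumes "0 < escape UNIV \<omega> []"
  shows "WUSF (gw_tree \<omega>)
    = distr (orient_measure \<omega> (escape UNIV \<omega>)) (edge_config_algebra (gw_tree \<omega>)) (forest_of \<omega>)"
  unfolding WUSF_def
  using is_WUSF_forest_of[OF assms] is_WUSF_unique[OF exhaustion_gw_balls] by (intro the_equality) auto

section \<open>Independence and the finiteness of the past\<close>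

text \<open>Coordinates outside \<open>K\<close> are constant on the product space. Hence a
  predicate such as \<open>reach_up\<close> can be treated over any index set without tracking which
  coordinates it reads.\<close>

lemma measurable_PiM_coord_any:
  "(\<lambda>x. x u) \<in> PiM K (\<lambda>v. measure_pmf (q v)) \<rightarrow>\<^sub>M count_space UNIV"
proof (cases "u \<in> K")
  case True
  then show ?thesis
    by (rule measurable_compose[OF measurable_component_singleton]) auto
next
  case False
  then have "x u = undefined" if "x \<in> space (PiM K (\<lambda>v. measure_pmf (q v)))" for x
    using that by (auto simp: space_PiM PiE_def extensional_def)
  then show ?thesis by (subst measurable_cong[where g = "\<lambda>_. undefined"]) auto
qed

text \<open>Independence of events that read disjoint blocks of coordinates; \<open>dep\<close>
  expresses that \<open>Q j\<close> reads only the block \<open>K j\<close>.\<close>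

lemma PiM_prob_indep:
  fixes q :: "'i \<Rightarrow> 'a pmf" and K :: "'j \<Rightarrow> 'i set"
  assumes J: "finite J" "disjoint_family_on K J"
    and meas: "\<And>j. j \<in> J \<Longrightarrow> Measurable.pred (PiM (K j) (\<lambda>v. measure_pmf (q v))) (Q j)"
    and dep: "\<And>j x. j \<in> J \<Longrightarrow> Q j (restrict x (K j)) \<longleftrightarrow> Q j x"
  shows "measure (PiM UNIV (\<lambda>v. measure_pmf (q v))) {x. \<forall>j\<in>J. Q j x}
    = (\<Prod>j\<in>J. measure (PiM UNIV (\<lambda>v. measure_pmf (q v))) {x. Q j x})"
proof (cases "J = {}")
  case False
  let ?M = "PiM UNIV (\<lambda>v. measure_pmf (q v))"
  interpret product_prob_space "\<lambda>v. measure_pmf (q v)" UNIV by unfold_locales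
  have sp: "space ?M = UNIV" by (simp add: space_PiM)
  have "indep_vars (\<lambda>v. measure_pmf (q v)) (\<lambda>v x. x v) UNIV"
    by (subst indep_vars_iff_distr_eq_PiM)
      (auto simp: restrict_UNIV PiM_component distr_id2 intro!: measurable_component_singleton)
  from indep_vars_restrict[OF this, of J K] J
  have ind: "indep_vars (\<lambda>j. PiM (K j) (\<lambda>v. measure_pmf (q v))) (\<lambda>j x. restrict (\<lambda>v. x v) (K j)) J"
    by simp
  define Y where "Y j = {y \<in> space (PiM (K j) (\<lambda>v. measure_pmf (q v))). Q j y}" for j
  have Y: "Y j \<in> sets (PiM (K j) (\<lambda>v. measure_pmf (q v)))" if "j \<in> J" for j
    unfolding Y_def using meas[OF that] by measurable
  have pre: "(\<lambda>x. restrict (\<lambda>v. x v) (K j)) -` Y j \<inter> space ?M = {x. Q j x}" if "j \<in> J" for j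
    using dep[OF that] by (auto simp: Y_def sp space_PiM)
  have "measure ?M (\<Inter>j\<in>J. (\<lambda>x. restrict (\<lambda>v. x v) (K j)) -` Y j \<inter> space ?M)
      = (\<Prod>j\<in>J. measure ?M ((\<lambda>x. restrict (\<lambda>v. x v) (K j)) -` Y j \<inter> space ?M))"
    using Y J(1) False by (intro indep_varsD[OF ind]) auto
  also have "(\<Inter>j\<in>J. (\<lambda>x. restrict (\<lambda>v. x v) (K j)) -` Y j \<inter> space ?M) = {x. \<forall>j\<in>J. Q j x}"
    using pre by auto
  also have "(\<Prod>j\<in>J. measure ?M ((\<lambda>x. restrict (\<lambda>v. x v) (K j)) -` Y j \<inter> space ?M))
      = (\<Prod>j\<in>J. measure ?M {x. Q j x})"
    by (rule prod.cong[OF refl]) (simp only: pre)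
  finally show ?thesis .
next
  case True
  interpret product_prob_space "\<lambda>v. measure_pmf (q v)" UNIV by unfold_locales
  have "space (PiM UNIV (\<lambda>v. measure_pmf (q v))) = UNIV" by (simp add: space_PiM)
  then show ?thesis using True P.prob_space by simp
qed

text \<open>Only flags are inspected. An unset flag is necessary for a path to climb, and flags at
  different vertices are independent, whereas the true directions are not.\<close>

primrec reach_up :: "(nat list \<Rightarrow> nat) \<Rightarrow> nat \<Rightarrow> nat list \<Rightarrow> (nat list \<Rightarrow> bool \<times> nat) \<Rightarrow> bool" where
  "reach_up \<omega> 0 v x \<longleftrightarrow> True"
| "reach_up \<omega> (Suc n) v x \<longleftrightarrow> (\<exists>i<\<omega> v. \<not> fst (x (v @ [i])) \<and> reach_up \<omega> n (v @ [i]) x)"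

lemma reach_up_cong:
  "(\<And>w. w \<noteq> [] \<Longrightarrow> x (v @ w) = y (v @ w)) \<Longrightarrow> reach_up \<omega> n v x \<longleftrightarrow> reach_up \<omega> n v y"
proof (induction n arbitrary: v)
  case (Suc n)
  have "reach_up \<omega> n (v @ [i]) x \<longleftrightarrow> reach_up \<omega> n (v @ [i]) y" for i
    using Suc.prems[of "i # w" for w] by (intro Suc.IH) simp
  then show ?case using Suc.prems[of "[i]" for i] by simp
qed simp

lemma measurable_reach_up [measurable]:
  "Measurable.pred (PiM K (\<lambda>v. measure_pmf (q v))) (reach_up \<omega> n v)"
proof (induction n arbitrary: v)
  case 0
  show ?case by simp
next
  case (Suc n)
  note [measurable] = Suc
  have [measurable]: "Measurable.pred (PiM K (\<lambda>v. measure_pmf (q v))) (\<lambda>x. fst (x u))" for u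
    by (rule measurable_compose[OF measurable_PiM_coord_any]) simp
  show ?case unfolding reach_up.simps by measurable
qed

text \<open>Independence is used twice: between the flag of a child and the flags strictly below it,
  and between the subtrees of different children. The result is the recursion of
  \<open>perc_upto\<close>.\<close>

lemma prob_reach_up:
  assumes b: "\<And>v. 0 \<le> b v \<and> b v \<le> 1"
  shows "measure (orient_measure \<omega> b) {x. reach_up \<omega> n v x} = perc_upto (\<lambda>v. 1 - b v) \<omega> n v"
proof (induction n arbitrary: v)
  case 0
  interpret P: prob_space "orient_measure \<omega> b" by (rule prob_space_orient_measure)
  show ?case using P.prob_space by simp
next
  case (Suc n)
  interpret P: prob_space "orient_measure \<omega> b" by (rule prob_space_orient_measure)
  have [measurable]: "Measurable.pred (orient_measure \<omega> b) (reach_up \<omega> n v)" for n v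
    unfolding orient_measure_def by measurable
  let ?up = "\<lambda>i x. \<not> fst (x (v @ [i])) \<and> reach_up \<omega> n (v @ [i]) x"
  have up: "P.prob {x. ?up i x} = (1 - b (v @ [i])) * perc_upto (\<lambda>v. 1 - b v) \<omega> n (v @ [i])" for i
  proof -
    define Q where "Q j x = (if j = (0::nat) then \<not> fst (x (v @ [i])) else reach_up \<omega> n (v @ [i]) x)"
      for j and x :: "nat list \<Rightarrow> bool \<times> nat"
    define K where "K j = (if j = (0::nat) then {v @ [i]} else {v @ [i] @ w | w. w \<noteq> []})" for j
    have "P.prob {x. \<forall>j\<in>{0, 1}. Q j x} = (\<Prod>j\<in>{0, 1}. P.prob {x. Q j x})"
      unfolding orient_measure_def
    proof (rule PiM_prob_indep)
      show "disjoint_family_on K {0, 1}" by (auto simp: disjoint_family_on_def K_def)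
      fix j :: nat
      have "Measurable.pred (PiM (K j) (\<lambda>v. measure_pmf (vertex_law \<omega> b v))) (\<lambda>x. fst (x u))" for u
        by (rule measurable_compose[OF measurable_PiM_coord_any]) simp
      then show "Measurable.pred (PiM (K j) (\<lambda>v. measure_pmf (vertex_law \<omega> b v))) (Q j)"
        unfolding Q_def by (cases "j = 0") (simp_all add: measurable_reach_up)
      have "reach_up \<omega> n (v @ [i]) (restrict x (K 1)) \<longleftrightarrow> reach_up \<omega> n (v @ [i]) x" for x
        by (rule reach_up_cong) (auto simp: K_def)
      then show "Q j (restrict x (K j)) \<longleftrightarrow> Q j x" for x
        unfolding Q_def by (cases "j = 0") (auto simp: K_def)
    qed simp
    moreover have "P.prob {x. \<not> fst (x (v @ [i]))} = 1 - b (v @ [i])"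
    proof -
      have eq: "{x. \<not> fst (x (v @ [i]))} = {x. \<forall>u\<in>{v @ [i]}. x u \<in> {False} \<times> UNIV}"
        by (auto simp: mem_Times_iff)
      have "P.prob {x. \<not> fst (x (v @ [i]))} = measure_pmf.prob (vertex_law \<omega> b (v @ [i])) ({False} \<times> UNIV)"
        unfolding eq by (subst prob_orient_measure_cylinder) auto
      also have "\<dots> = 1 - b (v @ [i])"
        using b[of "v @ [i]"] unfolding vertex_law_def
        by (subst measure_pmf_prob_product) (auto simp: measure_pmf_single)
      finally show ?thesis .
    qed
    moreover have "{x. \<forall>j\<in>{0, 1}. Q j x} = {x. ?up i x}" by (auto simp: Q_def)
    ultimately show ?thesis by (simp add: Q_def Suc)
  qed
  have ev: "{x. ?up i x} \<in> P.events" for i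
  proof -
    have "{x\<in>space (orient_measure \<omega> b). ?up i x} \<in> P.events" by measurable
    then show ?thesis by simp
  qed
  have "P.prob {x. \<forall>i\<in>{..<\<omega> v}. \<not> ?up i x} = (\<Prod>i\<in>{..<\<omega> v}. P.prob {x. \<not> ?up i x})"
    unfolding orient_measure_def
  proof (rule PiM_prob_indep[where K = "\<lambda>i. {v @ [i] @ w | w. True}"])
    show "disjoint_family_on (\<lambda>i. {v @ [i] @ w | w. True}) {..<\<omega> v}"
      by (auto simp: disjoint_family_on_def)
    fix i
    have [measurable]: "Measurable.pred (PiM {v @ [i] @ w | w. True} (\<lambda>v. measure_pmf (vertex_law \<omega> b v))) (\<lambda>x. fst (x u))" for u
      by (rule measurable_compose[OF measurable_PiM_coord_any]) simp
    show "Measurable.pred (PiM {v @ [i] @ w | w. True} (\<lambda>v. measure_pmf (vertex_law \<omega> b v))) (\<lambda>x. \<not> ?up i x)"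
      by measurable
    show "(\<not> ?up i (restrict x {v @ [i] @ w | w. True})) \<longleftrightarrow> (\<not> ?up i x)" for x
      using reach_up_cong[where v = "v @ [i]" and x = "restrict x {v @ [i] @ w | w. True}"
          and y = x and \<omega> = \<omega> and n = n] by auto
  qed simp
  also have "\<dots> = (\<Prod>i<\<omega> v. 1 - (1 - b (v @ [i])) * perc_upto (\<lambda>v. 1 - b v) \<omega> n (v @ [i]))"
  proof (rule prod.cong[OF refl])
    fix i
    have "P.prob {x. \<not> ?up i x} = 1 - P.prob {x. ?up i x}"
      using P.prob_compl[OF ev[of i]] by (simp add: set_diff_eq)
    then show "P.prob {x. \<not> ?up i x} = 1 - (1 - b (v @ [i])) * perc_upto (\<lambda>v. 1 - b v) \<omega> n (v @ [i])"
      using up by simp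
  qed
  finally have compl: "P.prob {x. \<forall>i\<in>{..<\<omega> v}. \<not> ?up i x}
      = (\<Prod>i<\<omega> v. 1 - (1 - b (v @ [i])) * perc_upto (\<lambda>v. 1 - b v) \<omega> n (v @ [i]))" .
  have "{x\<in>space (orient_measure \<omega> b). reach_up \<omega> (Suc n) v x} \<in> P.events" by measurable
  then have evS: "{x. reach_up \<omega> (Suc n) v x} \<in> P.events" by simp
  have "P.prob {x. \<forall>i\<in>{..<\<omega> v}. \<not> ?up i x} = 1 - P.prob {x. reach_up \<omega> (Suc n) v x}"
    using P.prob_compl[OF evS] by (simp add: set_diff_eq Ball_def)
  then show ?case using compl by simp
qed

lemma AE_finite_past:
  assumes "past_prob \<omega> v = 0"
  shows "AE x in orient_measure \<omega> (escape UNIV \<omega>). \<exists>n. \<not> reach_up \<omega> n v x"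
proof -
  interpret P: prob_space "orient_measure \<omega> (escape UNIV \<omega>)" by (rule prob_space_orient_measure)
  have [measurable]: "Measurable.pred (orient_measure \<omega> (escape UNIV \<omega>)) (reach_up \<omega> n v)" for n
    unfolding orient_measure_def by measurable
  let ?A = "{x. \<forall>n. reach_up \<omega> n v x}"
  have ev: "{x. reach_up \<omega> n v x} \<in> P.events" for n
  proof -
    have "{x\<in>space (orient_measure \<omega> (escape UNIV \<omega>)). reach_up \<omega> n v x} \<in> P.events" by measurable
    then show ?thesis by simp
  qed
  have A: "?A \<in> P.events"
  proof -
    have "{x\<in>space (orient_measure \<omega> (escape UNIV \<omega>)). \<forall>n. reach_up \<omega> n v x} \<in> P.events" by measurable
    then show ?thesis by simp
  qed
  have "P.prob ?A \<le> perc_upto (retain \<omega>) \<omega> n v" for n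
  proof -
    have "P.prob ?A \<le> P.prob {x. reach_up \<omega> n v x}" using ev by (intro P.finite_measure_mono) auto
    then show ?thesis using prob_reach_up[of "escape UNIV \<omega>" \<omega> n v] by (simp add: retain_def[abs_def])
  qed
  then have "P.prob ?A \<le> perc (retain \<omega>) \<omega> v"
    by (intro LIMSEQ_le_const[OF perc_upto_LIMSEQ[OF retain_bounds]]) auto
  then have "P.prob ?A = 0" using assms measure_nonneg[of _ ?A] by (simp add: past_prob_def order_antisym)
  then have "AE x in orient_measure \<omega> (escape UNIV \<omega>). x \<notin> ?A" using A by (simp add: P.prob_eq_0)
  then show ?thesis by simp
qed

section \<open>One-endedness\<close>

definition forest_step :: "'v set set \<Rightarrow> 'v set \<Rightarrow> 'v \<Rightarrow> 'v \<Rightarrow> bool" where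
  "forest_step F W a b \<longleftrightarrow> {a, b} \<in> F \<and> a \<notin> W \<and> b \<notin> W"

text \<open>A form of one-endedness of all components that is built from countable operations and is
  therefore measurable; finite sets of vertices are represented by lists for this reason.\<close>

definition all_one_ended :: "'v set \<Rightarrow> 'v set set \<Rightarrow> bool" where
  "all_one_ended V F \<longleftrightarrow>
     (\<forall>v\<in>V. \<forall>A. \<exists>u. u \<notin> set A \<and> (forest_step F {})\<^sup>*\<^sup>* v u) \<and>
     (\<forall>W. \<exists>P. \<forall>x y. x \<notin> set P \<longrightarrow> y \<notin> set P \<longrightarrow> (forest_step F {})\<^sup>*\<^sup>* x y \<longrightarrow> (forest_step F (set W))\<^sup>*\<^sup>* x y)"

lemma forest_step_sym: "forest_step F W a b \<Longrightarrow> forest_step F W b a"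
  by (simp add: forest_step_def insert_commute)

lemma forest_steps_sym: "(forest_step F W)\<^sup>*\<^sup>* a b \<Longrightarrow> (forest_step F W)\<^sup>*\<^sup>* b a"
  by (induction rule: rtranclp_induct) (auto intro: forest_step_sym converse_rtranclp_into_rtranclp)

lemma verts_induced: "verts (induced G U) = verts G \<inter> U"
  by (simp add: induced_def)

lemma reachable_set_eq:
  assumes "(adj G)\<^sup>*\<^sup>* a b"
  shows "{u. reachable G a u} = {u. reachable G b u}"
proof -
  have "(adj G)\<^sup>*\<^sup>* a u \<longleftrightarrow> (adj G)\<^sup>*\<^sup>* b u" for u
    using rtranclp_trans[OF assms, of u] rtranclp_trans[OF rtranclp_adj_sym[OF assms], of u] by blast
  then show ?thesis by (simp add: reachable_iff)
qed

text \<open>Two infinite components left after deleting \<open>W\<close> both contain vertices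
  outside the finite set \<open>P\<close>. These are joined in the forest, hence joined off
  \<open>W\<close>, so the components coincide. The first clause of \<open>all_one_ended\<close>
  makes the component infinite, and \<open>W = {}\<close> attains the count 1.\<close>

lemma all_one_ended_imp_one_ended:
  assumes F: "F \<subseteq> edges (gw_tree \<omega>)" and one: "all_one_ended (gw_verts \<omega>) F"
    and K: "K \<in> graph_components ((gw_tree \<omega>)\<lparr>edges := F\<rparr>)"
  shows "one_ended K"
proof -
  let ?G = "(gw_tree \<omega>)\<lparr>edges := F\<rparr>"
  have FV: "a \<in> gw_verts \<omega>" if "{a, b} \<in> F" for a b
  proof -
    have "{a, b} \<in> edges (gw_tree \<omega>)" using that F by blast
    then obtain u i where "{a, b} = {u, u @ [i]}" "u @ [i] \<in> gw_verts \<omega>" unfolding edges_gw_tree by blast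
    then show ?thesis by (auto simp: doubleton_eq_iff gw_verts_snoc)
  qed
  have adjG: "adj ?G = forest_step F {}"
  proof (intro ext iffI)
    fix a b assume "forest_step F {} a b"
    then have "{a, b} \<in> F" by (simp add: forest_step_def)
    then show "adj ?G a b" using FV[of a b] FV[of b a] by (auto simp: adj_def gw_tree_def insert_commute)
  qed (auto simp: adj_def gw_tree_def forest_step_def)
  obtain v where v: "v \<in> gw_verts \<omega>" and Kv: "K = induced ?G {u. reachable ?G v u}"
    using K by (auto simp: graph_components_def gw_tree_def)
  have reach_in: "u \<in> gw_verts \<omega>" if "(forest_step F {})\<^sup>*\<^sup>* v u" for u
    using that
  proof (cases rule: rtranclp.cases)
    case (rtrancl_into_rtrancl b)
    then have "{u, b} \<in> F" by (auto simp: forest_step_def insert_commute)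
    then show ?thesis by (rule FV)
  qed (use v in auto)
  define C where "C = {u. (forest_step F {})\<^sup>*\<^sup>* v u}"
  have reach_C: "{u. reachable ?G v u} = C"
  proof -
    have "verts ?G = gw_verts \<omega>" by (simp add: gw_tree_def)
    then show ?thesis unfolding C_def reachable_iff adjG using reach_in by blast
  qed
  have C_sub: "C \<subseteq> gw_verts \<omega>" using reach_in by (auto simp: C_def)
  have K_C: "K = induced ?G C" unfolding Kv reach_C ..
  have VK: "verts K = C" using C_sub by (auto simp: K_C induced_def gw_tree_def)
  have EK: "edges K = {e \<in> F. e \<subseteq> C}" and endsK: "ends K = (\<lambda>e. e)"
    by (auto simp: K_C induced_def gw_tree_def)
  have infC: "infinite C"
  proof
    assume "finite C"
    then obtain A where "set A = C" using finite_list by blast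
    then show False using one v unfolding all_one_ended_def C_def by blast
  qed
  have C_step: "b \<in> C" if "a \<in> C" "{a, b} \<in> F" for a b
    using that by (auto simp: C_def forest_step_def intro: rtranclp.rtrancl_into_rtrancl)
  let ?L = "\<lambda>W. induced K (verts K - W)"
  have adjL: "adj (?L W) a b \<longleftrightarrow> a \<in> C \<and> forest_step F W a b" for W a b
    using C_step by (auto simp: adj_def induced_def VK EK endsK forest_step_def)
  have stepsL: "(adj (?L W))\<^sup>*\<^sup>* a b" if "(forest_step F W)\<^sup>*\<^sup>* a b" "a \<in> C" for W a b
    using that
  proof (induction rule: converse_rtranclp_induct)
    case (step x y)
    then have "y \<in> C" using C_step by (auto simp: forest_step_def)
    then show ?case using step adjL by (auto intro: converse_rtranclp_into_rtranclp)
  qed simp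
  have VL: "verts (?L W) = C - W" for W by (auto simp: induced_def VK)
  have eq: "X = Y" if W: "finite W"
    and X: "X \<in> infinite_components_without K W" and Y: "Y \<in> infinite_components_without K W" for W X Y
  proof -
    obtain Wl where Wl: "set Wl = W" using finite_list[OF W] by blast
    have "\<exists>P. \<forall>x y. x \<notin> set P \<longrightarrow> y \<notin> set P \<longrightarrow> (forest_step F {})\<^sup>*\<^sup>* x y
        \<longrightarrow> (forest_step F (set Wl))\<^sup>*\<^sup>* x y"
      using one[unfolded all_one_ended_def, THEN conjunct2] by (rule spec)
    then obtain P where P: "\<forall>x y. x \<notin> set P \<longrightarrow> y \<notin> set P \<longrightarrow> (forest_step F {})\<^sup>*\<^sup>* x y
        \<longrightarrow> (forest_step F W)\<^sup>*\<^sup>* x y" unfolding Wl by (rule exE)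
    have comp: "\<exists>a. Z = induced (?L W) {u. reachable (?L W) a u} \<and> a \<in> C - set P"
      if Z: "Z \<in> infinite_components_without K W" for Z
    proof -
      obtain z where z: "Z = induced (?L W) {u. reachable (?L W) z u}" "infinite (verts Z)"
        using Z by (auto simp: infinite_components_without_def graph_components_def)
      have "infinite (verts Z - set P)" using z(2) by simp
      then have "verts Z - set P \<noteq> {}" by (rule infinite_imp_nonempty)
      then obtain a where a: "a \<in> verts Z" "a \<notin> set P" by blast
      have "verts Z = (C - W) \<inter> {u. reachable (?L W) z u}"
        unfolding z(1) VL[symmetric] by (rule verts_induced)
      then have "a \<in> C - W" and za: "(adj (?L W))\<^sup>*\<^sup>* z a"
        using a(1) unfolding reachable_iff by blast+
      then have "Z = induced (?L W) {u. reachable (?L W) a u} \<and> a \<in> C - set P"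
        using z(1) a(2) reachable_set_eq[OF za] by simp
      then show ?thesis by blast
    qed
    obtain a where "X = induced (?L W) {u. reachable (?L W) a u} \<and> a \<in> C - set P"
      using comp[OF X] by (rule exE)
    note a = this[THEN conjunct1] this[THEN conjunct2]
    obtain c where "Y = induced (?L W) {u. reachable (?L W) c u} \<and> c \<in> C - set P"
      using comp[OF Y] by (rule exE)
    note c = this[THEN conjunct1] this[THEN conjunct2]
    have "(forest_step F {})\<^sup>*\<^sup>* a c"
    proof (rule rtranclp_trans)
      show "(forest_step F {})\<^sup>*\<^sup>* a v" using a(2) by (simp add: forest_steps_sym C_def)
      show "(forest_step F {})\<^sup>*\<^sup>* v c" using c(2) by (simp add: C_def)
    qed
    then have "(forest_step F W)\<^sup>*\<^sup>* a c" using P[rule_format, of a c] a(2) c(2) by simp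
    then have ac: "(adj (?L W))\<^sup>*\<^sup>* a c" using a(2) by (intro stepsL) simp_all
    show ?thesis unfolding a(1) c(1) reachable_set_eq[OF ac] ..
  qed
  have le1: "finite (infinite_components_without K W) \<and> card (infinite_components_without K W) \<le> 1"
    if W: "finite W" for W
  proof (cases "infinite_components_without K W = {}")
    case False
    then obtain X where "infinite_components_without K W = {X}" using eq[OF W] by blast
    then show ?thesis by simp
  qed simp
  have "infinite_components_without K {} \<noteq> {}"
  proof -
    let ?X = "induced (?L {}) {u. reachable (?L {}) v u}"
    have "C \<subseteq> verts ?X"
    proof
      fix u assume u: "u \<in> C"
      then have "(adj (?L {}))\<^sup>*\<^sup>* v u" by (intro stepsL) (auto simp: C_def)
      then show "u \<in> verts ?X" using u VL[of "{}"] by (simp add: verts_induced reachable_iff)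
    qed
    then have "infinite (verts ?X)" using infC infinite_super by blast
    moreover have "v \<in> verts (?L {})" unfolding VL by (simp add: C_def)
    ultimately have "?X \<in> infinite_components_without K {}"
      unfolding infinite_components_without_def graph_components_def by blast
    then show ?thesis by blast
  qed
  moreover have "finite (infinite_components_without K {})" "card (infinite_components_without K {}) \<le> 1"
    using le1[of "{}"] by simp_all
  ultimately have card1: "card (infinite_components_without K {}) = 1"
    using card_gt_0_iff[of "infinite_components_without K {}"] by linarith
  show ?thesis
    unfolding k_ended_def VK
  proof (intro conjI allI impI)
    show "\<exists>W. finite W \<and> W \<subseteq> C \<and> card (infinite_components_without K W) = 1"
      using card1 by (intro exI[of _ "{}"]) simp
  qed (use infC le1 in simp_all)
qed

text \<open>Writing the closure as a union of relational powers leaves only quantifiers over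
  countable types: numbers, words and lists of words.\<close>

lemma measurable_all_one_ended [measurable]:
  "Measurable.pred (edge_config_algebra (gw_tree \<omega>)) (all_one_ended (gw_verts \<omega>))"
proof -
  let ?M = "edge_config_algebra (gw_tree \<omega>)"
  have [measurable]: "Measurable.pred ?M (\<lambda>F. e \<in> F)" for e
  proof (cases "e \<in> edges (gw_tree \<omega>)")
    case True
    then have "{F \<in> Pow (edges (gw_tree \<omega>)). e \<in> F} \<in> sets ?M"
      unfolding sets_edge_config_algebra by (intro sigma_sets.Basic) auto
    then show ?thesis by (simp add: pred_def space_edge_config_algebra)
  next
    case False
    then have "e \<notin> F" if "F \<in> space ?M" for F using that by (auto simp: space_edge_config_algebra)
    then show ?thesis by (subst measurable_cong[where g = "\<lambda>_. False"]) auto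
  qed
  have [measurable]: "Measurable.pred ?M (\<lambda>F. (forest_step F W ^^ n) a b)" for W n and a b :: "nat list"
  proof (induction n arbitrary: b)
    case (Suc n)
    note [measurable] = Suc
    have eq: "(forest_step F W ^^ Suc n) a b \<longleftrightarrow>
        (\<exists>y. (forest_step F W ^^ n) a y \<and> {y, b} \<in> F \<and> y \<notin> W \<and> b \<notin> W)" for F
      by (simp add: relcompp_apply forest_step_def[of F W _ b])
    show ?case unfolding eq by measurable
  qed simp
  show ?thesis
    unfolding all_one_ended_def rtranclp_power by measurable
qed

text \<open>The set \<open>R\<close> is the union of the unflagged clusters hanging from the
  prefixes of \<open>v\<close>. A step up into a cluster comes from an unflagged child and so
  extends it; a step down comes from the parent, which lies in the same cluster or is the preceding
  prefix. Each cluster is finite because \<open>reach_up\<close> fails at some depth and degrees are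
  finite.\<close>

lemma past_closed_finite:
  assumes v: "v \<in> gw_verts \<omega>" and fin: "\<And>v. v \<in> gw_verts \<omega> \<Longrightarrow> \<exists>n. \<not> reach_up \<omega> n v x"
  obtains R where "finite R" "v \<in> R"
    "\<And>u. u \<in> gw_verts \<omega> \<Longrightarrow> next_vertex (orient x) u \<in> R \<Longrightarrow> u \<in> R"
proof -
  \<comment> \<open>The index \<open>Suc k\<close> starts the test strictly below \<open>a\<close>;
    the flag of \<open>a\<close> itself does not matter for its cluster.\<close>
  define Up where "Up a = {a @ w | w. a @ w \<in> gw_verts \<omega> \<and> (\<forall>k<length w. \<not> fst (x (a @ take (Suc k) w)))}" for a
  define R where "R = (\<Union>k\<le>length v. Up (take k v))"
  have prefix: "take k v \<in> gw_verts \<omega>" for k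
    using v gw_verts_append[of "take k v" "drop k v" \<omega>] by simp
  have reach: "reach_up \<omega> n a x"
    if "a @ w \<in> gw_verts \<omega>" "\<forall>k<length w. \<not> fst (x (a @ take (Suc k) w))" "n \<le> length w" for n a w
    using that
  proof (induction n arbitrary: a w)
    case (Suc n)
    then obtain i w' where w: "w = i # w'" by (cases w) auto
    have "reach_up \<omega> n (a @ [i]) x"
    proof (rule Suc.IH[of "a @ [i]" w'])
      show "\<forall>k<length w'. \<not> fst (x ((a @ [i]) @ take (Suc k) w'))"
      proof (intro allI impI)
        fix k assume "k < length w'"
        then have "\<not> fst (x (a @ take (Suc (Suc k)) w))" using Suc.prems(2) w by auto
        then show "\<not> fst (x ((a @ [i]) @ take (Suc k) w'))" using w by simp
      qed
    qed (use Suc.prems w in auto)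
    moreover have "\<not> fst (x (a @ [i]))" using Suc.prems(2)[rule_format, of 0] w by simp
    moreover have "i < \<omega> a" using Suc.prems(1) w by (simp add: gw_verts_append gw_verts_Cons subtree_def)
    ultimately show ?case by auto
  qed simp
  have finUp: "finite (Up a)" if "a \<in> gw_verts \<omega>" for a
  proof -
    obtain n where n: "\<not> reach_up \<omega> n a x" using fin \<open>a \<in> gw_verts \<omega>\<close> by blast
    have "Up a \<subseteq> {w \<in> gw_verts \<omega>. length w \<le> length a + n}"
    proof
      fix u assume "u \<in> Up a"
      then obtain w where w: "u = a @ w" "a @ w \<in> gw_verts \<omega>" "\<forall>k<length w. \<not> fst (x (a @ take (Suc k) w))"
        by (auto simp: Up_def)
      have "\<not> n \<le> length w" using reach[OF w(2,3)] n by blast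
      then show "u \<in> {w \<in> gw_verts \<omega>. length w \<le> length a + n}" using w by simp
    qed
    then show ?thesis by (rule finite_subset) (rule finite_gw_ball)
  qed
  show thesis
  proof (rule that)
    show "finite R" unfolding R_def using finUp prefix by auto
    have "v \<in> Up v" using v by (auto simp: Up_def)
    then show "v \<in> R" unfolding R_def by (intro UN_I[of "length v"]) auto
    fix u assume u: "u \<in> gw_verts \<omega>" and "next_vertex (orient x) u \<in> R"
    then obtain k where k: "k \<le> length v" "next_vertex (orient x) u \<in> Up (take k v)" by (auto simp: R_def)
    then obtain w where w: "next_vertex (orient x) u = take k v @ w" "take k v @ w \<in> gw_verts \<omega>"
      "\<forall>j<length w. \<not> fst (x (take k v @ take (Suc j) w))" by (auto simp: Up_def)
    show "u \<in> R"
    proof (cases "down x u")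
      case False
      then have "u \<noteq> []" "\<not> fst (x u)" using down_root down_flag by auto
      then obtain i where i: "u = next_vertex (orient x) u @ [i]"
        using False by (cases u rule: rev_cases) (auto simp: next_vertex_def orient_def)
      then have ui: "u = take k v @ (w @ [i])" using w(1) by simp
      moreover have "\<not> fst (x (take k v @ take (Suc j) (w @ [i])))" if "j < length (w @ [i])" for j
        using that w(3) \<open>\<not> fst (x u)\<close> ui by (cases "j < length w") (auto simp: less_Suc_eq)
      ultimately have "u \<in> Up (take k v)" using u unfolding Up_def by blast
      then show ?thesis using k(1) unfolding R_def by blast
    next
      case True
      define j where "j = snd (x u)"
      have uj: "u @ [j] = take k v @ w" using w(1) True by (simp add: next_vertex_def orient_def j_def)
      show ?thesis
      proof (cases w rule: rev_cases)
        \<comment> \<open>The top of a cluster is entered from above, so \<open>u\<close> is the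
          preceding prefix of \<open>v\<close> and the top of its own cluster.\<close>
        case Nil
        then have tk: "take k v = u @ [j]" using uj by simp
        then have "k \<noteq> 0" by (metis snoc_eq_iff_butlast take_0)
        have "butlast (take k v) = butlast (u @ [j])" using tk by (rule arg_cong)
        then have "u = take (k - 1) v" using k(1) by (simp add: butlast_take)
        moreover have "u \<in> Up u" using u by (auto simp: Up_def)
        ultimately have "u \<in> Up (take (k - 1) v)" by simp
        then show ?thesis unfolding R_def using k(1) by (intro UN_I[of "k - 1"]) auto
      next
        case (snoc w' i)
        then have uw: "u = take k v @ w'" using uj by simp
        have "\<not> fst (x (take k v @ take (Suc j) w'))" if "j < length w'" for j
          using w(3)[rule_format, of j] that snoc by simp
        then have "u \<in> Up (take k v)" using u uw unfolding Up_def by blast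
        then show ?thesis using k(1) unfolding R_def by blast
      qed
    qed
  qed
qed

text \<open>Each vertex has one forward path under \<open>f\<close>. It eventually goes down
  forever, so components are infinite. Forward paths from one component coalesce, and if both
  starting points lie outside the past of \<open>W\<close>, both paths avoid \<open>W\<close>. Thus
  \<open>P\<close> is the past of \<open>W\<close>, finite by
  \<open>past_closed_finite\<close>.\<close>

lemma forest_of_all_one_ended:
  assumes dn: "\<And>v. v \<in> gw_verts \<omega> \<Longrightarrow> down x v \<Longrightarrow> snd (x v) < \<omega> v"
    and fin: "\<And>v. v \<in> gw_verts \<omega> \<Longrightarrow> \<exists>n. \<not> reach_up \<omega> n v x"
  shows "all_one_ended (gw_verts \<omega>) (forest_of \<omega> x)"
proof -
  define f where "f = next_vertex (orient x)"
  let ?F = "forest_of \<omega> x" and ?V = "gw_verts \<omega>"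
  have f_down: "f v = v @ [snd (x v)]" "down x (f v)" if "down x v" for v
    using that down_step by (auto simp: f_def next_vertex_def orient_def)
  have f_up: "v = f v @ [last v]" "v \<noteq> []" if "\<not> down x v" for v
  proof -
    show "v \<noteq> []" using that down_root by auto
    then show "v = f v @ [last v]" using that by (simp add: f_def next_vertex_def orient_def)
  qed
  have fV: "f v \<in> ?V" and fE: "{v, f v} \<in> edges (gw_tree \<omega>)" if v: "v \<in> ?V" for v
  proof -
    have "f v \<in> ?V \<and> {v, f v} \<in> edges (gw_tree \<omega>)"
    proof (cases "down x v")
      case True
      then have "f v \<in> ?V" using f_down(1)[OF True] dn[OF v True] v by (simp add: gw_verts_snoc)
      then show ?thesis using f_down(1)[OF True] by (auto simp: edges_gw_tree)
    next
      case False
      define u i where "u = f v" and "i = last v"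
      have vi: "v = u @ [i]" using f_up(1)[OF False] by (simp add: u_def i_def)
      have "u \<in> ?V" using v unfolding vi by (simp add: gw_verts_snoc)
      moreover have "{v, u} \<in> edges (gw_tree \<omega>)"
        unfolding edges_gw_tree using v vi by (intro exI[of _ u] exI[of _ i]) auto
      ultimately show ?thesis by (simp add: u_def)
    qed
    then show "f v \<in> ?V" "{v, f v} \<in> edges (gw_tree \<omega>)" by auto
  qed
  have F_iff: "e \<in> ?F \<longleftrightarrow> (\<exists>v\<in>?V. e = {v, f v})" for e
    using fE by (auto simp: forest_of_def used_edges_def f_def)
  have funV: "(f ^^ n) v \<in> ?V" if "v \<in> ?V" for n v
    using that fV by (induction n) auto
  have orbit: "(forest_step ?F W)\<^sup>*\<^sup>* v ((f ^^ n) v)" if "v \<in> ?V" "\<And>m. (f ^^ m) v \<notin> W" for W n v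
  proof (induction n)
    case (Suc n)
    have "{(f ^^ n) v, f ((f ^^ n) v)} \<in> ?F" using funV[OF that(1)] F_iff by blast
    then have "forest_step ?F W ((f ^^ n) v) ((f ^^ Suc n) v)"
      using that(2)[of n] that(2)[of "Suc n"] by (simp add: forest_step_def)
    with Suc show ?case by (rule rtranclp.rtrancl_into_rtrancl)
  qed simp
  have long: "\<exists>n. N \<le> length ((f ^^ n) v)" for v N
  proof -
    have "\<exists>n. down x ((f ^^ n) v)"
    proof (induction "length v" arbitrary: v rule: less_induct)
      case less
      show ?case
      proof (cases "down x v")
        case True
        then show ?thesis by (intro exI[of _ 0]) simp
      next
        case False
        have "length v = length (f v @ [last v])" using f_up(1)[OF False] by (rule arg_cong)
        then obtain n where "down x ((f ^^ n) (f v))" using less[of "f v"] by auto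
        then show ?thesis by (intro exI[of _ "Suc n"]) (simp add: funpow_swap1)
      qed
    qed
    then obtain n where n: "down x ((f ^^ n) v)" by blast
    have "down x ((f ^^ (m + n)) v) \<and> m \<le> length ((f ^^ (m + n)) v)" for m
    proof (induction m)
      case (Suc m)
      then show ?case using f_down[of "(f ^^ (m + n)) v"] by simp
    qed (use n in simp)
    then show ?thesis by blast
  qed
  have coalesce: "\<exists>m n. (f ^^ m) a = (f ^^ n) b" if "(forest_step ?F {})\<^sup>*\<^sup>* a b" for a b
    using that
  proof (induction rule: rtranclp_induct)
    case base
    show ?case by blast
  next
    case (step y z)
    then obtain m n where mn: "(f ^^ m) a = (f ^^ n) y" by blast
    from step(2) have "z = f y \<or> y = f z" by (auto simp: forest_step_def F_iff doubleton_eq_iff)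
    then show ?case
    proof
      assume "z = f y"
      then have "(f ^^ Suc m) a = (f ^^ n) z" using mn by (simp add: funpow_swap1)
      then show ?thesis by blast
    next
      assume "y = f z"
      then have "(f ^^ m) a = (f ^^ Suc n) z" using mn by (simp add: funpow_swap1)
      then show ?thesis by blast
    qed
  qed
  have inV: "a \<in> ?V \<and> b \<in> ?V" if "forest_step ?F {} a b" for a b
    using that fV by (auto simp: forest_step_def F_iff doubleton_eq_iff)
  have past: "\<exists>R. finite R \<and> (\<forall>u\<in>?V. \<forall>n. (f ^^ n) u = w \<longrightarrow> u \<in> R)" for w
  proof (cases "w \<in> ?V")
    case True
    obtain R where R: "finite R" "w \<in> R" "\<And>u. u \<in> ?V \<Longrightarrow> f u \<in> R \<Longrightarrow> u \<in> R"
      using past_closed_finite[OF True fin] unfolding f_def by blast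
    have "u \<in> R" if "u \<in> ?V" "(f ^^ n) u = w" for u n
      using that
    proof (induction n arbitrary: u)
      case (Suc n)
      then have "f u \<in> R" using fV by (simp add: funpow_swap1)
      then show ?case using R(3) Suc.prems by blast
    qed (use R in simp)
    then show ?thesis using R(1) by blast
  qed (use funV in blast)
  show ?thesis
    unfolding all_one_ended_def
  proof (intro conjI ballI allI)
    fix v and A :: "nat list list"
    assume v: "v \<in> ?V"
    define N where "N = Suc (Max (insert 0 (length ` set A)))"
    obtain n where n: "N \<le> length ((f ^^ n) v)" using long by blast
    have "(f ^^ n) v \<notin> set A"
    proof
      assume "(f ^^ n) v \<in> set A"
      then have "length ((f ^^ n) v) \<le> Max (insert 0 (length ` set A))" by (intro Max_ge) auto
      then show False using n by (simp add: N_def)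
    qed
    then show "\<exists>u. u \<notin> set A \<and> (forest_step ?F {})\<^sup>*\<^sup>* v u" using orbit[OF v, of "{}" n] by blast
  next
    fix W :: "nat list list"
    obtain R where R: "\<And>w. finite (R w)" "\<And>w u n. u \<in> ?V \<Longrightarrow> (f ^^ n) u = w \<Longrightarrow> u \<in> R w"
      using past by metis
    have "finite (\<Union>w\<in>set W. R w)" using R(1) by blast
    then obtain P where P: "set P = (\<Union>w\<in>set W. R w)" using finite_list by blast
    have "(forest_step ?F (set W))\<^sup>*\<^sup>* a b"
      if ab: "a \<notin> set P" "b \<notin> set P" "(forest_step ?F {})\<^sup>*\<^sup>* a b" for a b
    proof (cases "a = b")
      case False
      obtain c where "forest_step ?F {} a c" using ab(3) False by (cases rule: converse_rtranclpE) auto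
      then have aV: "a \<in> ?V" using inV by blast
      obtain d where "forest_step ?F {} d b" using ab(3) False by (cases rule: rtranclp.cases) auto
      then have bV: "b \<in> ?V" using inV by blast
      have avoid: "(f ^^ m) u \<notin> set W" if "u \<in> ?V" "u \<notin> set P" for u m
        using R(2)[OF that(1) refl, of m] that(2) unfolding P by blast
      obtain m n where mn: "(f ^^ m) a = (f ^^ n) b" using coalesce[OF ab(3)] by blast
      have "(forest_step ?F (set W))\<^sup>*\<^sup>* a ((f ^^ m) a)" "(forest_step ?F (set W))\<^sup>*\<^sup>* b ((f ^^ n) b)"
        using avoid ab aV bV by (auto intro!: orbit)
      then show ?thesis using forest_steps_sym[of ?F "set W" b] unfolding mn by (meson rtranclp_trans)
    qed simp
    then show "\<exists>P. \<forall>a b. a \<notin> set P \<longrightarrow> b \<notin> set P \<longrightarrow> (forest_step ?F {})\<^sup>*\<^sup>* a b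
        \<longrightarrow> (forest_step ?F (set W))\<^sup>*\<^sup>* a b" by blast
  qed
qed

lemma AE_WUSF_one_ended:
  assumes pos: "0 < escape UNIV \<omega> []" and past: "\<And>v. past_prob \<omega> v = 0"
  shows "AE F in WUSF (gw_tree \<omega>). \<forall>K\<in>graph_components ((gw_tree \<omega>)\<lparr>edges := F\<rparr>). one_ended K"
proof -
  let ?P = "orient_measure \<omega> (escape UNIV \<omega>)" and ?M = "edge_config_algebra (gw_tree \<omega>)"
  have "AE x in ?P. \<forall>v\<in>UNIV. down x v \<longrightarrow> snd (x v) < \<omega> v"
    by (intro AE_down pos escape_nonneg escape_le_1 escape_child_sum UNIV_I)
  moreover have "AE x in ?P. \<forall>v. \<exists>n. \<not> reach_up \<omega> n v x"
    using AE_finite_past[OF past] by (intro AE_all_countable[THEN iffD2] allI)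
  ultimately have "AE x in ?P. all_one_ended (gw_verts \<omega>) (forest_of \<omega> x)"
    by eventually_elim (rule forest_of_all_one_ended, auto)
  moreover have "{F \<in> space ?M. all_one_ended (gw_verts \<omega>) F} \<in> sets ?M" by measurable
  ultimately have "AE F in WUSF (gw_tree \<omega>). all_one_ended (gw_verts \<omega>) F"
    unfolding WUSF_gw_tree[OF pos] by (subst AE_distr_iff) auto
  moreover have "AE F in WUSF (gw_tree \<omega>). F \<in> space (WUSF (gw_tree \<omega>))" by (rule AE_space)
  ultimately show ?thesis
  proof eventually_elim
    case (elim F)
    then have "F \<subseteq> edges (gw_tree \<omega>)" by (auto simp: WUSF_gw_tree[OF pos] space_edge_config_algebra)
    then show ?case using elim all_one_ended_imp_one_ended by blast
  qed
qed

theorem corollary2: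
  fixes p :: "nat pmf"
  assumes "supercritical p"
  shows "AE \<omega> in gw_survival_measure p. AE F in WUSF (gw_tree \<omega>).
    \<forall>K \<in> graph_components ((gw_tree \<omega>)\<lparr>edges := F\<rparr>). one_ended K"
  unfolding gw_survival_measure_def
proof (rule AE_uniform_measureI[OF survival_measurable])
  show "AE \<omega> in gw_measure p. \<omega> \<in> survival \<longrightarrow> (AE F in WUSF (gw_tree \<omega>).
    \<forall>K \<in> graph_components ((gw_tree \<omega>)\<lparr>edges := F\<rparr>). one_ended K)"
    using AE_survival_imp_escape[OF assms] AE_past_prob_0[OF assms]
  proof eventually_elim
    case (elim \<omega>)
    then show ?case using AE_WUSF_one_ended by blast
  qed
qed

end
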